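(* Let $\varphi_0\colon\mathbb P^1\to X_0\subset\mathfrak X$ be an embedding of a line into a component $\mathbb P^2_i$ of $X_0$ satisfying the condition $$(\ast)\qquad \varphi_0(\mathbb P^1)\cap L\subset\mathcal S .$$ Then the cohomology group $H^1(\mathbb P^1,\mathcal N)$ of the log normal sheaf $\mathcal N=\varphi_0^*\Theta_{X_0}/\Theta_{\mathbb P^1}$, which is the group containing the obstruction to the existence of a lift of $\varphi_0$, is isomorphic to the $1$-dimensional vector space $\mathbb C$, and its dual space $H^1(\mathbb P^1,\mathcal N)^\vee\cong H^0(\mathbb P^1,\mathcal N^\vee\otimes\omega_{\mathbb P^1})$ is canonically identified with the space of triples of vectors $$v_1\in\mathbb C\cdot f_1,\qquad v_2\in\mathbb C\cdot f_2,\qquad v_3\in\mathbb C\cdot(f_1-f_2)$$ in $M_{\mathbb C}$ satisfying $v_1+v_2+v_3=0$.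
   Context: Let $\mathfrak X=\{\bar x\bar y\bar z\bar w+tf=0\}\subset\mathbb P^3\times\mathbb C$, where $\bar x,\bar y,\bar z,\bar w$ are homogeneous coordinates on $\mathbb P^3$, $t$ is the coordinate on $\mathbb C$, and $f$ is a homogeneous quartic polynomial in $\bar x,\bar y,\bar z,\bar w$. Let $X_0$ be the fibre over $t=0$. It is the union of four coordinate planes $\mathbb P_1^2,\dots,\mathbb P_4^2$. Let $L$ be the union of the six coordinate lines (pairwise intersections of these planes), and let $\mathcal S\subset X_0$ be the set of singular points of $\mathfrak X$ lying on $X_0$, i.e. the $24$ points of $L\cap\{f=0\}$. The polynomial $f$ is assumed generic among those for which $\mathcal S\cap\mathbb P_i^2$ contains three collinear points, one on each of the three coordinate lines of $\mathbb P_i^2$; in particular $\mathcal S$ contains no torus fixed point. Log structures. Near a point of $\mathcal S$ with coordinates $(x,y,z)=(0,0,\alpha)$, $\alpha\ne0$, in an affine chart in which $\mathfrak X$ is $xyz+tf=0$ and the component is $\{y=t=0\}$, put $\tilde z=z-\alpha$ and write $f=\tilde zf_1(\tilde z)+xf_2(x,\tilde z)+yf_3$ (the coefficients $f_1,f_2,f_3$ are functions here). With $f_4=f_3/(\tilde z+\alpha)$ and $f_5=-f_2f_3/(\tilde z+\alpha)$, the functions $X=x+tf_4$, $Y=y(\tilde z+\alpha)+tf_2$, $Z=\tilde zf_1+tf_5$ identify $\mathfrak X$ locally with the toric variety $\{XY+tZ=0\}$ near the origin. A neighbourhood of $\varphi_0(\mathbb P^1)$ in $\mathfrak X$ carries the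 log structure which is the toric log structure of $XY+tZ=0$ near the points of $\varphi_0(\mathbb P^1)\cap\mathcal S$ and is pulled back from the toric log structure of $\operatorname{Spec}\mathbb C[t]$ elsewhere. $\Theta_{X_0}$ is the log tangent sheaf of $X_0$ (relative to the base log point) for the induced log structure. $\Theta_{\mathbb P^1}$ is the log tangent sheaf of $\mathbb P^1$ for the divisor $p_1+p_2+p_3=\varphi_0^{-1}(L)$. Explicitly, near such a point $\varphi_0^*\Theta_{X_0}$ is freely generated by $x\partial_x$ and $\tilde z\partial_z$, and it is the pullback of the usual tangent sheaf of $\mathbb P_i^2$ elsewhere. Consequently $\mathcal N$ is identified with the sheaf of sections of the usual normal sheaf $\mathcal Q$ of the line in $\mathbb P^2_i$ vanishing at $p_1,p_2,p_3$. The identification. $\mathbb P_i^2$ is viewed as the toric surface with fan in $N_{\mathbb R}$, $N=\mathbb Z^2$, with rays generated by $e_1=(1,0)$, $e_2=(0,1)$, $(-1,-1)$; $f_1,f_2$ (in the claim) is the basis of $M=\operatorname{Hom}(N,\mathbb Z)$ dual to $e_1,e_2$, and $M_{\mathbb C}=M\otimes\mathbb C$. With toric affine coordinates $x,z$ (so that $e_1=x\partial_x$, $e_2=z\partial_z$), $p_1,p_2,p_3$ are the points mapped to $[0,\alpha_1,1]$, $[\alpha_2,0,1]$, $[\alpha_3,\alpha_4,0]$. The sheaf $\mathcal Q$ is canonically the quotient of $N_{\mathbb C}\otimes\mathcal O_{\mathbb P^1}$ (the log tangent sheaf of the toric surface restricted to the line) by $\Theta_{\mathbb P^1}$, so the fibres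 of $\mathcal Q^\vee$ at $p_1,p_2,p_3$ are the subspaces $\mathbb Cf_2,\mathbb Cf_1,\mathbb C(f_1-f_2)$ of $M_{\mathbb C}$. A section of $\mathcal N^\vee\otimes\omega_{\mathbb P^1}$ is a $\mathcal Q^\vee$-valued $1$-form with at most simple poles at $p_1,p_2,p_3$; it is sent to its residues $v_1,v_2,v_3$ at $p_2,p_1,p_3$ respectively. *)

theory Defs
  imports "HOL-Complex_Analysis.Complex_Analysis"
    "HOL-Computational_Algebra.Computational_Algebra"
    "HOL-Computational_Algebra.Field_as_Ring"
    "HOL-Library.FuncSet"
    "HOL-Algebra.Module"
begin

definition complex_ring :: "complex ring" where
  "complex_ring = \<lparr>carrier = UNIV, mult = (*), one = 1, zero = 0, add = (+)\<rparr>"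

text \<open>Module records inherit a multiplication from rings, which modules do not use.\<close>

definition lin_mod :: "(complex \<Rightarrow> 'v \<Rightarrow> 'v) \<Rightarrow> 'v set \<Rightarrow> (complex, 'v::ab_group_add) module" where
  "lin_mod sc S = \<lparr>carrier = S, mult = undefined, one = undefined,
     zero = 0, add = (+), smult = sc\<rparr>"

definition quot_mod :: "(complex \<Rightarrow> 'v \<Rightarrow> 'v) \<Rightarrow> 'v set \<Rightarrow> 'v set
    \<Rightarrow> (complex, 'v::ab_group_add set) module" where
  "quot_mod sc B A = \<lparr>carrier = (\<lambda>v. (+) v ` A) ` B, mult = undefined, one = undefined,
     zero = A,
     add = (\<lambda>P Q. {x + y |x y. x \<in> P \<and> y \<in> Q}),
     smult = (\<lambda>c P. {sc c x + y |x y. x \<in> P \<and> y \<in> A})\<rparr>"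

definition linear_map :: "(complex, 'v) module \<Rightarrow> (complex, 'w) module \<Rightarrow> ('v \<Rightarrow> 'w) \<Rightarrow> bool" where
  "linear_map M N h \<longleftrightarrow> h \<in> carrier M \<rightarrow> carrier N \<and>
     (\<forall>x\<in>carrier M. \<forall>y\<in>carrier M. h (x \<oplus>\<^bsub>M\<^esub> y) = h x \<oplus>\<^bsub>N\<^esub> h y) \<and>
     (\<forall>c. \<forall>x\<in>carrier M. h (c \<odot>\<^bsub>M\<^esub> x) = c \<odot>\<^bsub>N\<^esub> h x)"

definition linear_iso :: "(complex, 'v) module \<Rightarrow> (complex, 'w) module \<Rightarrow> ('v \<Rightarrow> 'w) \<Rightarrow> bool" where
  "linear_iso M N h \<longleftrightarrow> Module.module complex_ring M \<and> Module.module complex_ring N \<and>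
     linear_map M N h \<and> bij_betw h (carrier M) (carrier N)"

abbreviation complex_line :: "(complex, complex) module" where
  "complex_line \<equiv> lin_mod (*) UNIV"

definition dual_space :: "(complex, 'v) module \<Rightarrow> (complex, 'v \<Rightarrow> complex) module" where
  "dual_space M =
     \<lparr>carrier = {\<psi> \<in> extensional (carrier M). linear_map M complex_line \<psi>},
      mult = undefined, one = undefined,
      zero = (\<lambda>x\<in>carrier M. 0),
      add = (\<lambda>\<psi> \<psi>'. \<lambda>x\<in>carrier M. \<psi> x + \<psi>' x),
      smult = (\<lambda>c \<psi>. \<lambda>x\<in>carrier M. c * \<psi> x)\<rparr>"

text \<open>A sheaf is given by a vector space at each point and, for every open set \<open>U\<close>, by a set
  of functions on \<open>U\<close> with values in these spaces; every sheaf arises in this way from its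
  stalks.\<close>

record ('p, 'v) sheaf =
  stalk :: "'p \<Rightarrow> (complex, 'v) module"
  sec :: "'p set \<Rightarrow> ('p \<Rightarrow> 'v) set"

text \<open>The quotient \<open>B/A\<close> of two subsheaves \<open>A \<subseteq> B\<close> of a constant sheaf, both given by their
  stalks: a section is a family of residue classes which locally comes from a section of \<open>B\<close>.\<close>

definition quot_sheaf :: "'p topology \<Rightarrow> (complex \<Rightarrow> 'v \<Rightarrow> 'v) \<Rightarrow> ('p \<Rightarrow> 'v set) \<Rightarrow> ('p \<Rightarrow> 'v set)
    \<Rightarrow> ('p, 'v::ab_group_add set) sheaf" where
  "quot_sheaf X sc B A =
     \<lparr>stalk = (\<lambda>q. quot_mod sc (B q) (A q)),
      sec = (\<lambda>U. {s \<in> (\<Pi>\<^sub>E q\<in>U. carrier (quot_mod sc (B q) (A q))).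
               \<forall>q\<in>U. \<exists>W v. openin X W \<and> q \<in> W \<and> W \<subseteq> U \<and>
                 (\<forall>w\<in>W. v \<in> B w \<and> s w = (+) v ` A w)})\<rparr>"

text \<open>The first cohomology is the direct limit of the Cech cohomology over all open covers,
  which agrees with derived functor cohomology in degree one. Covers indexed by the points of
  the space, with \<open>x \<in> U x\<close>, are cofinal.\<close>

definition cech_cocycles :: "'p topology \<Rightarrow> ('p, 'v) sheaf
    \<Rightarrow> (('p \<Rightarrow> 'p set) \<times> ('p \<Rightarrow> 'p \<Rightarrow> 'p \<Rightarrow> 'v)) set" where
  "cech_cocycles X F = {(U, c) |U c.
     (\<forall>x. if x \<in> topspace X then openin X (U x) \<and> x \<in> U x else U x = {}) \<and>
     (\<forall>x y. c x y \<in> sec F (U x \<inter> U y)) \<and>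
     (\<forall>x y z. \<forall>w \<in> U x \<inter> U y \<inter> U z. c x z w = c x y w \<oplus>\<^bsub>stalk F w\<^esub> c y z w)}"

definition cohomologous :: "'p topology \<Rightarrow> ('p, 'v) sheaf
    \<Rightarrow> ((('p \<Rightarrow> 'p set) \<times> ('p \<Rightarrow> 'p \<Rightarrow> 'p \<Rightarrow> 'v)) \<times> (('p \<Rightarrow> 'p set) \<times> ('p \<Rightarrow> 'p \<Rightarrow> 'p \<Rightarrow> 'v))) set" where
  "cohomologous X F = {((U, c), (U', c')) |U c U' c'.
     (U, c) \<in> cech_cocycles X F \<and> (U', c') \<in> cech_cocycles X F \<and>
     (\<exists>W h. (\<forall>x\<in>topspace X. openin X (W x) \<and> x \<in> W x \<and> W x \<subseteq> U x \<inter> U' x \<and> h x \<in> sec F (W x)) \<and>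
       (\<forall>x\<in>topspace X. \<forall>y\<in>topspace X. \<forall>w \<in> W x \<inter> W y.
          c x y w \<oplus>\<^bsub>stalk F w\<^esub> h y w = c' x y w \<oplus>\<^bsub>stalk F w\<^esub> h x w))}"

definition H1 :: "'p topology \<Rightarrow> ('p, 'v) sheaf
    \<Rightarrow> (complex, (('p \<Rightarrow> 'p set) \<times> ('p \<Rightarrow> 'p \<Rightarrow> 'p \<Rightarrow> 'v)) set) module" where
  "H1 X F =
     \<lparr>carrier = cech_cocycles X F // cohomologous X F,
      mult = undefined, one = undefined,
      zero = cohomologous X F ``
        {(\<lambda>x. if x \<in> topspace X then topspace X else {},
          \<lambda>x y. \<lambda>w \<in> (if x \<in> topspace X \<and> y \<in> topspace X then topspace X else {}). \<zero>\<^bsub>stalk F w\<^esub>)},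
      add = (\<lambda>\<xi> \<xi>'. cohomologous X F ``
        {(\<lambda>x. U x \<inter> U' x,
          \<lambda>x y. \<lambda>w \<in> U x \<inter> U' x \<inter> (U y \<inter> U' y). c x y w \<oplus>\<^bsub>stalk F w\<^esub> c' x y w)
         |U c U' c'. (U, c) \<in> \<xi> \<and> (U', c') \<in> \<xi>'}),
      smult = (\<lambda>a \<xi>. cohomologous X F ``
        {(U, \<lambda>x y. \<lambda>w \<in> U x \<inter> U y. a \<odot>\<^bsub>stalk F w\<^esub> c x y w) |U c. (U, c) \<in> \<xi>})\<rparr>"

text \<open>Points \<open>[1 : s]\<close> and \<open>[0 : 1]\<close>.\<close>

datatype P1 = Aff complex | Infty

definition zariski :: "P1 topology" where
  "zariski = topology (\<lambda>U. U = {} \<or> finite (- U))"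

lemma openin_zariski: "openin zariski U \<longleftrightarrow> U = {} \<or> finite (- U)"
proof -
  have "istopology (\<lambda>U :: P1 set. U = {} \<or> finite (- U))"
    unfolding istopology_def
  proof (intro conjI allI impI)
    fix S T :: "P1 set"
    assume "S = {} \<or> finite (- S)" "T = {} \<or> finite (- T)"
    then show "S \<inter> T = {} \<or> finite (- (S \<inter> T))"
      by (auto simp: Compl_Int)
  next
    fix \<K> :: "P1 set set"
    assume *: "\<forall>S\<in>\<K>. S = {} \<or> finite (- S)"
    show "\<Union>\<K> = {} \<or> finite (- \<Union>\<K>)"
    proof (cases "\<Union>\<K> = {}")
      case False
      then obtain S where "S \<in> \<K>" "finite (- S)"
        using * by blast
      then show ?thesis
        by (metis Compl_anti_mono Union_upper finite_subset)
    qed simp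
  qed
  then show ?thesis
    by (simp add: zariski_def topology_inverse')
qed

text \<open>The function field of the line, that is, the field of rational functions of \<open>s\<close>.\<close>

type_synonym K = "complex poly fract"

abbreviation kconst :: "complex \<Rightarrow> K" where
  "kconst c \<equiv> Fract [:c:] 1"

definition kpoly :: "complex poly \<Rightarrow> K \<Rightarrow> K" where
  "kpoly g r = (\<Sum>n\<le>degree g. kconst (coeff g n) * r ^ n)"

definition kderiv :: "K \<Rightarrow> K" where
  "kderiv r = (let p = fst (quot_of_fract r); q = snd (quot_of_fract r)
     in Fract (pderiv p * q - p * pderiv q) (q * q))"

definition keval :: "K \<Rightarrow> complex \<Rightarrow> complex" where
  "keval r s = poly (fst (quot_of_fract r)) s / poly (snd (quot_of_fract r)) s"

text \<open>The local ring of the line at a point, as a subring of the function field.\<close>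

fun local_ring :: "P1 \<Rightarrow> K set" where
  "local_ring (Aff a) = {Fract p q |p q. poly q a \<noteq> 0}"
| "local_ring Infty = {Fract p q |p q. q \<noteq> 0 \<and> degree p \<le> degree q}"

definition max_ideal :: "P1 \<Rightarrow> K set" where
  "max_ideal q = {r \<in> local_ring q. r = 0 \<or> inverse r \<notin> local_ring q}"

text \<open>An element \<open>g\<close> of \<open>K\<close> stands for the vector field \<open>g d/ds\<close> in the next two definitions, and
  for the form \<open>g ds\<close> in the following two.\<close>

definition tangent :: "P1 \<Rightarrow> K set" where
  "tangent q = {g. \<forall>r\<in>local_ring q. g * kderiv r \<in> local_ring q}"

definition log_tangent :: "P1 set \<Rightarrow> P1 \<Rightarrow> K set" where
  "log_tangent D q =
     {g \<in> tangent q. q \<in> D \<longrightarrow> (\<forall>r\<in>max_ideal q. g * kderiv r \<in> max_ideal q)}"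

definition canonical :: "P1 \<Rightarrow> K set" where
  "canonical q = {\<theta>. \<forall>g\<in>tangent q. \<theta> * g \<in> local_ring q}"

text \<open>At infinity the coordinate is \<open>u = 1/s\<close>, and \<open>ds = - du/u\<^sup>2\<close>.\<close>

fun form_residue :: "P1 \<Rightarrow> K \<Rightarrow> complex" where
  "form_residue (Aff a) \<theta> = residue (keval \<theta>) a"
| "form_residue Infty \<theta> = residue (\<lambda>u. - keval \<theta> (1 / u) / u\<^sup>2) 0"

text \<open>A point of projective space is the line spanned by a nonzero vector. A homogeneous quartic
  is given by the coefficients of its monomials.\<close>

definition proj :: "complex ^ 4 \<Rightarrow> (complex ^ 4) set" where
  "proj v = range (\<lambda>c. c *s v)"

definition quartic :: "((4 \<Rightarrow> nat) \<Rightarrow> complex) \<Rightarrow> complex ^ 4 \<Rightarrow> complex" where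
  "quartic f v = (\<Sum>\<mu> | sum \<mu> UNIV = 4. f \<mu> * (\<Prod>i\<in>UNIV. (v $ i) ^ \<mu> i))"

definition family_eq :: "((4 \<Rightarrow> nat) \<Rightarrow> complex) \<Rightarrow> complex ^ 4 \<Rightarrow> complex \<Rightarrow> complex" where
  "family_eq f v t = (\<Prod>i\<in>UNIV. v $ i) + t * quartic f v"

definition total_space :: "((4 \<Rightarrow> nat) \<Rightarrow> complex) \<Rightarrow> ((complex ^ 4) set \<times> complex) set" where
  "total_space f = {(proj v, t) |v t. v \<noteq> 0 \<and> family_eq f v t = 0}"

definition total_space_sing :: "((4 \<Rightarrow> nat) \<Rightarrow> complex) \<Rightarrow> ((complex ^ 4) set \<times> complex) set" where
  "total_space_sing f = {(proj v, t) |v t. v \<noteq> 0 \<and> family_eq f v t = 0 \<and>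
     (\<forall>i. ((\<lambda>u. family_eq f (v + u *s axis i 1) t) has_field_derivative 0) (at 0)) \<and>
     ((\<lambda>u. family_eq f v u) has_field_derivative 0) (at t)}"

definition central_fibre :: "((4 \<Rightarrow> nat) \<Rightarrow> complex) \<Rightarrow> (complex ^ 4) set set" where
  "central_fibre f = {P. (P, 0) \<in> total_space f}"

definition sing_set :: "((4 \<Rightarrow> nat) \<Rightarrow> complex) \<Rightarrow> (complex ^ 4) set set" where
  "sing_set f = {P. (P, 0) \<in> total_space_sing f}"

definition comp_plane :: "4 \<Rightarrow> (complex ^ 4) set set" where
  "comp_plane i = {proj v |v. v \<noteq> 0 \<and> v $ i = 0}"

definition coord_lines :: "(complex ^ 4) set set" where
  "coord_lines = (\<Union>i. \<Union>j\<in>- {i}. comp_plane i \<inter> comp_plane j)"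

text \<open>Genericity of the quartic means that there are \<open>24\<close> distinct singular points on the central
  fibre, none of them fixed by the torus.\<close>

definition generic_quartic :: "((4 \<Rightarrow> nat) \<Rightarrow> complex) \<Rightarrow> 4 \<Rightarrow> bool" where
  "generic_quartic f i \<longleftrightarrow> card (sing_set f) = 24 \<and> (\<forall>r. proj (axis r 1) \<notin> sing_set f) \<and>
     (\<exists>j k l u v w. distinct [i, j, k, l] \<and>
        proj u \<in> sing_set f \<inter> comp_plane i \<inter> comp_plane j \<and>
        proj v \<in> sing_set f \<inter> comp_plane i \<inter> comp_plane k \<and>
        proj w \<in> sing_set f \<inter> comp_plane i \<inter> comp_plane l \<and>
        (\<exists>\<alpha> \<beta> \<gamma>. (\<alpha>, \<beta>, \<gamma>) \<noteq> (0, 0, 0) \<and> \<alpha> *s u + \<beta> *s v + \<gamma> *s w = 0))"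

fun line_map :: "complex ^ 4 \<Rightarrow> complex ^ 4 \<Rightarrow> P1 \<Rightarrow> (complex ^ 4) set" where
  "line_map a b (Aff s) = proj (a + s *s b)"
| "line_map a b Infty = proj b"

text \<open>The pullback of the \<open>r\<close>-th homogeneous coordinate along the line, on the affine part.\<close>

definition hcoord :: "complex ^ 4 \<Rightarrow> complex ^ 4 \<Rightarrow> 4 \<Rightarrow> K" where
  "hcoord a b r = Fract [:a $ r, b $ r:] 1"

text \<open>Let \<open>x = X\<^sub>j/X\<^sub>l\<close> and \<open>z = X\<^sub>k/X\<^sub>l\<close> be the toric coordinates of the \<open>i\<close>-th plane. The generic
  stalk of the pullback of its tangent sheaf is \<open>N \<otimes> K = K \<times> K\<close> with the basis
  \<open>e\<^sub>1 = x \<partial>\<^sub>x\<close>, \<open>e\<^sub>2 = z \<partial>\<^sub>z\<close>. A character is multiplied by its pairing with \<open>v \<in> N \<otimes> K\<close>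
  under the derivation \<open>v\<close>; \<open>char_deriv\<close> is the resulting derivative of \<open>X\<^sub>r/X\<^sub>m\<close>, pulled back
  to the line. (It is \<open>0\<close> if \<open>r = i\<close>, because \<open>X\<^sub>i\<close> vanishes on the plane.)\<close>

definition weight :: "4 \<Rightarrow> 4 \<Rightarrow> K \<times> K \<Rightarrow> 4 \<Rightarrow> K" where
  "weight j k v r = (if r = j then fst v else if r = k then snd v else 0)"

definition char_deriv :: "complex ^ 4 \<Rightarrow> complex ^ 4 \<Rightarrow> 4 \<Rightarrow> 4 \<Rightarrow> K \<times> K \<Rightarrow> 4 \<Rightarrow> 4 \<Rightarrow> K" where
  "char_deriv a b j k v r m =
     (weight j k v r - weight j k v m) * (hcoord a b r / hcoord a b m)"

text \<open>The pullback of the tangent sheaf of the plane: derivations from the local ring of the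
  plane to that of the line, which are determined by their values on affine coordinates.\<close>

definition plane_tangent :: "complex ^ 4 \<Rightarrow> complex ^ 4 \<Rightarrow> 4 \<Rightarrow> 4 \<Rightarrow> P1 \<Rightarrow> (K \<times> K) set" where
  "plane_tangent a b j k q = {v. \<forall>r m. line_map a b q \<notin> comp_plane m \<longrightarrow>
     char_deriv a b j k v r m \<in> local_ring q}"

text \<open>The restriction \<open>f(0, 0, z, 1)\<close> of the quartic to a coordinate line, where \<open>z = X\<^sub>n/X\<^sub>m\<close>.\<close>

definition edge_poly :: "((4 \<Rightarrow> nat) \<Rightarrow> complex) \<Rightarrow> 4 \<Rightarrow> 4 \<Rightarrow> complex poly" where
  "edge_poly f n m = (\<Sum>e\<le>4. monom (f ((\<lambda>_. 0)(n := e, m := 4 - e))) e)"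

text \<open>The pullback of the log tangent sheaf of the central fibre relative to the base log point.
  Near a point of \<open>sing_set\<close> take the affine chart \<open>X\<^sub>m \<noteq> 0\<close> with coordinates \<open>x = X\<^sub>r/X\<^sub>m\<close>,
  \<open>y = X\<^sub>i/X\<^sub>m\<close>, \<open>z = X\<^sub>n/X\<^sub>m\<close>, where \<open>x = y = 0\<close> at the point. The log structure is that of the
  toric variety \<open>X Y + t Z = 0\<close>. A log derivation over the base has logarithmic parts
  \<open>\<delta>\<^sub>X, \<delta>\<^sub>Y, \<delta>\<^sub>Z, \<delta>\<^sub>t\<close> in the local ring of the line with \<open>\<delta>\<^sub>X + \<delta>\<^sub>Y = \<delta>\<^sub>t + \<delta>\<^sub>Z\<close> and \<open>\<delta>\<^sub>t = 0\<close>,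
  and it maps each toric coordinate \<open>T\<close> to \<open>\<delta>\<^sub>T T\<close>. On the component \<open>y = t = 0\<close> the toric
  coordinates \<open>X, Y, Z\<close> restrict to \<open>x\<close>, \<open>0\<close> and \<open>f(0, 0, z, 1)\<close>; so the conditions for \<open>Y\<close> and \<open>t\<close>
  hold with \<open>\<delta>\<^sub>Y = \<delta>\<^sub>Z - \<delta>\<^sub>X\<close>, and those for \<open>X\<close> and \<open>Z\<close> remain. Equivalently, the sheaf is
  generated by \<open>x \<partial>\<^sub>x\<close> and \<open>(z - \<alpha>) \<partial>\<^sub>z\<close> there, where \<open>\<alpha>\<close> is the value of \<open>z\<close> at the point.
  Both choices of the chart give the same conditions.
  Away from \<open>sing_set\<close> the log structure of the neighbourhood is pulled back from the base.\<close>

definition central_log_tangent ::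
    "((4 \<Rightarrow> nat) \<Rightarrow> complex) \<Rightarrow> complex ^ 4 \<Rightarrow> complex ^ 4 \<Rightarrow> 4 \<Rightarrow> 4 \<Rightarrow> 4 \<Rightarrow> P1 \<Rightarrow> (K \<times> K) set" where
  "central_log_tangent f a b i j k q =
     {v \<in> plane_tangent a b j k q. line_map a b q \<in> sing_set f \<longrightarrow>
       (\<forall>r n m. distinct [i, r, n, m] \<and> line_map a b q \<in> comp_plane r \<and>
            line_map a b q \<notin> comp_plane m \<longrightarrow>
          (\<exists>\<delta>\<^sub>X\<in>local_ring q. \<exists>\<delta>\<^sub>Z\<in>local_ring q.
             char_deriv a b j k v r m = \<delta>\<^sub>X * (hcoord a b r / hcoord a b m) \<and>
             kpoly (pderiv (edge_poly f n m)) (hcoord a b n / hcoord a b m)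
               * char_deriv a b j k v n m
             = \<delta>\<^sub>Z * kpoly (edge_poly f n m) (hcoord a b n / hcoord a b m)))}"

definition pair_mult :: "'r \<Rightarrow> 'r \<times> 'r \<Rightarrow> 'r::times \<times> 'r" where
  "pair_mult r v = (r * fst v, r * snd v)"

definition pairing :: "K \<times> K \<Rightarrow> K \<times> K \<Rightarrow> K" where
  "pairing m v = fst m * fst v + snd m * snd v"

text \<open>The differential of the line maps \<open>g d/ds\<close> to \<open>g x'/x e\<^sub>1 + g z'/z e\<^sub>2\<close>.\<close>

definition differential :: "complex ^ 4 \<Rightarrow> complex ^ 4 \<Rightarrow> 4 \<Rightarrow> 4 \<Rightarrow> 4 \<Rightarrow> K \<Rightarrow> K \<times> K" where
  "differential a b j k l g =
     (let x = hcoord a b j / hcoord a b l; z = hcoord a b k / hcoord a b l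
      in (g * kderiv x / x, g * kderiv z / z))"

definition line_log_tangent ::
    "complex ^ 4 \<Rightarrow> complex ^ 4 \<Rightarrow> 4 \<Rightarrow> 4 \<Rightarrow> 4 \<Rightarrow> P1 \<Rightarrow> (K \<times> K) set" where
  "line_log_tangent a b j k l q =
     differential a b j k l ` log_tangent {p. line_map a b p \<in> coord_lines} q"

definition log_normal_sheaf :: "((4 \<Rightarrow> nat) \<Rightarrow> complex) \<Rightarrow> complex ^ 4 \<Rightarrow> complex ^ 4
    \<Rightarrow> 4 \<Rightarrow> 4 \<Rightarrow> 4 \<Rightarrow> 4 \<Rightarrow> (P1, (K \<times> K) set) sheaf" where
  "log_normal_sheaf f a b i j k l = quot_sheaf zariski (\<lambda>c. pair_mult (kconst c))
     (central_log_tangent f a b i j k) (line_log_tangent a b j k l)"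

text \<open>A homomorphism from the stalk of the normal sheaf to the local ring extends uniquely to the
  generic stalk; so the dual sheaf consists of functionals in \<open>M \<otimes> K = K \<times> K\<close>, written in the basis
  \<open>f\<^sub>1, f\<^sub>2\<close> dual to \<open>e\<^sub>1, e\<^sub>2\<close>, and its tensor product with the canonical sheaf consists of
  \<open>M\<close>-valued rational forms.\<close>

definition dual_normal :: "((4 \<Rightarrow> nat) \<Rightarrow> complex) \<Rightarrow> complex ^ 4 \<Rightarrow> complex ^ 4
    \<Rightarrow> 4 \<Rightarrow> 4 \<Rightarrow> 4 \<Rightarrow> 4 \<Rightarrow> P1 \<Rightarrow> (K \<times> K) set" where
  "dual_normal f a b i j k l q =
     {m. (\<forall>v\<in>central_log_tangent f a b i j k q. pairing m v \<in> local_ring q) \<and>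
         (\<forall>v\<in>line_log_tangent a b j k l q. pairing m v = 0)}"

definition dual_normal_canonical :: "((4 \<Rightarrow> nat) \<Rightarrow> complex) \<Rightarrow> complex ^ 4 \<Rightarrow> complex ^ 4
    \<Rightarrow> 4 \<Rightarrow> 4 \<Rightarrow> 4 \<Rightarrow> 4 \<Rightarrow> P1 \<Rightarrow> (K \<times> K) set" where
  "dual_normal_canonical f a b i j k l q =
     {\<Sum>d<n. pair_mult (\<theta> d) (m d) |(n::nat) \<theta> m.
        \<forall>d<n. \<theta> d \<in> canonical q \<and> m d \<in> dual_normal f a b i j k l q}"

definition H0_dual_normal_canonical :: "((4 \<Rightarrow> nat) \<Rightarrow> complex) \<Rightarrow> complex ^ 4 \<Rightarrow> complex ^ 4
    \<Rightarrow> 4 \<Rightarrow> 4 \<Rightarrow> 4 \<Rightarrow> 4 \<Rightarrow> (complex, K \<times> K) module" where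
  "H0_dual_normal_canonical f a b i j k l =
     lin_mod (\<lambda>c. pair_mult (kconst c)) (\<Inter>q. dual_normal_canonical f a b i j k l q)"

text \<open>Serre duality: pairing a cocycle \<open>c\<close> with a form \<open>\<eta>\<close> gives a cocycle with values in the canonical
  sheaf. On \<open>U x \<inter> U x\<^sub>0\<close> its component for \<open>x, x\<^sub>0\<close> is a rational form; its trace is the sum over
  all \<open>x\<close> of the residue at \<open>x\<close> of this form. The residue theorem makes the sum
  independent of the base point \<open>x\<^sub>0\<close>, here \<open>Infty\<close>, and of the representative of the class.\<close>

definition contract :: "K \<times> K \<Rightarrow> (K \<times> K) set \<Rightarrow> K" where
  "contract \<eta> C = the_elem (pairing \<eta> ` C)"

definition serre_trace :: "K \<times> K \<Rightarrow> (P1 \<Rightarrow> P1 set) \<times> (P1 \<Rightarrow> P1 \<Rightarrow> P1 \<Rightarrow> (K \<times> K) set) \<Rightarrow> complex" where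
  "serre_trace \<eta> = (\<lambda>(U, c).
     let \<gamma> = (\<lambda>x. contract \<eta> (c x Infty (SOME w. w \<in> U x \<inter> U Infty)))
     in \<Sum>x | form_residue x (\<gamma> x) \<noteq> 0. form_residue x (\<gamma> x))"

definition serre_map :: "(P1, (K \<times> K) set) sheaf \<Rightarrow> K \<times> K
    \<Rightarrow> ((P1 \<Rightarrow> P1 set) \<times> (P1 \<Rightarrow> P1 \<Rightarrow> P1 \<Rightarrow> (K \<times> K) set)) set \<Rightarrow> complex" where
  "serre_map N \<eta> = (\<lambda>\<xi>\<in>carrier (H1 zariski N). serre_trace \<eta> (SOME p. p \<in> \<xi>))"

text \<open>Vectors in \<open>M\<close> with complex coefficients are pairs of coordinates for \<open>f\<^sub>1, f\<^sub>2\<close>.\<close>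

definition residue_vec :: "P1 \<Rightarrow> K \<times> K \<Rightarrow> complex \<times> complex" where
  "residue_vec q \<eta> = (form_residue q (fst \<eta>), form_residue q (snd \<eta>))"

definition residue_triples ::
    "(complex, (complex \<times> complex) \<times> (complex \<times> complex) \<times> (complex \<times> complex)) module" where
  "residue_triples = lin_mod
     (\<lambda>c (v\<^sub>1, v\<^sub>2, v\<^sub>3). (pair_mult c v\<^sub>1, pair_mult c v\<^sub>2, pair_mult c v\<^sub>3))
     {(v\<^sub>1, v\<^sub>2, v\<^sub>3). v\<^sub>1 \<in> range (\<lambda>c. pair_mult c (1, 0)) \<and> v\<^sub>2 \<in> range (\<lambda>c. pair_mult c (0, 1)) \<and>
        v\<^sub>3 \<in> range (\<lambda>c. pair_mult c ((1, 0) - (0, 1))) \<and> v\<^sub>1 + v\<^sub>2 + v\<^sub>3 = 0}"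

end

theory Submission
  imports Defs "HOL-Library.Groups_Big_Fun"
begin

text \<open>Write \<open>A\<^sub>r(s) = a\<^sub>r + b\<^sub>r s\<close> for the homogeneous coordinates along the line. The line avoids the three
vertices of the coordinate triangle of its plane: such a vertex would lie in the singular set by
\<open>(\<ast>)\<close>, which contains no torus fixed point. So the three linear forms have distinct zeros \<open>p\<^sub>1\<close>, \<open>p\<^sub>2\<close>,
\<open>p\<^sub>3\<close>, and at each of them exactly one of the three forms vanishes. Moreover \<open>f\<close> has a simple zero there along
the coordinate line, because on each of the six coordinate lines the singular points are the zeros of a polynomial of degree
four, and there are \<open>24\<close> of them (\<open>edge_poly_simple_root\<close>). Therefore a derivation
\<open>v = v\<^sub>1 e\<^sub>1 + v\<^sub>2 e\<^sub>2\<close> belongs to the log tangent sheaf at \<open>p\<^sub>1\<close> if and only if \<open>v\<^sub>1\<close> is regular and \<open>v\<^sub>2\<close> vanishes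
there, and similarly at \<open>p\<^sub>2\<close> and \<open>p\<^sub>3\<close> (\<open>central_log_tangent_special\<close>).

The \<open>M\<close>-valued logarithmic form \<open>\<eta>\<^sub>0 = dlog(X\<^sub>k/X\<^sub>l) f\<^sub>1 - dlog(X\<^sub>j/X\<^sub>l) f\<^sub>2\<close> annihilates the tangent
vectors of the line. Counting zeros and poles at every point shows that pairing with \<open>\<eta>\<^sub>0\<close> maps
the log tangent sheaf of the plane into the canonical sheaf \<open>\<omega>\<close> of the line, that its kernel is the log
tangent sheaf of the line, and that it has a global splitting \<open>\<sigma>\<close>. So the log normal sheaf is
isomorphic to \<open>\<omega>\<close>, and three facts remain.

First, \<open>H\<^sup>1(\<omega>)\<close> is one-dimensional, with the total residue as coordinate. By irreducibility a Cech cocycle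
is a family of rational forms, one for each point, relative to the base point. Two cocycles are
cohomologous if and only if their difference can be matched by the principal parts of one global rational
form. By partial fractions such a form exists if and only if the residues of the difference add up to
zero (\<open>residue_theorem\<close>, \<open>principal_parts\<close>).

Second, the stalks of the dual sheaf twisted by \<open>\<omega>\<close> are the multiples of \<open>\<eta>\<^sub>0\<close> by regular functions, so
the global sections are the constant multiples of \<open>\<eta>\<^sub>0\<close>, and the Serre pairing with \<open>c \<eta>\<^sub>0\<close> is \<open>c\<close> times the
total residue.

Third, the residues of \<open>\<eta>\<^sub>0\<close> at \<open>p\<^sub>2\<close>, \<open>p\<^sub>1\<close>, \<open>p\<^sub>3\<close> are \<open>f\<^sub>1\<close>, \<open>- f\<^sub>2\<close>, \<open>f\<^sub>2 - f\<^sub>1\<close>, a generator of the space of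
residue triples. In this way \<open>H\<^sup>1\<close>, its dual, the global sections and the residue triples all come with
a linear coordinate (\<open>line_coord\<close>), and each map in question preserves the coordinates.\<close>

section \<open>One-dimensional modules\<close>

text \<open>A linear isomorphism from the complex line onto the module. The definition does not presuppose
the module axioms, which follow from it; this is how they are obtained for the space of cohomology
classes.\<close>

definition line_coord :: "(complex, 'v) module \<Rightarrow> (complex \<Rightarrow> 'v) \<Rightarrow> bool" where
  "line_coord M e \<longleftrightarrow> bij_betw e UNIV (carrier M) \<and> \<zero>\<^bsub>M\<^esub> = e 0 \<and>
     (\<forall>s t. e s \<oplus>\<^bsub>M\<^esub> e t = e (s + t)) \<and> (\<forall>c t. c \<odot>\<^bsub>M\<^esub> e t = e (c * t))"

lemma cring_complex_ring: "cring complex_ring"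
  by (rule cringI[OF abelian_groupI comm_monoidI])
    (auto simp: complex_ring_def algebra_simps intro: exI[of _ "- x" for x])

lemma line_coord_carrier: "line_coord M e \<Longrightarrow> carrier M = range e"
  by (auto simp: line_coord_def bij_betw_def)

lemma line_coord_module:
  assumes "line_coord M e"
  shows "Module.module complex_ring M"
proof -
  have C: "carrier M = range e" and Z: "\<zero>\<^bsub>M\<^esub> = e 0"
    and P: "\<And>s t. e s \<oplus>\<^bsub>M\<^esub> e t = e (s + t)" and S: "\<And>c t. c \<odot>\<^bsub>M\<^esub> e t = e (c * t)"
    using assms by (auto simp: line_coord_def bij_betw_def)
  have "abelian_group M"
  proof (rule abelian_groupI)
    fix x assume "x \<in> carrier M"
    then obtain t where "x = e t" by (auto simp: C)
    then show "\<exists>y\<in>carrier M. y \<oplus>\<^bsub>M\<^esub> x = \<zero>\<^bsub>M\<^esub>"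
      by (intro bexI[of _ "e (- t)"]) (auto simp: C P Z)
  qed (auto simp: C Z P algebra_simps)
  then show ?thesis
    by (rule moduleI[OF cring_complex_ring]) (auto simp: C P S complex_ring_def algebra_simps)
qed

lemma line_coord_iso:
  assumes M: "line_coord M e" and N: "line_coord N e'" and h: "\<And>t. h (e t) = e' t"
  shows "linear_iso M N h"
proof -
  have "h ` carrier M = carrier N"
    unfolding line_coord_carrier[OF M] line_coord_carrier[OF N] image_image by (simp add: h)
  moreover have "inj_on h (carrier M)"
    using N unfolding line_coord_carrier[OF M]
    by (auto simp: inj_on_def h line_coord_def bij_betw_def inj_def)
  moreover have "linear_map M N h"
    using M N unfolding linear_map_def line_coord_carrier[OF M] line_coord_carrier[OF N]
    by (auto simp: line_coord_def h)
  ultimately show ?thesis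
    using line_coord_module[OF M] line_coord_module[OF N]
    by (simp add: linear_iso_def bij_betw_def)
qed

lemma line_coord_complex_line: "line_coord complex_line id"
  by (simp add: line_coord_def lin_mod_def)

lemma line_coord_dual:
  assumes M: "line_coord M e"
  shows "line_coord (dual_space M) (\<lambda>c. \<lambda>x\<in>carrier M. c * inv_into UNIV e x)"
proof -
  let ?e = "\<lambda>c. \<lambda>x\<in>carrier M. c * inv_into UNIV e x"
  have inj: "inj e" and C: "carrier M = range e"
    and P: "\<And>s t. e s \<oplus>\<^bsub>M\<^esub> e t = e (s + t)" and S: "\<And>c t. c \<odot>\<^bsub>M\<^esub> e t = e (c * t)"
    using M by (auto simp: line_coord_def bij_betw_def)
  have ev: "?e c (e t) = c * t" for c t
    using inj by (simp add: C)
  have "\<psi> = ?e (\<psi> (e 1))" if "\<psi> \<in> carrier (dual_space M)" for \<psi>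
  proof
    fix x
    show "\<psi> x = ?e (\<psi> (e 1)) x"
    proof (cases "x \<in> carrier M")
      case True
      then obtain t where t: "x = e t" by (auto simp: C)
      have "\<psi> (t \<odot>\<^bsub>M\<^esub> e 1) = t * \<psi> (e 1)"
        using that unfolding dual_space_def linear_map_def by (auto simp: C lin_mod_def)
      then show ?thesis
        by (simp add: t ev S) (simp add: C inj)
    next
      case False
      then show ?thesis
        using that by (auto simp: dual_space_def extensional_def)
    qed
  qed
  moreover have "?e c \<in> carrier (dual_space M)" for c
    unfolding dual_space_def linear_map_def
    by (auto simp: C lin_mod_def P S inj algebra_simps)
  ultimately have "carrier (dual_space M) = range ?e"
    by blast
  moreover have "inj ?e"
  proof (rule injI)
    fix c c' assume "?e c = ?e c'"
    then have "?e c (e 1) = ?e c' (e 1)" by (rule fun_cong)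
    then show "c = c'" unfolding ev by simp
  qed
  ultimately show ?thesis
    unfolding line_coord_def bij_betw_def by (auto simp: dual_space_def fun_eq_iff algebra_simps)
qed

text \<open>The residues of \<open>c \<eta>\<^sub>0\<close> at \<open>p\<^sub>2\<close>, \<open>p\<^sub>1\<close> and \<open>p\<^sub>3\<close>; the two linear equations leave one free parameter.\<close>

definition residue_triple :: "complex \<Rightarrow> (complex \<times> complex) \<times> (complex \<times> complex) \<times> (complex \<times> complex)" where
  "residue_triple c = ((c, 0), (0, - c), (- c, c))"

lemma line_coord_residue_triples: "line_coord residue_triples residue_triple"
proof -
  have "carrier residue_triples = range residue_triple"
  proof (intro equalityI subsetI)
    fix x assume "x \<in> carrier residue_triples"
    then obtain c\<^sub>1 c\<^sub>2 c\<^sub>3 where x: "x = ((c\<^sub>1, 0), (0, c\<^sub>2), (c\<^sub>3, - c\<^sub>3))" "c\<^sub>1 + c\<^sub>3 = 0" "c\<^sub>2 - c\<^sub>3 = 0"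
      by (auto simp: residue_triples_def lin_mod_def pair_mult_def zero_prod_def)
    then have "c\<^sub>3 = - c\<^sub>1" "c\<^sub>2 = - c\<^sub>1" by (simp_all add: add_eq_0_iff)
    then show "x \<in> range residue_triple" using x by (auto simp: residue_triple_def)
  next
    fix x assume "x \<in> range residue_triple"
    then obtain c where x: "x = ((c, 0), (0, - c), (- c, c))" by (auto simp: residue_triple_def)
    have "(c, 0) \<in> range (\<lambda>c. pair_mult c (1, 0))" "(0, - c) \<in> range (\<lambda>c. pair_mult c (0, 1))"
      "(- c, c) \<in> range (\<lambda>c. pair_mult c ((1, 0) - (0, 1)))"
      by (rule image_eqI[of _ _ c] image_eqI[of _ _ "- c"]; simp add: pair_mult_def)+
    then show "x \<in> carrier residue_triples"
      by (simp add: x residue_triples_def lin_mod_def zero_prod_def)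
  qed
  then show ?thesis
    by (auto simp: line_coord_def residue_triples_def lin_mod_def bij_betw_def inj_def
        pair_mult_def plus_prod_def zero_prod_def residue_triple_def)
qed

section \<open>Rational functions and the local rings of the line\<close>

text \<open>Arithmetic of fractions must be switched off by default, since it would merge what the rules for
constants below separate.\<close>

declare add_fract [simp del] mult_fract [simp del] minus_fract [simp del] diff_fract [simp del]
  divide_fract [simp del] inverse_fract [simp del]

lemmas fract_arith = add_fract mult_fract minus_fract diff_fract divide_fract inverse_fract

lemma Fract_0_left [simp]: "Fract 0 q = 0"
  by (cases "q = 0") (simp_all add: Zero_fract_def eq_fract)

lemma Fract_1_1 [simp]: "Fract 1 1 = 1" "kconst 1 = 1"
  by (simp_all add: One_fract_def one_pCons)

lemma kconst_arith [simp]: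
  "kconst (c + d) = kconst c + kconst d" "kconst (c * d) = kconst c * kconst d"
  "kconst (- c) = - kconst c" "kconst (c - d) = kconst c - kconst d"
  by (simp_all add: fract_arith mult.commute)

lemma kconst_eq_iff [simp]: "kconst c = kconst d \<longleftrightarrow> c = d"
  by (simp add: eq_fract)

lemma kconst_eq_0_iff [simp]: "kconst c = 0 \<longleftrightarrow> c = 0"
  using kconst_eq_iff[of c 0] by (simp del: kconst_eq_iff)

lemma inverse_kconst: "inverse (kconst c) = kconst (inverse c)"
  by (cases "c = 0") (simp_all add: inverse_fract eq_fract one_pCons)

lemma kconst_divide: "kconst (c / d) = kconst c / kconst d"
  by (simp add: divide_inverse inverse_kconst)

fun uniformizer :: "P1 \<Rightarrow> K" where
  "uniformizer (Aff a) = Fract [:- a, 1:] 1"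
| "uniformizer Infty = Fract 1 [:0, 1:]"

text \<open>A linear form \<open>A(s) = \<alpha> + \<beta> s\<close> on the line is turned into a function near \<open>q\<close> by dividing it by
  a linear form that does not vanish at \<open>q\<close>: by \<open>1\<close> at the affine points, and by \<open>s\<close> at infinity. With
  this factor the affine points and infinity need no separate treatment.\<close>

fun trivialization :: "P1 \<Rightarrow> K" where
  "trivialization (Aff a) = 1"
| "trivialization Infty = Fract 1 [:0, 1:]"

lemma Fract_eq_0_iff: "q \<noteq> 0 \<Longrightarrow> Fract p q = 0 \<longleftrightarrow> p = 0"
  by (simp add: Zero_fract_def eq_fract del: Fract_0_left)

lemma uniformizer_nonzero [simp]: "uniformizer q \<noteq> 0"
  by (cases q) (simp_all add: Fract_eq_0_iff)

lemma trivialization_nonzero [simp]: "trivialization q \<noteq> 0"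
  by (cases q) (simp_all add: Fract_eq_0_iff)

lemma local_ring_AffI: "poly q a \<noteq> 0 \<Longrightarrow> Fract p q \<in> local_ring (Aff a)"
  by auto

lemma local_ring_InftyI: "q \<noteq> 0 \<Longrightarrow> degree p \<le> degree q \<Longrightarrow> Fract p q \<in> local_ring Infty"
  by auto

lemma local_ring_const [simp]: "kconst c \<in> local_ring q"
  by (cases q) (simp_all only: local_ring_AffI local_ring_InftyI poly_1 one_neq_zero degree_pCons_0
      degree_1 le_refl not_False_eq_True)

lemma local_ring_0 [simp]: "0 \<in> local_ring q" and local_ring_1 [simp]: "1 \<in> local_ring q"
  using local_ring_const[of 0 q] local_ring_const[of 1 q] by simp_all

lemma local_ring_mult [simp]:
  assumes "x \<in> local_ring q" "y \<in> local_ring q"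
  shows "x * y \<in> local_ring q"
proof (cases q)
  case Infty
  with assms obtain p r p' r' where *: "x = Fract p r" "r \<noteq> 0" "degree p \<le> degree r"
     "y = Fract p' r'" "r' \<noteq> 0" "degree p' \<le> degree r'"
    by auto
  then have "degree (p * p') \<le> degree (r * r')"
    by (intro order.trans[OF degree_mult_le]) (simp add: degree_mult_eq)
  with * show ?thesis
    by (simp add: Infty local_ring_InftyI fract_arith del: local_ring.simps)
next
  case (Aff a)
  with assms obtain p r p' r' where "x = Fract p r" "poly r a \<noteq> 0" "y = Fract p' r'" "poly r' a \<noteq> 0"
    by auto
  then show ?thesis
    by (simp add: Aff local_ring_AffI fract_arith del: local_ring.simps)
qed

lemma local_ring_add [simp]:
  assumes "x \<in> local_ring q" "y \<in> local_ring q"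
  shows "x + y \<in> local_ring q"
proof (cases q)
  case Infty
  with assms obtain p r p' r' where *: "x = Fract p r" "r \<noteq> 0" "degree p \<le> degree r"
     "y = Fract p' r'" "r' \<noteq> 0" "degree p' \<le> degree r'"
    by auto
  then have "degree (p * r' + p' * r) \<le> degree (r * r')"
    by (intro degree_add_le order.trans[OF degree_mult_le]) (simp_all add: degree_mult_eq)
  with * show ?thesis
    by (simp add: Infty local_ring_InftyI fract_arith del: local_ring.simps)
next
  case (Aff a)
  with assms obtain p r p' r' where *: "x = Fract p r" "poly r a \<noteq> 0" "y = Fract p' r'" "poly r' a \<noteq> 0"
    by auto
  then have "r \<noteq> 0" "r' \<noteq> 0" by auto
  with * show ?thesis
    by (simp add: Aff local_ring_AffI fract_arith del: local_ring.simps)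
qed

lemma local_ring_uminus [simp]: "x \<in> local_ring q \<Longrightarrow> - x \<in> local_ring q"
  using local_ring_mult[OF local_ring_const[of "-1" q], of x] by simp

lemma local_ring_diff [simp]: "x \<in> local_ring q \<Longrightarrow> y \<in> local_ring q \<Longrightarrow> x - y \<in> local_ring q"
  using local_ring_add[of x q "- y"] by simp

lemma uniformizer_in_local_ring [simp]: "uniformizer q \<in> local_ring q"
  by (cases q) (simp_all add: local_ring_AffI local_ring_InftyI del: local_ring.simps)

lemma inverse_uniformizer_notin: "inverse (uniformizer q) \<notin> local_ring q"
proof (cases q)
  case (Aff a)
  have "\<not> (poly r a \<noteq> 0 \<and> Fract 1 [:- a, 1:] = Fract p r)" for p r
  proof
    assume *: "poly r a \<noteq> 0 \<and> Fract 1 [:- a, 1:] = Fract p r"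
    then have "r \<noteq> 0" by auto
    with * have "r = p * [:- a, 1:]" by (simp add: eq_fract mult.commute)
    with * show False by simp
  qed
  then show ?thesis by (auto simp: Aff inverse_fract)
next
  case Infty
  have "\<not> (r \<noteq> 0 \<and> degree p \<le> degree r \<and> Fract [:0, 1:] 1 = Fract p r)" for p r :: "complex poly"
  proof
    assume *: "r \<noteq> 0 \<and> degree p \<le> degree r \<and> Fract [:0, 1:] 1 = Fract p r"
    then have "p = [:0, 1:] * r" by (auto simp add: eq_fract)
    with * have "degree p = Suc (degree r)" by (simp add: degree_mult_eq)
    with * show False by simp
  qed
  then show ?thesis by (auto simp: Infty inverse_fract)
qed

text \<open>The local rings are discrete valuation rings whose residue field consists of the constants. This
expansion to first order and the next two lemmas determine the maximal ideals and the units without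
a distinction between the affine points and infinity.\<close>

lemma local_ring_expand:
  assumes "x \<in> local_ring q"
  obtains c y where "y \<in> local_ring q" "x = kconst c + uniformizer q * y"
proof (cases q)
  case (Aff a)
  with assms obtain p r where x: "x = Fract p r" and r: "poly r a \<noteq> 0" by auto
  define c where "c = poly p a / poly r a"
  have "poly (p - Polynomial.smult c r) a = 0" using r by (simp add: c_def)
  then obtain g where g: "p - Polynomial.smult c r = [:- a, 1:] * g" unfolding poly_eq_0_iff_dvd by (rule dvdE)
  have "r \<noteq> 0" using r by auto
  then have "kconst c + uniformizer q * Fract g r = Fract (Polynomial.smult c r + [:- a, 1:] * g) r"
    by (simp add: Aff fract_arith)
  also have "Polynomial.smult c r + [:- a, 1:] * g = p"
    using g by (simp add: algebra_simps)
  finally have "x = kconst c + uniformizer q * Fract g r"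
    by (simp add: x)
  moreover have "Fract g r \<in> local_ring q" using r by (auto simp: Aff)
  ultimately show ?thesis using that by blast
next
  case Infty
  with assms obtain p r where x: "x = Fract p r" and r: "r \<noteq> 0" "degree p \<le> degree r" by auto
  define c where "c = coeff p (degree r) / lead_coeff r"
  define g where "g = p - Polynomial.smult c r"
  have "degree g \<le> degree r" unfolding g_def using r by (intro degree_diff_le) auto
  moreover have "coeff g (degree r) = 0" using r by (simp add: g_def c_def)
  ultimately have "g = 0 \<or> degree g < degree r"
    using r by (metis leading_coeff_0_iff le_neq_implies_less)
  then have "degree ([:0, 1:] * g) \<le> degree r" by (cases "g = 0") (auto simp: degree_mult_eq)
  then have "Fract ([:0, 1:] * g) r \<in> local_ring q" using r unfolding Infty local_ring.simps by blast
  moreover have "p = Polynomial.smult c r + g" by (simp add: g_def)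
  then have "x = kconst c + uniformizer q * Fract ([:0, 1:] * g) r"
    using r by (simp add: x Infty eq_fract fract_arith algebra_simps)
  ultimately show ?thesis using that by blast
qed

lemma kconst_uniformizer_independent:
  assumes "y \<in> local_ring q" "kconst c + uniformizer q * y = 0"
  shows "c = 0"
proof (rule ccontr)
  assume c: "c \<noteq> 0"
  have "uniformizer q * (- y) = kconst c" using assms(2) by (simp add: add_eq_0_iff2)
  then have "uniformizer q * (- y * inverse (kconst c)) = kconst c * inverse (kconst c)"
    by (simp only: mult.assoc[symmetric])
  then have "uniformizer q * (- y * inverse (kconst c)) = 1"
    using c by simp
  then have "inverse (uniformizer q) = - y * inverse (kconst c)"
    by (rule inverse_unique)
  moreover have "- y * inverse (kconst c) \<in> local_ring q"
    using assms(1) unfolding inverse_kconst by (intro local_ring_mult) auto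
  ultimately show False using inverse_uniformizer_notin[of q] by simp
qed

lemma local_ring_unit:
  assumes "y \<in> local_ring q" "c \<noteq> 0"
  shows "inverse (kconst c + uniformizer q * y) \<in> local_ring q"
proof (cases q)
  case (Aff a)
  with assms obtain p r where y: "y = Fract p r" and r: "poly r a \<noteq> 0" by auto
  have "r \<noteq> 0" using r by auto
  then have "inverse (kconst c + uniformizer q * y) = Fract r (Polynomial.smult c r + [:- a, 1:] * p)"
    by (simp add: y Aff fract_arith)
  moreover have "poly (Polynomial.smult c r + [:- a, 1:] * p) a \<noteq> 0" using r assms by simp
  ultimately show ?thesis unfolding Aff local_ring.simps by blast
next
  case Infty
  with assms obtain p r where y: "y = Fract p r" and r: "r \<noteq> 0" "degree p \<le> degree r" by auto
  have d: "degree (Polynomial.smult c ([:0, 1:] * r) + p) = degree ([:0, 1:] * r)"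
    by (subst degree_add_eq_left) (use r assms in \<open>auto simp: degree_mult_eq\<close>)
  then have nz: " Polynomial.smult c ([:0, 1:] * r) + p \<noteq> 0" using r by (auto simp: degree_mult_eq)
  have "inverse (kconst c + uniformizer q * y) = Fract ([:0, 1:] * r) (Polynomial.smult c ([:0, 1:] * r) + p)"
    using r by (simp add: y Infty fract_arith)
  then show ?thesis using d nz unfolding Infty by (metis local_ring_InftyI le_refl)
qed

lemma max_ideal_eq: "max_ideal q = (*) (uniformizer q) ` local_ring q"
proof
  show "max_ideal q \<subseteq> (*) (uniformizer q) ` local_ring q"
  proof
    fix x assume x: "x \<in> max_ideal q"
    then have "x \<in> local_ring q" by (simp add: max_ideal_def)
    then obtain c y where *: "y \<in> local_ring q" "x = kconst c + uniformizer q * y"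
      by (rule local_ring_expand)
    have "x = 0 \<or> inverse x \<notin> local_ring q" using x by (simp add: max_ideal_def)
    then have "c = 0"
      using local_ring_unit[OF *(1), of c] kconst_uniformizer_independent[OF *(1), of c]
      unfolding *(2) by blast
    with * show "x \<in> (*) (uniformizer q) ` local_ring q" by simp
  qed
  show "(*) (uniformizer q) ` local_ring q \<subseteq> max_ideal q"
  proof
    fix x assume "x \<in> (*) (uniformizer q) ` local_ring q"
    then obtain y where y: "y \<in> local_ring q" "x = uniformizer q * y" by auto
    have "inverse x \<notin> local_ring q" if "x \<noteq> 0"
    proof
      assume "inverse x \<in> local_ring q"
      then have "y * inverse x \<in> local_ring q" using y by simp
      moreover have "y * inverse x = inverse (uniformizer q)" using that y by simp
      ultimately show False using inverse_uniformizer_notin by simp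
    qed
    then show "x \<in> max_ideal q" using y by (auto simp: max_ideal_def)
  qed
qed

lemma max_ideal_imp_local_ring: "x \<in> max_ideal q \<Longrightarrow> x \<in> local_ring q"
  by (simp add: max_ideal_def)

lemma max_ideal_0 [simp]: "0 \<in> max_ideal q"
  by (simp add: max_ideal_def)

lemma max_ideal_add [simp]:
  assumes "x \<in> max_ideal q" "y \<in> max_ideal q"
  shows "x + y \<in> max_ideal q"
proof -
  obtain u v where "x = uniformizer q * u" "y = uniformizer q * v" and uv: "u \<in> local_ring q" "v \<in> local_ring q"
    using assms unfolding max_ideal_eq by blast
  then have "x + y = uniformizer q * (u + v)"
    by (simp only: distrib_left)
  then show ?thesis
    unfolding max_ideal_eq using local_ring_add[OF uv] by blast
qed

lemma max_ideal_mult [simp]: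
  assumes "x \<in> max_ideal q" "y \<in> local_ring q"
  shows "x * y \<in> max_ideal q" "y * x \<in> max_ideal q"
proof -
  obtain z where "x = uniformizer q * z" "z \<in> local_ring q"
    using assms(1) unfolding max_ideal_eq by blast
  then have "x * y = uniformizer q * (z * y)" "z * y \<in> local_ring q"
    using assms(2) by (simp_all only: mult.assoc local_ring_mult)
  then show "x * y \<in> max_ideal q" unfolding max_ideal_eq by blast
  then show "y * x \<in> max_ideal q" by (simp add: mult.commute)
qed

lemma max_ideal_uminus [simp]: "x \<in> max_ideal q \<Longrightarrow> - x \<in> max_ideal q"
  using max_ideal_mult(2)[of x q "-1"] by simp

lemma uniformizer_mult_in_max_ideal: "uniformizer q * x \<in> max_ideal q \<longleftrightarrow> x \<in> local_ring q"
  unfolding max_ideal_eq image_iff by simp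

lemma uniformizer_in_max_ideal [simp]: "uniformizer q \<in> max_ideal q"
  using uniformizer_mult_in_max_ideal[of q 1] by simp

definition local_unit :: "P1 \<Rightarrow> K \<Rightarrow> bool" where
  "local_unit q u \<longleftrightarrow> u \<in> local_ring q \<and> inverse u \<in> local_ring q \<and> u \<noteq> 0"

lemma local_unit_mult: "local_unit q u \<Longrightarrow> local_unit q v \<Longrightarrow> local_unit q (u * v)"
  by (simp add: local_unit_def)

lemma local_unit_divide: "local_unit q u \<Longrightarrow> local_unit q v \<Longrightarrow> local_unit q (u / v)"
  by (simp add: local_unit_def divide_inverse)

lemma local_unit_const: "c \<noteq> 0 \<Longrightarrow> local_unit q (kconst c)"
  by (simp add: local_unit_def inverse_kconst)

lemma local_unit_cancel:
  assumes "local_unit q u"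
  shows "u * x \<in> local_ring q \<longleftrightarrow> x \<in> local_ring q" "x * u \<in> local_ring q \<longleftrightarrow> x \<in> local_ring q"
    "x / u \<in> local_ring q \<longleftrightarrow> x \<in> local_ring q"
    "u * x \<in> max_ideal q \<longleftrightarrow> x \<in> max_ideal q" "x * u \<in> max_ideal q \<longleftrightarrow> x \<in> max_ideal q"
    "x / u \<in> max_ideal q \<longleftrightarrow> x \<in> max_ideal q"
proof -
  have u: "u \<in> local_ring q" "inverse u \<in> local_ring q" "u \<noteq> 0"
    using assms by (auto simp: local_unit_def)
  have e: "x = inverse u * (u * x)" "x = u * (x * inverse u)" using u by simp_all
  show "u * x \<in> local_ring q \<longleftrightarrow> x \<in> local_ring q"
    using e(1) u local_ring_mult by metis
  then show "x * u \<in> local_ring q \<longleftrightarrow> x \<in> local_ring q" by (simp add: mult.commute)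
  show "x / u \<in> local_ring q \<longleftrightarrow> x \<in> local_ring q"
    using e(2) u local_ring_mult unfolding divide_inverse by metis
  show "u * x \<in> max_ideal q \<longleftrightarrow> x \<in> max_ideal q"
    using e(1) u max_ideal_mult by metis
  then show "x * u \<in> max_ideal q \<longleftrightarrow> x \<in> max_ideal q" by (simp add: mult.commute)
  show "x / u \<in> max_ideal q \<longleftrightarrow> x \<in> max_ideal q"
    using e(2) u max_ideal_mult unfolding divide_inverse by metis
qed

lemma local_unitI:
  assumes "x - kconst c \<in> max_ideal q" "c \<noteq> 0"
  shows "local_unit q x"
proof -
  obtain y where y: "y \<in> local_ring q" "x - kconst c = uniformizer q * y"
    using assms by (auto simp: max_ideal_eq)
  then have x: "x = kconst c + uniformizer q * y" by (simp add: algebra_simps)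
  have "inverse x \<in> local_ring q"
    unfolding x by (rule local_ring_unit[OF y(1) assms(2)])
  moreover have "x \<noteq> 0"
    using kconst_uniformizer_independent[OF y(1), of c] assms(2) unfolding x by blast
  ultimately show ?thesis using y by (simp add: local_unit_def x)
qed

section \<open>Evaluating polynomials at rational functions\<close>

lemma kpoly_0 [simp]: "kpoly 0 r = 0"
  by (simp add: kpoly_def)

lemma kpoly_pCons: "kpoly (pCons c g) r = kconst c + r * kpoly g r"
proof (cases "g = 0")
  case False
  have "kpoly (pCons c g) r = (\<Sum>n\<le>Suc (degree g). kconst (coeff (pCons c g) n) * r ^ n)"
    using False by (simp add: kpoly_def del: sum.atMost_Suc)
  also have "\<dots> = kconst c + r * kpoly g r"
    unfolding sum.atMost_Suc_shift kpoly_def sum_distrib_left by (simp add: mult_ac)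
  finally show ?thesis .
qed (simp add: kpoly_def)

lemma kpoly_add: "kpoly (g + h) r = kpoly g r + kpoly h r"
  by (induction g h rule: poly_induct2) (simp_all add: kpoly_pCons algebra_simps)

lemma kpoly_smult: "kpoly (Polynomial.smult c g) r = kconst c * kpoly g r"
  by (induction g) (simp_all add: kpoly_pCons algebra_simps)

lemma kpoly_linear_factor: "kpoly ([:- c, 1:] * g) r = (r - kconst c) * kpoly g r"
  by (simp add: kpoly_add kpoly_smult kpoly_pCons algebra_simps del: smult_minus_left)

text \<open>Evaluation of polynomials is compatible with passing to the residue field.\<close>

lemma kpoly_residue_class:
  assumes r: "r \<in> local_ring q" "r - kconst c \<in> max_ideal q"
  shows "kpoly g r - kconst (poly g c) \<in> max_ideal q"
proof (induction g)
  case (pCons d g)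
  have "kpoly (pCons d g) r - kconst (poly (pCons d g) c) =
      r * (kpoly g r - kconst (poly g c)) + (r - kconst c) * kconst (poly g c)"
    by (simp add: kpoly_pCons algebra_simps)
  also have "\<dots> \<in> max_ideal q"
    using pCons r by (intro max_ideal_add max_ideal_mult) auto
  finally show ?case .
qed simp

text \<open>A simple zero of \<open>g\<close> at the value of a local coordinate makes \<open>g\<close> itself a local coordinate.\<close>

lemma kpoly_simple_root:
  assumes r: "r \<in> local_ring q" "r - kconst c = uniformizer q * u" "local_unit q u"
    and root: "poly g c = 0" "poly (pderiv g) c \<noteq> 0"
  shows "local_unit q (kpoly (pderiv g) r)"
    "\<exists>w. local_unit q w \<and> kpoly g r = uniformizer q * w"
proof -
  have c: "r - kconst c \<in> max_ideal q"
    unfolding r(2) uniformizer_mult_in_max_ideal using r(3) by (simp add: local_unit_def)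
  show "local_unit q (kpoly (pderiv g) r)"
    using kpoly_residue_class[OF r(1) c] root(2) by (rule local_unitI)
  obtain h where h: "g = [:- c, 1:] * h" using root(1) unfolding poly_eq_0_iff_dvd by (rule dvdE)
  have "poly h c \<noteq> 0" using root(2) unfolding h pderiv_mult by (simp add: pderiv_pCons)
  then have "local_unit q (kpoly h r)" using kpoly_residue_class[OF r(1) c] by (intro local_unitI)
  then show "\<exists>w. local_unit q w \<and> kpoly g r = uniformizer q * w"
    unfolding h kpoly_linear_factor r(2)
    by (intro exI[of _ "u * kpoly h r"]) (simp add: local_unit_mult r(3) mult.assoc)
qed

section \<open>Vector fields and forms on the line\<close>

text \<open>The derivative is defined by the reduced fraction; the quotient rule is independent of the
representative.\<close>

lemma kderiv_Fract:
  assumes "q \<noteq> 0"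
  shows "kderiv (Fract p q) = Fract (pderiv p * q - p * pderiv q) (q * q)"
proof -
  define P Q where "P = fst (quot_of_fract (Fract p q))" and "Q = snd (quot_of_fract (Fract p q))"
  have Q: "Q \<noteq> 0" by (simp add: Q_def)
  have "Fract P Q = Fract p q" by (simp add: P_def Q_def)
  then have e: "P * q = p * Q" using Q assms by (simp add: eq_fract)
  then have "pderiv (P * q) = pderiv (p * Q)" by simp
  then have d: "pderiv P * q = pderiv p * Q + p * pderiv Q - P * pderiv q"
    by (simp add: pderiv_mult algebra_simps)
  have "(pderiv P * Q - P * pderiv Q) * (q * q) = (pderiv P * q) * (Q * q) - (P * q) * (pderiv Q * q)"
    by (simp add: algebra_simps)
  also have "\<dots> = (pderiv p * Q + p * pderiv Q - P * pderiv q) * (Q * q) - (p * Q) * (pderiv Q * q)"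
    by (simp only: d e)
  also have "\<dots> = pderiv p * Q * (Q * q) - (P * q) * (pderiv q * Q)"
    by (simp add: algebra_simps)
  also have "\<dots> = (pderiv p * q - p * pderiv q) * (Q * Q)"
    unfolding e by (simp add: algebra_simps)
  finally show ?thesis
    unfolding kderiv_def Let_def P_def[symmetric] Q_def[symmetric] using Q assms
    by (simp add: eq_fract)
qed

lemma kderiv_kconst [simp]: "kderiv (kconst c) = 0"
  by (simp add: kderiv_Fract pderiv_pCons)

lemma kderiv_add: "kderiv (x + y) = kderiv x + kderiv y"
proof (cases x rule: Fract_cases_nonzero)
  case 0
  then show ?thesis using kderiv_kconst[of 0] by simp
next
  case (Fract a b)
  show ?thesis
  proof (cases y rule: Fract_cases_nonzero)
    case 0
    then show ?thesis using kderiv_kconst[of 0] by simp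
  next
    case (Fract c d)
    with \<open>x = Fract a b\<close> \<open>b \<noteq> 0\<close> show ?thesis
      by (simp add: kderiv_Fract fract_arith eq_fract pderiv_mult pderiv_add algebra_simps)
  qed
qed

lemma kderiv_mult: "kderiv (x * y) = kderiv x * y + x * kderiv y"
proof (cases x rule: Fract_cases_nonzero)
  case 0
  then show ?thesis using kderiv_kconst[of 0] by simp
next
  case (Fract a b)
  show ?thesis
  proof (cases y rule: Fract_cases_nonzero)
    case 0
    then show ?thesis using kderiv_kconst[of 0] by simp
  next
    case (Fract c d)
    with \<open>x = Fract a b\<close> \<open>b \<noteq> 0\<close> show ?thesis
      by (simp add: kderiv_Fract fract_arith eq_fract pderiv_mult algebra_simps)
  qed
qed

text \<open>At infinity \<open>d(1/s) = - s\<^sup>-\<^sup>2 ds\<close>, which is why squares of the trivializing factor appear: they translate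
between \<open>ds\<close> and the differential of a local coordinate.\<close>

lemma kderiv_uniformizer:
  "\<exists>c. c \<noteq> 0 \<and> kderiv (uniformizer q) = kconst c * trivialization q ^ 2"
proof (cases q)
  case (Aff a)
  then show ?thesis by (intro exI[of _ 1]) (simp add: kderiv_Fract pderiv_pCons One_fract_def[symmetric] one_pCons[symmetric])
next
  case Infty
  have "kderiv (Fract 1 [:0, 1:]) = Fract (- 1) ([:0, 1:] * [:0, 1:])"
    by (simp add: kderiv_Fract pderiv_pCons one_pCons)
  also have "\<dots> = kconst (- 1) * Fract 1 [:0, 1:] ^ 2"
    by (simp add: power2_eq_square fract_arith eq_fract one_pCons)
  finally show ?thesis by (intro exI[of _ "- 1"]) (simp add: Infty)
qed

lemma kderiv_local_ring:
  assumes "x \<in> local_ring q"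
  shows "kderiv x / trivialization q ^ 2 \<in> local_ring q"
proof (cases q)
  case (Aff a)
  with assms obtain p r where x: "x = Fract p r" "poly r a \<noteq> 0" by auto
  then have "r \<noteq> 0" by auto
  then show ?thesis
    using x by (simp add: Aff kderiv_Fract local_ring_AffI del: local_ring.simps)
next
  case Infty
  \<comment> \<open>The quotient rule only gives a zero of order one at infinity for the derivative of a regular function;
    the constant term has to be removed to gain the second order.\<close>
  obtain c y where y: "y \<in> local_ring q" "x = kconst c + uniformizer q * y"
    using local_ring_expand[OF assms] .
  obtain p r where r: "y = Fract p r" "r \<noteq> 0" "degree p \<le> degree r" using y by (auto simp: Infty)
  have "degree ([:0, 1:] * (pderiv p * r - p * pderiv r)) \<le> degree (r * r)"
  proof (cases "pderiv p * r - p * pderiv r = 0")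
    case False
    have "degree p \<noteq> 0 \<or> degree r \<noteq> 0"
      using False by (metis degree_0_id diff_self mult_zero_left mult_zero_right pderiv_eq_0_iff)
    then have d: "degree r \<noteq> 0" using r by auto
    have "degree (pderiv p) \<le> degree r - 1" "degree (pderiv r) \<le> degree r - 1"
      using r by (auto simp: degree_pderiv)
    then have "degree (pderiv p * r - p * pderiv r) \<le> (degree r - 1) + degree r"
      using r by (intro degree_diff_le order.trans[OF degree_mult_le]) auto
    with d show ?thesis using False r by (simp add: degree_mult_eq del: mult_pCons_left)
  qed simp
  then have "Fract ([:0, 1:] * (pderiv p * r - p * pderiv r)) (r * r) \<in> local_ring Infty"
    using r by (intro local_ring_InftyI) simp_all
  moreover have "Fract ([:0, 1:] * (pderiv p * r - p * pderiv r)) (r * r) = kderiv y / uniformizer q"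
    using r by (simp add: Infty kderiv_Fract fract_arith mult.commute[of "[:0, 1:]"] del: mult_pCons_left mult_pCons_right)
  ultimately have *: "kderiv y / uniformizer q \<in> local_ring q" by (simp add: Infty)
  obtain d where d: "kderiv (uniformizer q) = kconst d * trivialization q ^ 2"
    using kderiv_uniformizer by blast
  have t: "uniformizer q = trivialization q" by (simp add: Infty)
  have "kderiv x = kconst d * trivialization q ^ 2 * y + uniformizer q * kderiv y"
    by (simp add: y kderiv_add kderiv_mult d)
  then have "kderiv x / trivialization q ^ 2 = kconst d * y + kderiv y / uniformizer q"
    using trivialization_nonzero[of q] by (simp add: t power2_eq_square field_simps)
  then show ?thesis using * y by simp
qed

lemma tangent_eq: "tangent q = {g. g * trivialization q ^ 2 \<in> local_ring q}"
proof (intro equalityI subsetI CollectI)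
  fix g assume "g \<in> tangent q"
  then have "g * kderiv (uniformizer q) \<in> local_ring q" by (simp add: tangent_def)
  moreover obtain c where "c \<noteq> 0" "kderiv (uniformizer q) = kconst c * trivialization q ^ 2"
    using kderiv_uniformizer by blast
  ultimately show "g * trivialization q ^ 2 \<in> local_ring q"
    using local_unit_cancel(1)[OF local_unit_const[of c q], of "g * trivialization q ^ 2"]
    by (simp add: mult.left_commute)
next
  fix g assume "g \<in> {g. g * trivialization q ^ 2 \<in> local_ring q}"
  then have g: "g * trivialization q ^ 2 \<in> local_ring q" by simp
  show "g \<in> tangent q"
    unfolding tangent_def
  proof (intro CollectI ballI)
    fix r assume r: "r \<in> local_ring q"
    have "(g * trivialization q ^ 2) * (kderiv r / trivialization q ^ 2) \<in> local_ring q"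
      by (rule local_ring_mult[OF g kderiv_local_ring[OF r]])
    then show "g * kderiv r \<in> local_ring q" by simp
  qed
qed

lemma log_tangent_eq:
  "log_tangent D q = {g. g * trivialization q ^ 2 \<in> (if q \<in> D then max_ideal q else local_ring q)}"
proof -
  obtain c where c: "c \<noteq> 0" "kderiv (uniformizer q) = kconst c * trivialization q ^ 2"
    using kderiv_uniformizer by blast
  have "(\<forall>r\<in>max_ideal q. g * kderiv r \<in> max_ideal q) \<longleftrightarrow> g * trivialization q ^ 2 \<in> max_ideal q" for g
  proof
    assume "\<forall>r\<in>max_ideal q. g * kderiv r \<in> max_ideal q"
    then have "g * kderiv (uniformizer q) \<in> max_ideal q" by simp
    then show "g * trivialization q ^ 2 \<in> max_ideal q"
      using local_unit_cancel(4)[OF local_unit_const[OF c(1), of q], of "g * trivialization q ^ 2"]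
      by (simp add: c(2) mult.left_commute)
  next
    assume g: "g * trivialization q ^ 2 \<in> max_ideal q"
    show "\<forall>r\<in>max_ideal q. g * kderiv r \<in> max_ideal q"
    proof
      fix r assume r: "r \<in> max_ideal q"
      have "(g * trivialization q ^ 2) * (kderiv r / trivialization q ^ 2) \<in> max_ideal q"
        by (rule max_ideal_mult(1)[OF g kderiv_local_ring[OF max_ideal_imp_local_ring[OF r]]])
      then show "g * kderiv r \<in> max_ideal q" by simp
    qed
  qed
  then show ?thesis
    unfolding log_tangent_def tangent_eq by (auto intro: max_ideal_imp_local_ring)
qed

lemma canonical_eq: "canonical q = {\<theta>. \<theta> / trivialization q ^ 2 \<in> local_ring q}"
proof (intro equalityI subsetI CollectI)
  fix \<theta> assume "\<theta> \<in> canonical q"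
  moreover have "inverse (trivialization q ^ 2) \<in> tangent q" by (simp add: tangent_eq)
  ultimately have "\<theta> * inverse (trivialization q ^ 2) \<in> local_ring q"
    unfolding canonical_def by blast
  then show "\<theta> / trivialization q ^ 2 \<in> local_ring q" by (simp add: divide_inverse)
next
  fix \<theta> assume "\<theta> \<in> {\<theta>. \<theta> / trivialization q ^ 2 \<in> local_ring q}"
  then have t: "\<theta> / trivialization q ^ 2 \<in> local_ring q" by simp
  have "\<theta> * g \<in> local_ring q" if "g * trivialization q ^ 2 \<in> local_ring q" for g
    using local_ring_mult[OF t that] by simp
  then show "\<theta> \<in> canonical q" by (simp add: canonical_def tangent_eq)
qed

lemma canonical_0 [simp]: "0 \<in> canonical q"
  by (simp add: canonical_def)

lemma canonical_add [simp]: "x \<in> canonical q \<Longrightarrow> y \<in> canonical q \<Longrightarrow> x + y \<in> canonical q"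
  by (simp add: canonical_eq add_divide_distrib)

lemma canonical_mult: "x \<in> canonical q \<Longrightarrow> c \<in> local_ring q \<Longrightarrow> c * x \<in> canonical q"
  unfolding canonical_eq using local_ring_mult[of c q "x / trivialization q ^ 2"] by simp

lemma canonical_const [simp]: "x \<in> canonical q \<Longrightarrow> kconst c * x \<in> canonical q"
  by (simp add: canonical_mult)

lemma canonical_uminus [simp]: "x \<in> canonical q \<Longrightarrow> - x \<in> canonical q"
  using canonical_const[of x q "- 1"] by simp

lemma canonical_diff [simp]: "x \<in> canonical q \<Longrightarrow> y \<in> canonical q \<Longrightarrow> x - y \<in> canonical q"
  using canonical_add[of x q "- y"] by simp

lemma canonical_Aff: "canonical (Aff a) = local_ring (Aff a)"
  by (simp add: canonical_eq)

definition poles :: "K \<Rightarrow> complex set" where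
  "poles x = {s. poly (snd (quot_of_fract x)) s = 0}"

lemma finite_poles: "finite (poles x)"
  unfolding poles_def by (rule poly_roots_finite) simp

lemma local_ring_Aff_iff: "x \<in> local_ring (Aff a) \<longleftrightarrow> a \<notin> poles x"
proof
  assume "a \<notin> poles x"
  then show "x \<in> local_ring (Aff a)"
    using local_ring_AffI[of "snd (quot_of_fract x)" a "fst (quot_of_fract x)"] by (simp add: poles_def)
next
  define P Q where "P = fst (quot_of_fract x)" and "Q = snd (quot_of_fract x)"
  have Q: "Q \<noteq> 0" "x = Fract P Q" by (simp_all add: Q_def P_def)
  assume "x \<in> local_ring (Aff a)"
  then obtain p q where pq: "x = Fract p q" "poly q a \<noteq> 0" by auto
  then have "q \<noteq> 0" by auto
  with Q pq have e: "P * q = p * Q" by (simp add: eq_fract)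
  have "poly Q a \<noteq> 0"
  proof
    assume "poly Q a = 0"
    then have "poly P a * poly q a = 0" using e by (metis mult_zero_right poly_mult)
    then have "poly P a = 0" using pq by simp
    with \<open>poly Q a = 0\<close> have "[:- a, 1:] dvd P" "[:- a, 1:] dvd Q" by (simp_all add: poly_eq_0_iff_dvd)
    moreover have "coprime P Q" unfolding P_def Q_def by (rule coprime_quot_of_fract)
    ultimately have "is_unit [:- a, 1:]" by (metis coprime_common_divisor)
    then show False by (simp add: is_unit_pCons_iff)
  qed
  then show "a \<notin> poles x" by (simp add: poles_def Q_def)
qed

lemma keval_Fract:
  assumes "poly q s \<noteq> 0"
  shows "keval (Fract p q) s = poly p s / poly q s"
proof -
  define P Q where "P = fst (quot_of_fract (Fract p q))" and "Q = snd (quot_of_fract (Fract p q))"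
  have "Fract p q \<in> local_ring (Aff s)" using assms by (rule local_ring_AffI)
  then have Q: "poly Q s \<noteq> 0" by (simp add: local_ring_Aff_iff poles_def Q_def del: local_ring.simps)
  have "Q \<noteq> 0" "q \<noteq> 0" "Fract P Q = Fract p q" using assms by (auto simp: P_def Q_def)
  then have "P * q = p * Q" by (simp add: eq_fract)
  then have "poly P s * poly q s = poly p s * poly Q s" by (metis poly_mult)
  then show ?thesis
    unfolding keval_def P_def[symmetric] Q_def[symmetric] using Q assms by (simp add: field_simps)
qed

lemma pole_free_Fract:
  assumes "s \<notin> poles x"
  obtains p q where "x = Fract p q" "poly q s \<noteq> 0" "q \<noteq> 0"
proof
  show "x = Fract (fst (quot_of_fract x)) (snd (quot_of_fract x))" by simp
  show "poly (snd (quot_of_fract x)) s \<noteq> 0" using assms by (simp add: poles_def)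
qed simp

lemma keval_add:
  assumes "s \<notin> poles x" "s \<notin> poles y"
  shows "keval (x + y) s = keval x s + keval y s"
proof -
  obtain p q where x: "x = Fract p q" "poly q s \<noteq> 0" "q \<noteq> 0"
    using assms(1) by (rule pole_free_Fract)
  obtain p' q' where y: "y = Fract p' q'" "poly q' s \<noteq> 0" "q' \<noteq> 0"
    using assms(2) by (rule pole_free_Fract)
  have "x + y = Fract (p * q' + p' * q) (q * q')"
    using x y by (simp add: fract_arith)
  then show ?thesis
    using x y by (simp add: keval_Fract add_divide_distrib)
qed

lemma keval_kconst_mult:
  assumes "s \<notin> poles x"
  shows "keval (kconst c * x) s = c * keval x s"
proof -
  obtain p q where x: "x = Fract p q" "poly q s \<noteq> 0" "q \<noteq> 0"
    using assms by (rule pole_free_Fract)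
  then have "kconst c * x = Fract ([:c:] * p) q"
    by (simp add: fract_arith)
  then show ?thesis
    using x by (simp add: keval_Fract)
qed

text \<open>The next three functions describe the local coordinate in which a residue is computed, so that the
two defining clauses of the residue of a form become one.\<close>

fun chart :: "P1 \<Rightarrow> complex \<Rightarrow> complex" where
  "chart (Aff a) u = u"
| "chart Infty u = 1 / u"

fun chart_deriv :: "P1 \<Rightarrow> complex \<Rightarrow> complex" where
  "chart_deriv (Aff a) u = 1"
| "chart_deriv Infty u = - 1 / u\<^sup>2"

fun center :: "P1 \<Rightarrow> complex" where
  "center (Aff a) = a"
| "center Infty = 0"

lemma form_residue_chart:
  "form_residue q \<theta> = residue (\<lambda>u. chart_deriv q u * keval \<theta> (chart q u)) (center q)"
  by (cases q) simp_all

lemma eventually_chart: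
  assumes "finite F"
  shows "\<forall>\<^sub>F u in at (center q). chart q u \<notin> F"
proof -
  have "inj (chart q)" by (cases q) (simp_all add: inj_def)
  then have "finite (chart q -` F)" using assms by (rule finite_vimageI[rotated])
  then have "open (- (chart q -` F - {center q}))"
    by (intro open_Compl finite_imp_closed finite_Diff)
  then have "\<forall>\<^sub>F u in at (center q). u \<in> - (chart q -` F - {center q})"
    by (rule eventually_at_in_open') simp
  moreover have "\<forall>\<^sub>F u in at (center q). u \<noteq> center q" by (simp add: eventually_at_filter)
  ultimately show ?thesis by eventually_elim auto
qed

lemma holomorphic_chart:
  obtains S where "open S" "center q \<in> S"
    "(\<lambda>u. chart_deriv q u * keval \<theta> (chart q u)) holomorphic_on S - {center q}"
proof
  define F where "F = chart q -` poles \<theta> - {center q}"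
  have "inj (chart q)" by (cases q) (simp_all add: inj_def)
  then have "finite F" unfolding F_def using finite_poles by (intro finite_Diff finite_vimageI)
  then show "open (- F)" by (simp add: finite_imp_closed open_Compl)
  show "center q \<in> - F" by (simp add: F_def)
  have "poly (snd (quot_of_fract \<theta>)) (chart q u) \<noteq> 0" if "u \<in> - F - {center q}" for u
    using that by (auto simp: F_def poles_def)
  then show "(\<lambda>u. chart_deriv q u * keval \<theta> (chart q u)) holomorphic_on - F - {center q}"
    unfolding keval_def by (cases q) (auto intro!: holomorphic_intros)
qed

lemma form_residue_add: "form_residue q (\<theta> + \<theta>') = form_residue q \<theta> + form_residue q \<theta>'"
proof -
  obtain S where S: "open S" "center q \<in> S"
    "(\<lambda>u. chart_deriv q u * keval \<theta> (chart q u)) holomorphic_on S - {center q}"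
    using holomorphic_chart .
  obtain S' where S': "open S'" "center q \<in> S'"
    "(\<lambda>u. chart_deriv q u * keval \<theta>' (chart q u)) holomorphic_on S' - {center q}"
    using holomorphic_chart .
  have "form_residue q (\<theta> + \<theta>') =
      residue (\<lambda>u. chart_deriv q u * keval \<theta> (chart q u) + chart_deriv q u * keval \<theta>' (chart q u)) (center q)"
    unfolding form_residue_chart
  proof (rule residue_cong)
    show "\<forall>\<^sub>F u in at (center q). chart_deriv q u * keval (\<theta> + \<theta>') (chart q u) =
        chart_deriv q u * keval \<theta> (chart q u) + chart_deriv q u * keval \<theta>' (chart q u)"
      using eventually_chart[OF finite_poles[of \<theta>]] eventually_chart[OF finite_poles[of \<theta>']]
      by eventually_elim (simp add: keval_add distrib_left)
  qed simp
  also have "\<dots> = form_residue q \<theta> + form_residue q \<theta>'"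
    unfolding form_residue_chart
    by (rule residue_add[of "S \<inter> S'"])
      (use S S' in \<open>auto intro: holomorphic_on_subset\<close>)
  finally show ?thesis .
qed

lemma form_residue_kconst_mult: "form_residue q (kconst c * \<theta>) = c * form_residue q \<theta>"
proof -
  obtain S where S: "open S" "center q \<in> S"
    "(\<lambda>u. chart_deriv q u * keval \<theta> (chart q u)) holomorphic_on S - {center q}"
    using holomorphic_chart .
  have "form_residue q (kconst c * \<theta>) = residue (\<lambda>u. c * (chart_deriv q u * keval \<theta> (chart q u))) (center q)"
    unfolding form_residue_chart
  proof (rule residue_cong)
    show "\<forall>\<^sub>F u in at (center q). chart_deriv q u * keval (kconst c * \<theta>) (chart q u) =
        c * (chart_deriv q u * keval \<theta> (chart q u))"
      using eventually_chart[OF finite_poles[of \<theta>]]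
      by eventually_elim (simp add: keval_kconst_mult)
  qed simp
  also have "\<dots> = c * form_residue q \<theta>"
    unfolding form_residue_chart by (rule residue_lmul[OF S])
  finally show ?thesis .
qed

lemma form_residue_uminus: "form_residue q (- \<theta>) = - form_residue q \<theta>"
  using form_residue_kconst_mult[of q "- 1" \<theta>] by simp

lemma form_residue_diff: "form_residue q (\<theta> - \<theta>') = form_residue q \<theta> - form_residue q \<theta>'"
  using form_residue_add[of q \<theta> "- \<theta>'"] by (simp add: form_residue_uminus)

lemma form_residue_0 [simp]: "form_residue q 0 = 0"
  using form_residue_kconst_mult[of q 0 0] by simp

lemma form_residue_canonical:
  assumes "\<theta> \<in> canonical q"
  shows "form_residue q \<theta> = 0"
proof (cases q)
  case (Aff a)
  with assms obtain p r where t: "\<theta> = Fract p r" "poly r a \<noteq> 0" by (auto simp: canonical_Aff)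
  have "open {z. poly r z \<noteq> 0}" by (intro open_Collect_neq continuous_intros)
  moreover have "keval \<theta> holomorphic_on {z. poly r z \<noteq> 0}"
    by (rule holomorphic_transform[of "\<lambda>z. poly p z / poly r z"])
      (auto intro!: holomorphic_intros simp: keval_Fract t)
  ultimately have "residue (keval \<theta>) a = 0"
    using t by (intro residue_holo[of "{z. poly r z \<noteq> 0}"]) auto
  then show ?thesis by (simp add: Aff)
next
  case Infty
  from assms obtain p r where t: "\<theta> / trivialization q ^ 2 = Fract p r" "r \<noteq> 0" "degree p \<le> degree r"
    unfolding canonical_eq Infty by auto
  have "\<theta> = Fract p r * trivialization q ^ 2" unfolding t(1)[symmetric] by simp
  then have \<theta>: "\<theta> = Fract p (r * [:0, 0, 1:])" by (simp add: Infty power2_eq_square mult_fract)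
  define g where "g = (\<lambda>u. - (u ^ (degree r - degree p)) * poly (reflect_poly p) u / poly (reflect_poly r) u)"
  have "form_residue q \<theta> = residue g 0"
    unfolding Infty form_residue.simps
  proof (rule residue_cong)
    have "finite (insert 0 {s. poly r s = 0})" using t poly_roots_finite by auto
    from eventually_chart[OF this, of Infty]
    show "\<forall>\<^sub>F u in at 0. - keval \<theta> (1 / u) / u\<^sup>2 = g u"
      unfolding center.simps
    proof eventually_elim
      case (elim u)
      then have u: "u \<noteq> 0" "poly r (inverse u) \<noteq> 0" by (auto simp: inverse_eq_divide)
      then have "keval \<theta> (inverse u) = poly p (inverse u) / (poly r (inverse u) * (inverse u) ^ 2)"
        unfolding \<theta> by (subst keval_Fract) (auto simp: power2_eq_square)
      then have e: "- keval \<theta> (1 / u) / u\<^sup>2 = - poly p (inverse u) / poly r (inverse u)"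
        using u by (simp add: inverse_eq_divide[symmetric]) (simp add: field_simps)
      have "u ^ degree r = u ^ (degree r - degree p) * u ^ degree p"
        using t by (simp flip: power_add)
      then have "g u = - poly p (inverse u) / poly r (inverse u)"
        using u by (simp add: g_def poly_reflect_poly_nz)
      with e show ?case by simp
    qed
  qed simp
  also have "open {u. poly (reflect_poly r) u \<noteq> 0}" by (intro open_Collect_neq continuous_intros)
  then have "residue g 0 = 0"
    by (rule residue_holo) (use t in \<open>auto simp: g_def intro!: holomorphic_intros\<close>)
  finally show ?thesis .
qed

lemma form_residue_congruent:
  assumes "\<theta> - \<theta>' \<in> canonical q"
  shows "form_residue q \<theta> = form_residue q \<theta>'"
  using form_residue_canonical[OF assms] by (simp add: form_residue_diff)

lemma finite_noncanonical: "finite {q. \<theta> \<notin> canonical q}"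
proof (rule finite_subset)
  show "{q. \<theta> \<notin> canonical q} \<subseteq> insert Infty (Aff ` poles \<theta>)"
  proof
    fix q assume "q \<in> {q. \<theta> \<notin> canonical q}"
    then show "q \<in> insert Infty (Aff ` poles \<theta>)"
      by (cases q) (auto simp: canonical_Aff local_ring_Aff_iff simp del: local_ring.simps)
  qed
qed (simp add: finite_poles)

section \<open>Partial fractions and the residue theorem\<close>

abbreviation simple_fraction :: "complex \<Rightarrow> nat \<Rightarrow> K" where
  "simple_fraction a n \<equiv> Fract 1 ([:- a, 1:] ^ n)"

lemma Fract_split: "q \<noteq> 0 \<Longrightarrow> Fract (p + p') q = Fract p q + Fract p' q"
  by (simp add: add_fract eq_fract algebra_simps)

text \<open>Partial fraction decomposition as an induction principle: rational functions are sums of monomials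
and of multiples of negative powers of \<open>s - a\<close>.\<close>

lemma partial_fraction_induct [consumes 0, case_names add monom pole]:
  fixes x :: K
  assumes add: "\<And>x y. P x \<Longrightarrow> P y \<Longrightarrow> P (x + y)"
    and monom: "\<And>c n. P (Fract (Polynomial.monom c n) 1)"
    and pole: "\<And>c a n. P (kconst c * simple_fraction a (Suc n))"
  shows "P x"
proof -
  have poly: "P (Fract p 1)" for p
  proof -
    have "P (Fract (\<Sum>n\<in>S. Polynomial.monom (coeff p n) n) 1)" if "finite S" for S
      using that
    proof (induction S)
      case empty
      show ?case using monom[of 0 0] by simp
    next
      case (insert n S)
      then show ?case using add[OF monom insert.IH] by (simp add: Fract_split)
    qed
    from this[of "{..degree p}"] show ?thesis by (simp add: poly_as_sum_of_monoms)
  qed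
  have main: "q \<noteq> 0 \<Longrightarrow> degree q = n \<Longrightarrow> P (Fract p q)" for p q n
  proof (induction n arbitrary: p q)
    case 0
    then obtain c where c: "q = [:c:]" "c \<noteq> 0" by (metis degree_eq_zeroE pCons_0_0)
    then have "Fract p q = Fract (Polynomial.smult (1 / c) p) 1" by (simp add: eq_fract)
    then show ?case using poly by simp
  next
    case (Suc n)
    then have "\<not> constant (poly q)" by (simp add: constant_degree)
    then obtain a where a: "poly q a = 0" using fundamental_theorem_of_algebra by blast
    define m where "m = order a q"
    obtain r where r: "q = [:- a, 1:] ^ m * r" "\<not> [:- a, 1:] dvd r"
      using order_decomp[OF Suc.prems(1), of a] unfolding m_def by blast
    have "m \<noteq> 0" using a Suc.prems(1) by (simp add: m_def order_root)
    then obtain k where k: "m = Suc k" by (cases m) auto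
    have ra: "poly r a \<noteq> 0" using r by (simp add: poly_eq_0_iff_dvd)
    have r0: "r \<noteq> 0" using ra by auto
    define c where "c = poly p a / poly r a"
    have "poly (p - Polynomial.smult c r) a = 0" using ra by (simp add: c_def)
    then obtain g where g: "p - Polynomial.smult c r = [:- a, 1:] * g"
      unfolding poly_eq_0_iff_dvd by (rule dvdE)
    \<comment> \<open>Subtracting the leading polar term at the root \<open>a\<close> lowers the degree of the denominator.\<close>
    define q' where "q' = [:- a, 1:] ^ k * r"
    have q': "q = [:- a, 1:] * q'" by (simp only: r(1) k q'_def power_Suc mult.assoc)
    then have "q' \<noteq> 0" using Suc.prems by auto
    note q' = q' this
    have "p = Polynomial.smult c r + [:- a, 1:] * g" using g by (simp add: algebra_simps)
    then have "Fract p q = Fract (Polynomial.smult c r) q + Fract ([:- a, 1:] * g) q"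
      using Suc.prems by (simp add: Fract_split del: mult_pCons_left)
    also have "Fract ([:- a, 1:] * g) q = Fract g q'"
      using q' by (simp add: eq_fract del: mult_pCons_left)
    also have "Fract (Polynomial.smult c r) q = kconst c * simple_fraction a (Suc k)"
    proof -
      have "Fract (Polynomial.smult c r) (u * r) = kconst c * Fract 1 u" if "u \<noteq> 0" for u
        using r0 that by (simp add: mult_fract eq_fract mult.commute)
      then show ?thesis unfolding r(1) k by (simp del: power_Suc)
    qed
    finally have e: "Fract p q = kconst c * simple_fraction a (Suc k) + Fract g q'" .
    have "degree q = Suc (degree q')" using q' by (simp add: degree_mult_eq del: mult_pCons_left)
    then have "P (Fract g q')" using Suc q' by auto
    then show ?case unfolding e using add pole by blast
  qed
  show ?thesis
    using main[of "snd (quot_of_fract x)" _ "fst (quot_of_fract x)"] by simp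
qed

lemma simple_fraction_in_local_ring: "b \<noteq> a \<Longrightarrow> simple_fraction a n \<in> local_ring (Aff b)"
  by (rule local_ring_AffI) simp

lemma simple_fraction_canonical_Infty: "simple_fraction a (Suc (Suc n)) \<in> canonical Infty"
proof -
  have "Fract ([:0, 1:] ^ 2) ([:- a, 1:] ^ Suc (Suc n)) \<in> local_ring Infty"
    by (rule local_ring_InftyI) (simp_all add: degree_power_eq del: power_Suc)
  then show ?thesis
    by (simp add: canonical_eq power2_eq_square fract_arith del: power_Suc local_ring.simps)
qed

lemma form_residue_simple_fraction:
  "form_residue (Aff b) (simple_fraction a (Suc n)) = (if b = a \<and> n = 0 then 1 else 0)"
  "form_residue Infty (simple_fraction a (Suc n)) = (if n = 0 then - 1 else 0)"
proof -
  have "form_residue (Aff a) (simple_fraction a (Suc n)) = residue (\<lambda>z. 1 / (z - a) ^ Suc n) a"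
    unfolding form_residue.simps
  proof (rule residue_cong)
    have "\<forall>\<^sub>F z in at a. z \<noteq> a" by (simp add: eventually_at_filter)
    then show "\<forall>\<^sub>F z in at a. keval (simple_fraction a (Suc n)) z = 1 / (z - a) ^ Suc n"
      by eventually_elim (subst keval_Fract; simp add: algebra_simps)
  qed simp
  also have "\<dots> = (if n = 0 then 1 else 0)"
    by (subst residue_holomorphic_over_power[of UNIV]) auto
  finally show "form_residue (Aff b) (simple_fraction a (Suc n)) = (if b = a \<and> n = 0 then 1 else 0)"
    by (cases "b = a") (auto intro!: form_residue_canonical simple_fraction_in_local_ring
        simp: canonical_Aff simp del: form_residue.simps local_ring.simps power_Suc)
  show "form_residue Infty (simple_fraction a (Suc n)) = (if n = 0 then - 1 else 0)"
  proof (cases n)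
    case 0
    have "form_residue Infty (simple_fraction a (Suc n)) = residue (\<lambda>u. (- 1 / (1 - a * u)) / (u - 0)) 0"
      unfolding form_residue.simps
    proof (rule residue_cong)
      show "\<forall>\<^sub>F u in at 0. - keval (simple_fraction a (Suc n)) (1 / u) / u\<^sup>2 = (- 1 / (1 - a * u)) / (u - 0)"
        using eventually_chart[of "{0, a}" Infty, unfolded center.simps chart.simps, simplified]
      proof eventually_elim
        case (elim u)
        then have "1 / u - a \<noteq> 0" "u \<noteq> 0" by auto
        moreover from this have "1 - a * u \<noteq> 0" by (simp add: field_simps)
        ultimately show ?case by (subst keval_Fract) (simp_all add: 0 field_simps power2_eq_square)
      qed
    qed simp
    also have "\<dots> = - 1"
    proof -
      have o: "open {u. 1 - a * u \<noteq> 0}" by (intro open_Collect_neq continuous_intros)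
      show ?thesis
        by (subst residue_simple[OF o]) (auto intro!: holomorphic_intros)
    qed
    finally show ?thesis by (simp add: 0)
  next
    case (Suc m)
    show ?thesis
      unfolding Suc by (simp only: form_residue_canonical[OF simple_fraction_canonical_Infty]) simp
  qed
qed

lemma form_residue_monom: "form_residue q (Fract (Polynomial.monom c n) 1) = 0"
proof (cases q)
  case (Aff a)
  have "Fract (Polynomial.monom c n) 1 \<in> canonical (Aff a)"
    unfolding canonical_Aff by (rule local_ring_AffI) simp
  then show ?thesis unfolding Aff by (rule form_residue_canonical)
next
  case Infty
  have "form_residue Infty (Fract (Polynomial.monom c n) 1) = residue (\<lambda>u. (- c) / u ^ Suc (Suc n)) 0"
    unfolding form_residue.simps
  proof (rule residue_cong)
    have "\<forall>\<^sub>F u in at 0. u \<noteq> (0 :: complex)" by (simp add: eventually_at_filter)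
    then show "\<forall>\<^sub>F u in at 0. - keval (Fract (Polynomial.monom c n) 1) (1 / u) / u\<^sup>2 = (- c) / u ^ Suc (Suc n)"
      by eventually_elim (subst keval_Fract; simp add: poly_monom power2_eq_square divide_simps)
  qed simp
  also have "\<dots> = 0"
    by (subst residue_holomorphic_over_power'[of UNIV]) (auto simp del: power_Suc)
  finally show ?thesis by (simp add: Infty)
qed

lemma finite_residues:
  assumes "finite {q. \<delta> q \<notin> canonical q}"
  shows "finite {q. form_residue q (\<delta> q) \<noteq> 0}"
  by (rule finite_subset[OF _ assms]) (auto intro: form_residue_canonical)

lemma residue_sum_add:
  assumes "finite {q. \<delta> q \<notin> canonical q}" "finite {q. \<delta>' q \<notin> canonical q}"
  shows "Sum_any (\<lambda>q. form_residue q (\<delta> q + \<delta>' q)) =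
    Sum_any (\<lambda>q. form_residue q (\<delta> q)) + Sum_any (\<lambda>q. form_residue q (\<delta>' q))"
  unfolding form_residue_add by (intro Sum_any.distrib finite_residues assms)

text \<open>Both sides are additive, so partial fractions reduce this to the form \<open>ds/(s - a)\<close>, whose
residue \<open>1\<close> at \<open>a\<close> cancels the residue \<open>- 1\<close> at infinity; all other terms have no residues.\<close>

theorem residue_theorem: "Sum_any (\<lambda>q. form_residue q \<theta>) = 0"
proof (induction \<theta> rule: partial_fraction_induct)
  case (add x y)
  then show ?case using residue_sum_add[OF finite_noncanonical[of x] finite_noncanonical[of y]] by simp
next
  case (monom c n)
  show ?case by (simp add: form_residue_monom)
next
  case (pole c a n)
  have z: "form_residue q (kconst c * simple_fraction a (Suc n)) = 0" if "q \<notin> {Aff a, Infty}" for q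
    using that by (cases q) (simp_all add: form_residue_kconst_mult form_residue_simple_fraction
        del: form_residue.simps power_Suc)
  have "Sum_any (\<lambda>q. form_residue q (kconst c * simple_fraction a (Suc n))) =
      (\<Sum>q\<in>{Aff a, Infty}. form_residue q (kconst c * simple_fraction a (Suc n)))"
    by (rule Sum_any.expand_superset) (use z in auto)
  also have "\<dots> = 0"
    by (simp add: form_residue_kconst_mult form_residue_simple_fraction del: form_residue.simps power_Suc)
  finally show ?case .
qed

text \<open>The polar part at one point of the partial fraction decomposition. It vanishes at infinity
as a function, so that as a form it has at most a simple pole there.\<close>

lemma principal_part:
  "\<exists>\<kappa>. \<theta> - \<kappa> \<in> local_ring (Aff a) \<and> (\<forall>b. b \<noteq> a \<longrightarrow> \<kappa> \<in> local_ring (Aff b)) \<and> \<kappa> \<in> max_ideal Infty"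
proof (induction \<theta> rule: partial_fraction_induct)
  case (add x y)
  then obtain \<kappa> \<kappa>' where
    "x - \<kappa> \<in> local_ring (Aff a) \<and> (\<forall>b. b \<noteq> a \<longrightarrow> \<kappa> \<in> local_ring (Aff b)) \<and> \<kappa> \<in> max_ideal Infty"
    "y - \<kappa>' \<in> local_ring (Aff a) \<and> (\<forall>b. b \<noteq> a \<longrightarrow> \<kappa>' \<in> local_ring (Aff b)) \<and> \<kappa>' \<in> max_ideal Infty"
    by blast
  moreover from this have "(x - \<kappa>) + (y - \<kappa>') \<in> local_ring (Aff a)"
    by (intro local_ring_add) simp_all
  then have "x + y - (\<kappa> + \<kappa>') \<in> local_ring (Aff a)"
    by (simp only: add_diff_add)
  ultimately show ?case
    by (intro exI[of _ "\<kappa> + \<kappa>'"]) (simp del: local_ring.simps)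
next
  case (monom c n)
  have "Fract (Polynomial.monom c n) 1 \<in> local_ring (Aff a)" by (rule local_ring_AffI) simp
  then show ?case by (intro exI[of _ 0]) (simp del: local_ring.simps)
next
  case (pole c b n)
  show ?case
  proof (cases "b = a")
    case True
    have "Fract ([:0, 1:] * [:1:]) ([:- a, 1:] ^ Suc n) \<in> local_ring Infty"
      by (rule local_ring_InftyI) (simp_all add: degree_power_eq del: power_Suc)
    moreover have "simple_fraction a (Suc n) = uniformizer Infty * Fract ([:0, 1:] * [:1:]) ([:- a, 1:] ^ Suc n)"
      by (simp add: mult_fract eq_fract del: power_Suc)
    ultimately have "simple_fraction a (Suc n) \<in> max_ideal Infty"
      using uniformizer_mult_in_max_ideal[of Infty] by metis
    then show ?thesis
      using True by (intro exI[of _ "kconst c * simple_fraction b (Suc n)"])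
        (auto intro!: local_ring_mult max_ideal_mult(2) simple_fraction_in_local_ring simp del: local_ring.simps power_Suc uniformizer.simps)
  next
    case False
    then show ?thesis
      by (intro exI[of _ 0]) (auto intro!: local_ring_mult simple_fraction_in_local_ring simp del: local_ring.simps power_Suc)
  qed
qed

lemma canonical_Infty_if_residue_0:
  assumes "\<kappa> \<in> max_ideal Infty" "form_residue Infty \<kappa> = 0"
  shows "\<kappa> \<in> canonical Infty"
proof -
  obtain x where x: "x \<in> local_ring Infty" "\<kappa> = uniformizer Infty * x"
    using assms(1) unfolding max_ideal_eq by blast
  obtain c y where y: "y \<in> local_ring Infty" "x = kconst c + uniformizer Infty * y"
    using local_ring_expand[OF x(1)] .
  have u: "uniformizer Infty = simple_fraction 0 (Suc 0)" "uniformizer Infty = trivialization Infty" by simp_all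
  have k: "\<kappa> = kconst c * simple_fraction 0 (Suc 0) + y * trivialization Infty ^ 2"
    unfolding x y u(1)[symmetric] by (simp only: u(2)) (simp add: power2_eq_square algebra_simps)
  have *: "y * trivialization Infty ^ 2 \<in> canonical Infty"
    using y trivialization_nonzero[of Infty] unfolding canonical_eq by (simp del: trivialization.simps local_ring.simps)
  \<comment> \<open>The leading coefficient at infinity is the negative of the residue there.\<close>
  have "form_residue Infty \<kappa> = - c"
    unfolding k form_residue_add form_residue_canonical[OF *] form_residue_kconst_mult form_residue_simple_fraction
    by simp
  then have "c = 0" using assms by simp
  then show ?thesis using * by (simp add: k del: trivialization.simps)
qed

text \<open>The Mittag-Leffler problem for forms. The sum of all affine polar parts has at most a simple pole at
infinity, and its residue there is the negative of the sum of the prescribed residues. So the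
vanishing of this sum is what makes the form regular at infinity.\<close>

theorem principal_parts:
  assumes fin: "finite {q. \<delta> q \<notin> canonical q}" and sum: "Sum_any (\<lambda>q. form_residue q (\<delta> q)) = 0"
  obtains \<kappa> where "\<And>q. \<delta> q + \<kappa> \<in> canonical q"
proof -
  \<comment> \<open>A global form may be subtracted, so nothing is prescribed at infinity.\<close>
  define \<epsilon> where "\<epsilon> q = \<delta> q + - \<delta> Infty" for q
  have fin': "finite {q. \<epsilon> q \<notin> canonical q}"
    by (rule finite_subset[OF _ finite_UnI[OF fin finite_noncanonical[of "- \<delta> Infty"]]])
      (use canonical_add[of "\<delta> q" q "- \<delta> Infty" for q] in \<open>auto simp only: \<epsilon>_def\<close>)
  have sum': "Sum_any (\<lambda>q. form_residue q (\<epsilon> q)) = 0"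
    unfolding \<epsilon>_def residue_sum_add[OF fin finite_noncanonical] sum residue_theorem by simp
  have "\<forall>a. \<exists>\<kappa>. \<epsilon> (Aff a) - \<kappa> \<in> local_ring (Aff a) \<and>
      (\<forall>b. b \<noteq> a \<longrightarrow> \<kappa> \<in> local_ring (Aff b)) \<and> \<kappa> \<in> max_ideal Infty"
    using principal_part by blast
  then obtain pp where pp: "\<And>a. \<epsilon> (Aff a) - pp a \<in> local_ring (Aff a)"
    "\<And>a b. b \<noteq> a \<Longrightarrow> pp a \<in> local_ring (Aff b)" "\<And>a. pp a \<in> max_ideal Infty"
    by metis
  define S where "S = {a. \<epsilon> (Aff a) \<notin> canonical (Aff a)}"
  have S: "finite S"
    using finite_vimageI[OF fin', of Aff] by (simp add: S_def vimage_def inj_def)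
  define \<kappa> where "\<kappa> = - (\<Sum>a\<in>S. pp a)"
  have local_sum: "sum x A \<in> local_ring q" if "\<And>i. i \<in> A \<Longrightarrow> x i \<in> local_ring q" for x and A :: "complex set" and q
    using that by (induction A rule: infinite_finite_induct) (simp_all del: local_ring.simps)
  have aff: "\<epsilon> (Aff b) + \<kappa> \<in> canonical (Aff b)" for b
  proof (cases "b \<in> S")
    case True
    then have "\<epsilon> (Aff b) + \<kappa> = (\<epsilon> (Aff b) - pp b) - (\<Sum>a\<in>S - {b}. pp a)"
      using S by (simp add: \<kappa>_def sum.remove)
    then show ?thesis
      unfolding canonical_Aff by (simp only:) (intro local_ring_diff pp local_sum, auto)
  next
    case False
    then have "(\<Sum>a\<in>S. pp a) \<in> canonical (Aff b)"
      unfolding canonical_Aff by (intro local_sum pp) auto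
    then show ?thesis using False by (simp add: \<kappa>_def S_def)
  qed
  have "Sum_any (\<lambda>q. form_residue q (\<epsilon> q + \<kappa>)) = 0"
    unfolding residue_sum_add[OF fin' finite_noncanonical] sum' residue_theorem by simp
  also have "Sum_any (\<lambda>q. form_residue q (\<epsilon> q + \<kappa>)) = (\<Sum>q\<in>{Infty}. form_residue q (\<epsilon> q + \<kappa>))"
  proof (rule Sum_any.expand_superset)
    show "{q. form_residue q (\<epsilon> q + \<kappa>) \<noteq> 0} \<subseteq> {Infty}"
    proof
      fix q assume "q \<in> {q. form_residue q (\<epsilon> q + \<kappa>) \<noteq> 0}"
      then show "q \<in> {Infty}"
        using form_residue_canonical[OF aff] by (cases q) (auto simp del: form_residue.simps)
    qed
  qed simp
  finally have "form_residue Infty \<kappa> = 0" by (simp add: \<epsilon>_def)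
  moreover have "(\<Sum>a\<in>S. pp a) \<in> max_ideal Infty"
    using pp(3) by (induction S rule: infinite_finite_induct) auto
  then have "\<kappa> \<in> max_ideal Infty" by (simp add: \<kappa>_def)
  ultimately have inf: "\<kappa> \<in> canonical Infty" by (intro canonical_Infty_if_residue_0)
  show ?thesis
  proof
    fix q
    show "\<delta> q + (\<kappa> - \<delta> Infty) \<in> canonical q"
      using aff inf by (cases q) (simp_all add: \<epsilon>_def algebra_simps)
  qed
qed

section \<open>The cohomology of a sheaf isomorphic to the canonical sheaf\<close>

lemma infinite_P1: "infinite (UNIV :: P1 set)"
  using finite_imageD[of Aff UNIV] finite_subset[of "range Aff" UNIV] infinite_UNIV_char_0[where 'a = complex]
  by (auto simp: inj_def)

lemma topspace_zariski [simp]: "topspace zariski = UNIV"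
  using openin_subset[of zariski UNIV] by (auto simp: openin_zariski)

lemma zariski_Int_nonempty:
  assumes "openin zariski U" "openin zariski V" "U \<noteq> {}" "V \<noteq> {}"
  shows "U \<inter> V \<noteq> {}"
proof
  assume "U \<inter> V = {}"
  then have "UNIV = - U \<union> - V" by blast
  moreover have "finite (- U \<union> - V)" using assms by (auto simp: openin_zariski)
  ultimately show False using infinite_P1 by simp
qed

lemma pair_mult_simps [simp]: "fst (pair_mult r v) = r * fst v" "snd (pair_mult r v) = r * snd v"
  by (simp_all add: pair_mult_def)

lemma cohomologous_pair_iff:
  "((U, c), (U', c')) \<in> cohomologous X F \<longleftrightarrow>
     (U, c) \<in> cech_cocycles X F \<and> (U', c') \<in> cech_cocycles X F \<and>
     (\<exists>W h. (\<forall>x\<in>topspace X. openin X (W x) \<and> x \<in> W x \<and> W x \<subseteq> U x \<inter> U' x \<and> h x \<in> sec F (W x)) \<and>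
       (\<forall>x\<in>topspace X. \<forall>y\<in>topspace X. \<forall>w \<in> W x \<inter> W y.
          c x y w \<oplus>\<^bsub>stalk F w\<^esub> h y w = c' x y w \<oplus>\<^bsub>stalk F w\<^esub> h x w))"
  unfolding cohomologous_def by simp

text \<open>The quotient of \<open>B\<close> by \<open>A\<close> is isomorphic to the canonical sheaf by pairing with \<open>\<eta>\<^sub>0\<close>, and the
isomorphism is globally split by \<open>\<sigma>\<close>. The splitting gives every regular form one lift that is valid at
all points where the form is regular.\<close>

locale canonical_quotient =
  fixes A B :: "P1 \<Rightarrow> (K \<times> K) set" and \<eta>\<^sub>0 :: "K \<times> K" and \<sigma> :: "K \<Rightarrow> K \<times> K"
  assumes \<sigma>_add: "\<sigma> (h + h') = \<sigma> h + \<sigma> h'"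
    and \<sigma>_mult: "\<sigma> (r * h) = pair_mult r (\<sigma> h)"
    and splitting: "pairing \<eta>\<^sub>0 (\<sigma> h) = h"
    and B_add: "v \<in> B q \<Longrightarrow> w \<in> B q \<Longrightarrow> v + w \<in> B q"
    and B_mult: "r \<in> local_ring q \<Longrightarrow> v \<in> B q \<Longrightarrow> pair_mult r v \<in> B q"
    and pairing_B: "v \<in> B q \<Longrightarrow> pairing \<eta>\<^sub>0 v \<in> canonical q"
    and \<sigma>_B: "h \<in> canonical q \<Longrightarrow> \<sigma> h \<in> B q"
    and A_eq: "A q = {v \<in> B q. pairing \<eta>\<^sub>0 v = 0}"
begin

abbreviation \<phi> :: "K \<times> K \<Rightarrow> K" where
  "\<phi> \<equiv> pairing \<eta>\<^sub>0"

abbreviation F :: "(P1, (K \<times> K) set) sheaf" where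
  "F \<equiv> quot_sheaf zariski (\<lambda>c. pair_mult (kconst c)) B A"

text \<open>The residue class modulo \<open>A\<close> that corresponds to the form \<open>h\<close>.\<close>

definition coset :: "P1 \<Rightarrow> K \<Rightarrow> (K \<times> K) set" where
  "coset q h = {v \<in> B q. \<phi> v = h}"

lemma \<phi>_add: "\<phi> (v + w) = \<phi> v + \<phi> w"
  by (simp add: pairing_def algebra_simps)

lemma \<phi>_mult: "\<phi> (pair_mult r v) = r * \<phi> v"
  by (simp add: pairing_def algebra_simps)

lemma B_diff: "v \<in> B q \<Longrightarrow> w \<in> B q \<Longrightarrow> v - w \<in> B q"
  using B_add[of v q "pair_mult (- 1) w"] B_mult[of "- 1" q w]
  by (simp add: pair_mult_def minus_prod_def plus_prod_def)

lemma \<phi>_diff: "\<phi> (v - w) = \<phi> v - \<phi> w"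
  by (simp add: pairing_def algebra_simps)

lemma A_coset: "A q = coset q 0"
  by (simp add: A_eq coset_def)

lemma translate_A: "v \<in> B q \<Longrightarrow> (+) v ` A q = coset q (\<phi> v)"
proof (intro equalityI subsetI)
  fix x assume v: "v \<in> B q" and "x \<in> coset q (\<phi> v)"
  then have "x - v \<in> A q" by (simp add: A_eq coset_def B_diff \<phi>_diff)
  then show "x \<in> (+) v ` A q" by (auto intro: image_eqI[of _ _ "x - v"])
qed (auto simp: A_eq coset_def B_add \<phi>_add)

lemma coset_nonempty: "h \<in> canonical q \<Longrightarrow> \<sigma> h \<in> coset q h"
  by (simp add: coset_def \<sigma>_B splitting)

lemma coset_inj: "h \<in> canonical q \<Longrightarrow> coset q h = coset q h' \<Longrightarrow> h = h'"
  using coset_nonempty[of h q] by (auto simp: coset_def)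

lemma carrier_stalk: "carrier (stalk F q) = coset q ` canonical q"
proof -
  have "(\<lambda>v. (+) v ` A q) ` B q = (\<lambda>v. coset q (\<phi> v)) ` B q"
    by (intro image_cong) (simp_all add: translate_A)
  also have "\<dots> = coset q ` \<phi> ` B q"
    by (simp only: image_image)
  also have "\<phi> ` B q = canonical q"
  proof (intro equalityI subsetI)
    fix h assume "h \<in> canonical q"
    then show "h \<in> \<phi> ` B q" using \<sigma>_B splitting[of h] by (metis image_eqI)
  qed (use pairing_B in blast)
  finally show ?thesis by (simp add: quot_sheaf_def quot_mod_def)
qed

lemma zero_stalk: "\<zero>\<^bsub>stalk F q\<^esub> = coset q 0"
  by (simp add: quot_sheaf_def quot_mod_def A_coset)

lemma add_stalk:
  assumes "h \<in> canonical q" "h' \<in> canonical q"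
  shows "coset q h \<oplus>\<^bsub>stalk F q\<^esub> coset q h' = coset q (h + h')"
proof -
  have "v \<in> {x + y |x y. x \<in> coset q h \<and> y \<in> coset q h'}" if "v \<in> coset q (h + h')" for v
  proof -
    have "v - \<sigma> h' \<in> coset q h"
      using that coset_nonempty[OF assms(2)] by (simp add: coset_def B_diff \<phi>_diff)
    moreover have "v = (v - \<sigma> h') + \<sigma> h'" by simp
    ultimately show ?thesis using coset_nonempty[OF assms(2)] by blast
  qed
  moreover have "{x + y |x y. x \<in> coset q h \<and> y \<in> coset q h'} \<subseteq> coset q (h + h')"
  proof
    fix v assume "v \<in> {x + y |x y. x \<in> coset q h \<and> y \<in> coset q h'}"
    then obtain x y where "v = x + y" "x \<in> coset q h" "y \<in> coset q h'" by blast
    then show "v \<in> coset q (h + h')" by (simp add: coset_def B_add \<phi>_add)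
  qed
  ultimately show ?thesis by (auto simp: quot_sheaf_def quot_mod_def)
qed

lemma smult_stalk:
  assumes "h \<in> canonical q"
  shows "c \<odot>\<^bsub>stalk F q\<^esub> coset q h = coset q (kconst c * h)"
proof -
  have "v \<in> {pair_mult (kconst c) x + y |x y. x \<in> coset q h \<and> y \<in> A q}" if "v \<in> coset q (kconst c * h)" for v
  proof -
    have "v - pair_mult (kconst c) (\<sigma> h) \<in> A q"
      using that coset_nonempty[OF assms] by (simp add: coset_def A_eq B_diff \<phi>_diff B_mult \<phi>_mult)
    moreover have "v = pair_mult (kconst c) (\<sigma> h) + (v - pair_mult (kconst c) (\<sigma> h))" by simp
    ultimately show ?thesis using coset_nonempty[OF assms] by blast
  qed
  moreover have "{pair_mult (kconst c) x + y |x y. x \<in> coset q h \<and> y \<in> A q} \<subseteq> coset q (kconst c * h)"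
  proof
    fix v assume "v \<in> {pair_mult (kconst c) x + y |x y. x \<in> coset q h \<and> y \<in> A q}"
    then obtain x y where "v = pair_mult (kconst c) x + y" "x \<in> coset q h" "y \<in> A q" by blast
    then show "v \<in> coset q (kconst c * h)" by (simp add: coset_def A_eq B_add B_mult \<phi>_add \<phi>_mult)
  qed
  ultimately show ?thesis by (auto simp: quot_sheaf_def quot_mod_def)
qed

text \<open>The form that represents a section is locally constant, hence constant, because two
nonempty open sets meet.\<close>

lemma sec_eq:
  assumes U: "openin zariski U" "U \<noteq> {}"
  shows "sec F U = {\<lambda>q\<in>U. coset q h |h. \<forall>q\<in>U. h \<in> canonical q}"
proof (intro equalityI subsetI)
  fix s assume s: "s \<in> sec F U"
  have loc0: "\<forall>q\<in>U. \<exists>W v. openin zariski W \<and> q \<in> W \<and> W \<subseteq> U \<and> (\<forall>w\<in>W. v \<in> B w \<and> s w = (+) v ` A w)"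
    using s by (simp add: quot_sheaf_def)
  have loc: "\<exists>W h. openin zariski W \<and> q \<in> W \<and> (\<forall>w\<in>W. h \<in> canonical w \<and> s w = coset w h)" if "q \<in> U" for q
  proof -
    obtain W v where "openin zariski W" "q \<in> W" "\<forall>w\<in>W. v \<in> B w \<and> s w = (+) v ` A w"
      using loc0[rule_format, OF \<open>q \<in> U\<close>] by (elim exE conjE)
    then show ?thesis
      by (intro exI[of _ W] exI[of _ "\<phi> v"]) (simp add: translate_A pairing_B)
  qed
  obtain q\<^sub>0 where q\<^sub>0: "q\<^sub>0 \<in> U" using U by blast
  obtain W\<^sub>0 h where "openin zariski W\<^sub>0" "q\<^sub>0 \<in> W\<^sub>0" "\<forall>w\<in>W\<^sub>0. h \<in> canonical w \<and> s w = coset w h"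
    using loc[OF q\<^sub>0] by (elim exE conjE)
  then have h: "openin zariski W\<^sub>0" "q\<^sub>0 \<in> W\<^sub>0" "\<And>w. w \<in> W\<^sub>0 \<Longrightarrow> s w = coset w h"
    by simp_all
  have "h \<in> canonical q \<and> s q = coset q h" if "q \<in> U" for q
  proof -
    obtain W h' where "openin zariski W" "q \<in> W" "\<forall>w\<in>W. h' \<in> canonical w \<and> s w = coset w h'"
      using loc[OF \<open>q \<in> U\<close>] by (elim exE conjE)
    then have h': "openin zariski W" "q \<in> W" "\<And>w. w \<in> W \<Longrightarrow> h' \<in> canonical w \<and> s w = coset w h'"
      by simp_all
    then have "W \<inter> W\<^sub>0 \<noteq> {}" using h by (intro zariski_Int_nonempty) auto
    then obtain w where w: "w \<in> W" "w \<in> W\<^sub>0" by blast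
    have "h' = h" using h'(3)[OF w(1)] h(3)[OF w(2)] coset_inj[of h' w h] by simp
    then show ?thesis using h'(3)[OF h'(2)] by simp
  qed
  note h_eq = this
  have "s \<in> extensional U"
    using s by (simp add: quot_sheaf_def PiE_def)
  then have "s = (\<lambda>q\<in>U. coset q h)"
    by (rule extensionalityI) (simp_all add: h_eq)
  moreover have "\<forall>q\<in>U. h \<in> canonical q"
    using h_eq by blast
  ultimately show "s \<in> {\<lambda>q\<in>U. coset q h |h. \<forall>q\<in>U. h \<in> canonical q}" by blast
next
  fix s assume "s \<in> {\<lambda>q\<in>U. coset q h |h. \<forall>q\<in>U. h \<in> canonical q}"
  then obtain h where s: "s = (\<lambda>q\<in>U. coset q h)" "\<forall>q\<in>U. h \<in> canonical q" by blast
  have "s q \<in> carrier (stalk F q)" if "q \<in> U" for q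
    using that s by (simp add: carrier_stalk)
  then have "s \<in> (\<Pi>\<^sub>E q\<in>U. carrier (quot_mod (\<lambda>c. pair_mult (kconst c)) (B q) (A q)))"
    using s by (auto simp: PiE_def quot_sheaf_def)
  moreover have "\<forall>w\<in>U. \<sigma> h \<in> B w \<and> s w = (+) (\<sigma> h) ` A w"
    using s by (simp add: \<sigma>_B translate_A splitting)
  ultimately show "s \<in> sec F U"
    unfolding quot_sheaf_def sheaf.select_convs mem_Collect_eq
    by (intro conjI ballI exI[of _ U] exI[of _ "\<sigma> h"]) (simp_all add: U)
qed

text \<open>A cocycle over a cover by nonempty open sets is, by irreducibility of the line, a family of
  rational forms, and hence the coboundary of its values at a base point.\<close>

definition cochain :: "(P1 \<Rightarrow> P1 set) \<Rightarrow> (P1 \<Rightarrow> K) \<Rightarrow> bool" where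
  "cochain U \<gamma> \<longleftrightarrow> (\<forall>x. openin zariski (U x) \<and> x \<in> U x) \<and> \<gamma> Infty = 0 \<and>
     (\<forall>x y. \<forall>w\<in>U x \<inter> U y. \<gamma> x - \<gamma> y \<in> canonical w)"

definition cocycle :: "(P1 \<Rightarrow> P1 set) \<Rightarrow> (P1 \<Rightarrow> K) \<Rightarrow> (P1 \<Rightarrow> P1 set) \<times> (P1 \<Rightarrow> P1 \<Rightarrow> P1 \<Rightarrow> (K \<times> K) set)" where
  "cocycle U \<gamma> = (U, \<lambda>x y. \<lambda>w\<in>U x \<inter> U y. coset w (\<gamma> x - \<gamma> y))"

definition total_residue :: "(P1 \<Rightarrow> K) \<Rightarrow> complex" where
  "total_residue \<gamma> = Sum_any (\<lambda>x. form_residue x (\<gamma> x))"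

lemma cochainD:
  assumes "cochain U \<gamma>"
  shows "openin zariski (U x)" "x \<in> U x" "\<gamma> Infty = 0"
    "w \<in> U x \<Longrightarrow> w \<in> U y \<Longrightarrow> \<gamma> x - \<gamma> y \<in> canonical w"
  using assms by (auto simp: cochain_def)

lemma cover_Int:
  assumes "\<And>x. openin zariski (U x) \<and> x \<in> U x"
  shows "openin zariski (U x \<inter> U y)" "U x \<inter> U y \<noteq> {}"
  using assms zariski_Int_nonempty[of "U x" "U y"] by (blast intro: openin_Int)+

lemma cech_cocycles_eq: "cech_cocycles zariski F = {cocycle U \<gamma> |U \<gamma>. cochain U \<gamma>}"
proof (intro equalityI subsetI)
  fix p assume p: "p \<in> cech_cocycles zariski F"
  then obtain U c where p_eq: "p = (U, c)" and U: "\<And>x. openin zariski (U x) \<and> x \<in> U x"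
    and c: "\<And>x y. c x y \<in> sec F (U x \<inter> U y)"
    and cc: "\<And>x y z w. w \<in> U x \<inter> U y \<inter> U z \<Longrightarrow> c x z w = c x y w \<oplus>\<^bsub>stalk F w\<^esub> c y z w"
    unfolding cech_cocycles_def by auto
  have "\<exists>h. (\<forall>w\<in>U x \<inter> U y. h \<in> canonical w) \<and> c x y = (\<lambda>w\<in>U x \<inter> U y. coset w h)" for x y
    using c[of x y] unfolding sec_eq[OF cover_Int[of U, OF U]] by blast
  then obtain g where g: "\<And>x y w. w \<in> U x \<inter> U y \<Longrightarrow> g x y \<in> canonical w"
    "\<And>x y. c x y = (\<lambda>w\<in>U x \<inter> U y. coset w (g x y))"
    by metis
  have add: "g x z = g x y + g y z" for x y z
  proof -
    have "(U x \<inter> U y) \<inter> U z \<noteq> {}"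
      using U by (intro zariski_Int_nonempty cover_Int[of U]) auto
    then obtain w where w: "w \<in> U x" "w \<in> U y" "w \<in> U z" by blast
    then have "coset w (g x z) = coset w (g x y + g y z)"
      using cc[of w x y z] g(1)[of w] by (simp add: g(2) add_stalk)
    then show ?thesis using w g(1)[of w] by (intro coset_inj) auto
  qed
  have "g Infty Infty + 0 = g Infty Infty + g Infty Infty" using add[of Infty Infty Infty] by simp
  then have "g Infty Infty = 0" by (metis add_left_cancel)
  moreover have e: "g x y = g x Infty - g y Infty" for x y using add[of x Infty y] by simp
  ultimately have "cochain U (\<lambda>x. g x Infty)"
    unfolding cochain_def e[symmetric] using U g(1) by blast
  moreover have "p = cocycle U (\<lambda>x. g x Infty)"
  proof -
    have "c x y = (\<lambda>w\<in>U x \<inter> U y. coset w (g x Infty - g y Infty))" for x y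
      using g(2)[of x y] unfolding e[of x y] .
    then have "c = (\<lambda>x y. \<lambda>w\<in>U x \<inter> U y. coset w (g x Infty - g y Infty))" by (rule ext[OF ext])
    then show ?thesis by (simp only: p_eq cocycle_def)
  qed
  ultimately show "p \<in> {cocycle U \<gamma> |U \<gamma>. cochain U \<gamma>}" by blast
next
  fix p assume "p \<in> {cocycle U \<gamma> |U \<gamma>. cochain U \<gamma>}"
  then obtain U \<gamma> where p: "p = cocycle U \<gamma>" and \<gamma>: "cochain U \<gamma>" by blast
  have U: "\<And>x. openin zariski (U x) \<and> x \<in> U x" using cochainD[OF \<gamma>] by blast
  have "(\<lambda>w\<in>U x \<inter> U y. coset w (\<gamma> x - \<gamma> y)) \<in> sec F (U x \<inter> U y)" for x y
    unfolding sec_eq[OF cover_Int[of U, OF U]] using cochainD(4)[OF \<gamma>] by blast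
  moreover have "coset w (\<gamma> x - \<gamma> z) = coset w (\<gamma> x - \<gamma> y) \<oplus>\<^bsub>stalk F w\<^esub> coset w (\<gamma> y - \<gamma> z)"
    if "w \<in> U x" "w \<in> U y" "w \<in> U z" for x y z w
    using that cochainD(4)[OF \<gamma>] by (simp add: add_stalk)
  ultimately show "p \<in> cech_cocycles zariski F"
    unfolding cech_cocycles_def p cocycle_def using U by auto
qed

lemma finite_cochain:
  assumes "cochain U \<gamma>"
  shows "finite {x. \<gamma> x \<notin> canonical x}"
proof (rule finite_subset)
  show "{x. \<gamma> x \<notin> canonical x} \<subseteq> - U Infty"
    using cochainD(4)[OF assms, of x x Infty for x] cochainD(2,3)[OF assms] by auto
  show "finite (- U Infty)"
    using cochainD(1,2)[OF assms, of Infty] by (auto simp: openin_zariski)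
qed

text \<open>A coboundary changes the forms \<open>\<gamma> x\<close> by a form regular at \<open>x\<close> and by one rational form common to all
points, and neither contributes to the total residue. Conversely, if the total residues agree, the
required common form is a solution of the Mittag-Leffler problem for the difference.\<close>

lemma cohomologous_iff:
  assumes \<gamma>: "cochain U \<gamma>" and \<gamma>': "cochain U' \<gamma>'"
  shows "(cocycle U \<gamma>, cocycle U' \<gamma>') \<in> cohomologous zariski F \<longleftrightarrow> total_residue \<gamma> = total_residue \<gamma>'"
proof
  assume "(cocycle U \<gamma>, cocycle U' \<gamma>') \<in> cohomologous zariski F"
  then obtain W h where
    W0: "\<forall>x. openin zariski (W x) \<and> x \<in> W x \<and> W x \<subseteq> U x \<inter> U' x \<and> h x \<in> sec F (W x)"
    and eq0: "\<forall>x y. \<forall>w\<in>W x \<inter> W y.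
      snd (cocycle U \<gamma>) x y w \<oplus>\<^bsub>stalk F w\<^esub> h y w = snd (cocycle U' \<gamma>') x y w \<oplus>\<^bsub>stalk F w\<^esub> h x w"
    unfolding cocycle_def cohomologous_pair_iff topspace_zariski ball_UNIV snd_conv
    by (elim conjE exE)
  have W: "openin zariski (W x) \<and> x \<in> W x" and sub: "W x \<subseteq> U x \<inter> U' x" and h: "h x \<in> sec F (W x)" for x
    using W0[rule_format, of x] by simp_all
  note eq = eq0[rule_format]
  have "\<exists>k. (\<forall>w\<in>W x. k \<in> canonical w) \<and> h x = (\<lambda>w\<in>W x. coset w k)" for x
  proof -
    have "W x \<noteq> {}" "openin zariski (W x)" using W by auto
    then show ?thesis using h[of x] by (simp add: sec_eq) blast
  qed
  then obtain k where k: "\<And>x w. w \<in> W x \<Longrightarrow> k x \<in> canonical w" "\<And>x. h x = (\<lambda>w\<in>W x. coset w (k x))"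
    by metis
  have \<gamma>_eq: "\<gamma> x = \<gamma>' x + (k x + - k Infty)" for x
  proof -
    obtain w where w: "w \<in> W x" "w \<in> W Infty" using cover_Int(2)[of W, OF W] by blast
    then have U: "w \<in> U x" "w \<in> U Infty" "w \<in> U' x" "w \<in> U' Infty" using sub by auto
    have "coset w (\<gamma> x - \<gamma> Infty + k Infty) = coset w (\<gamma>' x - \<gamma>' Infty + k x)"
      using eq[of w x Infty] w U cochainD(4)[OF \<gamma>, of w x Infty] cochainD(4)[OF \<gamma>', of w x Infty] k(1)[of w]
      by (simp add: cocycle_def k(2) add_stalk)
    then have "\<gamma> x - \<gamma> Infty + k Infty = \<gamma>' x - \<gamma>' Infty + k x"
      using w U cochainD(4)[OF \<gamma>, of w x Infty] k(1)[of w] by (intro coset_inj[of _ w]) auto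
    then show ?thesis using cochainD(3)[OF \<gamma>] cochainD(3)[OF \<gamma>'] by (simp add: algebra_simps)
  qed
  have "form_residue x (\<gamma> x) = form_residue x (\<gamma>' x + - k Infty)" for x
    using k(1)[of x x] W[of x] by (intro form_residue_congruent) (simp add: \<gamma>_eq)
  then show "total_residue \<gamma> = total_residue \<gamma>'"
    unfolding total_residue_def
    using residue_sum_add[OF finite_cochain[OF \<gamma>'] finite_noncanonical[of "- k Infty"]]
    by (simp add: residue_theorem)
next
  assume *: "total_residue \<gamma> = total_residue \<gamma>'"
  have neg: "Sum_any (\<lambda>x. form_residue x (- \<gamma>' x)) = - total_residue \<gamma>'"
    unfolding total_residue_def form_residue_uminus Sum_any.expand_set by (simp add: sum_negf)
  have fin': "finite {x. - \<gamma>' x \<notin> canonical x}"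
    by (rule finite_subset[OF _ finite_cochain[OF \<gamma>']]) auto
  have "finite {x. \<gamma> x + - \<gamma>' x \<notin> canonical x}"
    by (rule finite_subset[OF _ finite_UnI[OF finite_cochain[OF \<gamma>] fin']])
      (use canonical_add[of "\<gamma> x" x "- \<gamma>' x" for x] in \<open>auto simp only:\<close>)
  moreover have "Sum_any (\<lambda>x. form_residue x (\<gamma> x + - \<gamma>' x)) = 0"
    using * neg unfolding residue_sum_add[OF finite_cochain[OF \<gamma>] fin'] by (simp add: total_residue_def)
  ultimately obtain \<kappa> where \<kappa>: "\<And>x. \<gamma> x + - \<gamma>' x + \<kappa> \<in> canonical x"
    using principal_parts[of "\<lambda>x. \<gamma> x + - \<gamma>' x"] by blast
  define k where "k x = \<gamma> x + - \<gamma>' x + \<kappa>" for x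
  define W where "W x = U x \<inter> U' x \<inter> {w. k x \<in> canonical w}" for x
  have op: "openin zariski {w. k x \<in> canonical w}" for x
    using finite_noncanonical[of "k x"] by (simp add: openin_zariski Collect_neg_eq[symmetric])
  have W: "openin zariski (W x) \<and> x \<in> W x" for x
    unfolding W_def using cochainD(1,2)[OF \<gamma>] cochainD(1,2)[OF \<gamma>'] op \<kappa> by (auto simp: k_def intro!: openin_Int)
  have "(\<lambda>w\<in>W x. coset w (k x)) \<in> sec F (W x)" for x
  proof -
    have "W x \<noteq> {}" "openin zariski (W x)" using W by auto
    then show ?thesis by (auto simp: sec_eq W_def)
  qed
  moreover have "coset w (\<gamma> x - \<gamma> y) \<oplus>\<^bsub>stalk F w\<^esub> coset w (k y) = coset w (\<gamma>' x - \<gamma>' y) \<oplus>\<^bsub>stalk F w\<^esub> coset w (k x)"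
    if "w \<in> W x" "w \<in> W y" for w x y
  proof -
    have "\<gamma> x - \<gamma> y \<in> canonical w" "\<gamma>' x - \<gamma>' y \<in> canonical w" "k x \<in> canonical w" "k y \<in> canonical w"
      using that cochainD(4)[OF \<gamma>] cochainD(4)[OF \<gamma>'] by (auto simp: W_def)
    then show ?thesis by (simp add: add_stalk) (simp add: k_def algebra_simps)
  qed
  ultimately have "\<exists>W h. (\<forall>x\<in>topspace zariski. openin zariski (W x) \<and> x \<in> W x \<and> W x \<subseteq> U x \<inter> U' x \<and> h x \<in> sec F (W x)) \<and>
       (\<forall>x\<in>topspace zariski. \<forall>y\<in>topspace zariski. \<forall>w \<in> W x \<inter> W y.
          snd (cocycle U \<gamma>) x y w \<oplus>\<^bsub>stalk F w\<^esub> h y w = snd (cocycle U' \<gamma>') x y w \<oplus>\<^bsub>stalk F w\<^esub> h x w)"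
    using W by (intro exI[of _ W] exI[of _ "\<lambda>x. \<lambda>w\<in>W x. coset w (k x)"]) (auto simp: cocycle_def W_def)
  moreover have "cocycle U \<gamma> \<in> cech_cocycles zariski F" "cocycle U' \<gamma>' \<in> cech_cocycles zariski F"
    using \<gamma> \<gamma>' by (auto simp: cech_cocycles_eq)
  ultimately show "(cocycle U \<gamma>, cocycle U' \<gamma>') \<in> cohomologous zariski F"
    unfolding cocycle_def cohomologous_pair_iff snd_conv by (intro conjI)
qed

definition residue_class :: "complex \<Rightarrow> ((P1 \<Rightarrow> P1 set) \<times> (P1 \<Rightarrow> P1 \<Rightarrow> P1 \<Rightarrow> (K \<times> K) set)) set" where
  "residue_class t = {cocycle U \<gamma> |U \<gamma>. cochain U \<gamma> \<and> total_residue \<gamma> = t}"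

lemma cohomologous_Image:
  assumes S: "S \<subseteq> residue_class t" "S \<noteq> {}"
  shows "cohomologous zariski F `` S = residue_class t"
proof -
  have "cohomologous zariski F `` {p} = residue_class t" if "p \<in> residue_class t" for p
  proof -
    obtain U \<gamma> where p: "p = cocycle U \<gamma>" and \<gamma>: "cochain U \<gamma>" "total_residue \<gamma> = t"
      using \<open>p \<in> residue_class t\<close> unfolding residue_class_def by blast
    have "p' \<in> residue_class t \<longleftrightarrow> (p, p') \<in> cohomologous zariski F" for p'
    proof
      assume "p' \<in> residue_class t"
      then show "(p, p') \<in> cohomologous zariski F"
        using \<gamma> by (auto simp: p residue_class_def cohomologous_iff)
    next
      assume *: "(p, p') \<in> cohomologous zariski F"
      then have "p' \<in> cech_cocycles zariski F" by (auto simp: cohomologous_def)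
      then obtain U' \<gamma>' where "p' = cocycle U' \<gamma>'" "cochain U' \<gamma>'" by (auto simp: cech_cocycles_eq)
      then show "p' \<in> residue_class t"
        using * \<gamma> by (auto simp: p residue_class_def cohomologous_iff)
    qed
    then show ?thesis by blast
  qed
  then have "(\<Union>p\<in>S. cohomologous zariski F `` {p}) = residue_class t" using S by blast
  then show ?thesis by blast
qed

text \<open>The class with a given total residue is represented by a form with a simple pole at \<open>0\<close>.\<close>

lemma residue_class_nonempty: "residue_class t \<noteq> {}"
proof -
  define U where "U = (\<lambda>x. if x = Aff 0 then - {Infty} else - {Aff 0})"
  define \<gamma> where "\<gamma> = (\<lambda>x. if x = Aff 0 then kconst t * simple_fraction 0 (Suc 0) else 0)"
  have "kconst t * simple_fraction 0 (Suc 0) \<in> canonical w" if "w \<noteq> Aff 0" "w \<noteq> Infty" for w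
  proof (cases w)
    case (Aff b)
    then show ?thesis
      using that simple_fraction_in_local_ring[of b 0 "Suc 0"]
      by (intro canonical_const) (simp add: canonical_Aff del: local_ring.simps)
  qed (use that in simp)
  then have "cochain U \<gamma>"
    by (auto simp: cochain_def U_def \<gamma>_def openin_zariski dest: canonical_uminus simp del: power_Suc)
  moreover have "total_residue \<gamma> = t"
  proof -
    have "total_residue \<gamma> = (\<Sum>x\<in>{Aff 0}. form_residue x (\<gamma> x))"
      unfolding total_residue_def
      by (rule Sum_any.expand_superset) (auto simp: \<gamma>_def simp del: form_residue.simps)
    also have "\<dots> = t * form_residue (Aff 0) (simple_fraction 0 (Suc 0))"
    proof -
      have "\<gamma> (Aff 0) = kconst t * simple_fraction 0 (Suc 0)" by (simp only: \<gamma>_def simp_thms if_True)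
      then show ?thesis by (simp add: form_residue_kconst_mult del: form_residue.simps power_Suc)
    qed
    also have "\<dots> = t"
      unfolding form_residue_simple_fraction by simp
    finally show ?thesis .
  qed
  ultimately show ?thesis unfolding residue_class_def by blast
qed

lemma residue_class_inj: "residue_class s = residue_class t \<Longrightarrow> s = t"
proof -
  assume "residue_class s = residue_class t"
  with residue_class_nonempty obtain p where p: "p \<in> residue_class s" "p \<in> residue_class t" by blast
  then obtain U \<gamma> U' \<gamma>' where *: "p = cocycle U \<gamma>" "cochain U \<gamma>" "total_residue \<gamma> = s"
    "p = cocycle U' \<gamma>'" "cochain U' \<gamma>'" "total_residue \<gamma>' = t"
    unfolding residue_class_def by blast
  have "p \<in> cohomologous zariski F `` {p}"
    using p by (simp add: cohomologous_Image[of "{p}" s])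
  then show "s = t" using * cohomologous_iff[of U \<gamma> U' \<gamma>'] by simp
qed

lemma residue_class_add:
  assumes "p \<in> residue_class s" "p' \<in> residue_class t"
  shows "(\<lambda>x. fst p x \<inter> fst p' x, \<lambda>x y. \<lambda>w \<in> fst p x \<inter> fst p' x \<inter> (fst p y \<inter> fst p' y).
    snd p x y w \<oplus>\<^bsub>stalk F w\<^esub> snd p' x y w) \<in> residue_class (s + t)"
proof -
  obtain U \<gamma> where p: "p = cocycle U \<gamma>" and \<gamma>: "cochain U \<gamma>" "total_residue \<gamma> = s"
    using assms(1) unfolding residue_class_def by blast
  obtain U' \<gamma>' where p': "p' = cocycle U' \<gamma>'" and \<gamma>': "cochain U' \<gamma>'" "total_residue \<gamma>' = t"
    using assms(2) unfolding residue_class_def by blast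
  let ?U = "\<lambda>x. U x \<inter> U' x" and ?\<gamma> = "\<lambda>x. \<gamma> x + \<gamma>' x"
  have "cochain ?U ?\<gamma>"
    unfolding cochain_def
    using cochainD[OF \<gamma>(1)] cochainD[OF \<gamma>'(1)] canonical_add[of "\<gamma> x - \<gamma> y" w "\<gamma>' x - \<gamma>' y" for x y w]
    by (auto simp: add_diff_add)
  moreover have "total_residue ?\<gamma> = s + t"
    using residue_sum_add[OF finite_cochain[OF \<gamma>(1)] finite_cochain[OF \<gamma>'(1)]] \<gamma>(2) \<gamma>'(2)
    by (simp add: total_residue_def)
  moreover have "coset w (\<gamma> x - \<gamma> y) \<oplus>\<^bsub>stalk F w\<^esub> coset w (\<gamma>' x - \<gamma>' y) = coset w (?\<gamma> x - ?\<gamma> y)"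
    if "w \<in> ?U x" "w \<in> ?U y" for x y w
    using that cochainD(4)[OF \<gamma>(1)] cochainD(4)[OF \<gamma>'(1)] by (simp add: add_stalk add_diff_add)
  then have "(\<lambda>x. fst p x \<inter> fst p' x, \<lambda>x y. \<lambda>w \<in> fst p x \<inter> fst p' x \<inter> (fst p y \<inter> fst p' y).
    snd p x y w \<oplus>\<^bsub>stalk F w\<^esub> snd p' x y w) = cocycle ?U ?\<gamma>"
    by (auto simp: cocycle_def p p' fun_eq_iff)
  ultimately show ?thesis unfolding residue_class_def by blast
qed

lemma residue_class_smult:
  assumes "p \<in> residue_class t"
  shows "(fst p, \<lambda>x y. \<lambda>w \<in> fst p x \<inter> fst p y. c \<odot>\<^bsub>stalk F w\<^esub> snd p x y w) \<in> residue_class (c * t)"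
proof -
  obtain U \<gamma> where p: "p = cocycle U \<gamma>" and \<gamma>: "cochain U \<gamma>" "total_residue \<gamma> = t"
    using assms unfolding residue_class_def by blast
  let ?\<gamma> = "\<lambda>x. kconst c * \<gamma> x"
  have "cochain U ?\<gamma>"
    unfolding cochain_def using cochainD[OF \<gamma>(1)] canonical_const[of "\<gamma> x - \<gamma> y" w c for x y w]
    by (auto simp: right_diff_distrib)
  moreover have "total_residue ?\<gamma> = c * t"
    unfolding total_residue_def form_residue_kconst_mult \<gamma>(2)[symmetric]
    by (cases "c = 0") (simp_all add: Sum_any.expand_set sum_distrib_left)
  moreover have "(fst p, \<lambda>x y. \<lambda>w \<in> fst p x \<inter> fst p y. c \<odot>\<^bsub>stalk F w\<^esub> snd p x y w) = cocycle U ?\<gamma>"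
    using cochainD(4)[OF \<gamma>(1)] by (auto simp: cocycle_def p fun_eq_iff smult_stalk right_diff_distrib)
  ultimately show ?thesis unfolding residue_class_def by blast
qed

theorem line_coord_H1: "line_coord (H1 zariski F) residue_class"
  unfolding line_coord_def
proof (intro conjI allI)
  have cls: "p \<in> cech_cocycles zariski F \<longleftrightarrow> (\<exists>t. p \<in> residue_class t)" for p
    unfolding cech_cocycles_eq residue_class_def by blast
  have "X \<in> carrier (H1 zariski F) \<longleftrightarrow> X \<in> range residue_class" for X
  proof
    assume "X \<in> carrier (H1 zariski F)"
    then obtain p where p: "p \<in> cech_cocycles zariski F" "X = cohomologous zariski F `` {p}"
      by (auto simp: H1_def elim: quotientE)
    then obtain t where "p \<in> residue_class t" using cls by blast
    then show "X \<in> range residue_class" using cohomologous_Image[of "{p}" t] p by simp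
  next
    assume "X \<in> range residue_class"
    then obtain t where t: "X = residue_class t" by blast
    obtain p where p: "p \<in> residue_class t" using residue_class_nonempty by blast
    then have "X = cohomologous zariski F `` {p}" using cohomologous_Image[of "{p}" t] t by simp
    moreover have "p \<in> cech_cocycles zariski F" using cls p by blast
    ultimately show "X \<in> carrier (H1 zariski F)" by (simp add: H1_def quotientI)
  qed
  then have "carrier (H1 zariski F) = range residue_class" by blast
  then show "bij_betw residue_class UNIV (carrier (H1 zariski F))"
    by (auto simp: bij_betw_def inj_def residue_class_inj)
  have "(\<lambda>x. UNIV, \<lambda>x y. \<lambda>w\<in>UNIV. \<zero>\<^bsub>stalk F w\<^esub>) = cocycle (\<lambda>x. UNIV) (\<lambda>x. 0)"
    by (simp add: cocycle_def zero_stalk)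
  moreover have "cochain (\<lambda>x. UNIV) (\<lambda>x. 0)"
    by (simp add: cochain_def openin_zariski)
  ultimately have "(\<lambda>x. UNIV, \<lambda>x y. \<lambda>w\<in>UNIV. \<zero>\<^bsub>stalk F w\<^esub>) \<in> residue_class 0"
    unfolding residue_class_def mem_Collect_eq
    by (intro exI[of _ "\<lambda>x. UNIV"] exI[of _ "\<lambda>x. 0"]) (simp add: total_residue_def del: form_residue.simps)
  then show "\<zero>\<^bsub>H1 zariski F\<^esub> = residue_class 0"
    unfolding H1_def by (simp add: cohomologous_Image)
next
  fix s t
  let ?S = "{(\<lambda>x. U x \<inter> U' x,
          \<lambda>x y. \<lambda>w \<in> U x \<inter> U' x \<inter> (U y \<inter> U' y). c x y w \<oplus>\<^bsub>stalk F w\<^esub> c' x y w)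
         |U c U' c'. (U, c) \<in> residue_class s \<and> (U', c') \<in> residue_class t}"
  have "?S \<subseteq> residue_class (s + t)"
    using residue_class_add by fastforce
  moreover have "?S \<noteq> {}"
  proof -
    obtain U c U' c' where "(U, c) \<in> residue_class s" "(U', c') \<in> residue_class t"
      using residue_class_nonempty by (metis all_not_in_conv surj_pair)
    then show ?thesis by blast
  qed
  ultimately have "cohomologous zariski F `` ?S = residue_class (s + t)"
    by (rule cohomologous_Image)
  then show "residue_class s \<oplus>\<^bsub>H1 zariski F\<^esub> residue_class t = residue_class (s + t)"
    by (simp add: H1_def)
next
  fix a t
  let ?S = "{(U, \<lambda>x y. \<lambda>w \<in> U x \<inter> U y. a \<odot>\<^bsub>stalk F w\<^esub> c x y w) |U c. (U, c) \<in> residue_class t}"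
  have "?S \<subseteq> residue_class (a * t)"
    using residue_class_smult by fastforce
  moreover have "?S \<noteq> {}"
  proof -
    obtain U c where "(U, c) \<in> residue_class t"
      using residue_class_nonempty by (metis all_not_in_conv surj_pair)
    then show ?thesis by blast
  qed
  ultimately have "cohomologous zariski F `` ?S = residue_class (a * t)"
    by (rule cohomologous_Image)
  then show "a \<odot>\<^bsub>H1 zariski F\<^esub> residue_class t = residue_class (a * t)"
    by (simp add: H1_def)
qed

lemma contract_coset:
  assumes "h \<in> canonical q"
  shows "contract (pair_mult r \<eta>\<^sub>0) (coset q h) = r * h"
proof -
  have "pairing (pair_mult r \<eta>\<^sub>0) v = r * \<phi> v" for v
    by (simp add: pairing_def algebra_simps)
  then have "pairing (pair_mult r \<eta>\<^sub>0) ` coset q h = {r * h}"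
    using coset_nonempty[OF assms] by (auto simp: coset_def image_iff)
  then show ?thesis by (simp add: contract_def)
qed

text \<open>Contraction with \<open>c \<eta>\<^sub>0\<close> turns the component of a cocycle for \<open>x\<close> and the base point into \<open>c \<gamma> x\<close>.\<close>

lemma serre_trace_residue_class:
  assumes "p \<in> residue_class t"
  shows "serre_trace (pair_mult (kconst c) \<eta>\<^sub>0) p = c * t"
proof -
  obtain U \<gamma> where p: "p = cocycle U \<gamma>" and \<gamma>: "cochain U \<gamma>" "total_residue \<gamma> = t"
    using assms unfolding residue_class_def by blast
  have "contract (pair_mult (kconst c) \<eta>\<^sub>0) (snd p x Infty (SOME w. w \<in> U x \<inter> U Infty)) = kconst c * \<gamma> x" for x
  proof -
    define w where "w = (SOME w. w \<in> U x \<inter> U Infty)"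
    have "\<exists>w. w \<in> U x \<inter> U Infty"
      using cover_Int(2)[of U x Infty] cochainD(1,2)[OF \<gamma>(1)] by blast
    then have "w \<in> U x \<inter> U Infty" unfolding w_def by (rule someI_ex)
    then show ?thesis
      unfolding w_def[symmetric] using cochainD(3)[OF \<gamma>(1)] cochainD(4)[OF \<gamma>(1), of w x Infty]
      by (simp add: p cocycle_def contract_coset)
  qed
  then have "serre_trace (pair_mult (kconst c) \<eta>\<^sub>0) p = Sum_any (\<lambda>x. form_residue x (kconst c * \<gamma> x))"
    by (simp add: serre_trace_def p cocycle_def Sum_any.expand_set)
  also have "\<dots> = c * t"
    unfolding form_residue_kconst_mult \<gamma>(2)[symmetric] total_residue_def
    by (cases "c = 0") (simp_all add: Sum_any.expand_set sum_distrib_left)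
  finally show ?thesis .
qed

lemma serre_map_eq:
  "serre_map F (pair_mult (kconst c) \<eta>\<^sub>0) =
    (\<lambda>\<xi>\<in>carrier (H1 zariski F). c * inv_into UNIV residue_class \<xi>)"
  unfolding serre_map_def
proof (rule restrict_ext)
  fix \<xi> assume "\<xi> \<in> carrier (H1 zariski F)"
  then obtain t where \<xi>: "\<xi> = residue_class t" using line_coord_carrier[OF line_coord_H1] by auto
  have "(SOME p. p \<in> \<xi>) \<in> \<xi>"
    using residue_class_nonempty by (simp add: \<xi> some_in_eq)
  then show "serre_trace (pair_mult (kconst c) \<eta>\<^sub>0) (SOME p. p \<in> \<xi>) = c * inv_into UNIV residue_class \<xi>"
    using serre_trace_residue_class by (simp add: \<xi> inv_f_f inj_def residue_class_inj)
qed

end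

section \<open>The singular points on the central fibre\<close>

lemma proj_eqE:
  assumes "proj v = proj w" "w \<noteq> 0"
  obtains c where "c \<noteq> 0" "w = c *s v"
proof -
  have "1 *s w \<in> proj w" unfolding proj_def by blast
  then have "w \<in> proj v" using assms by (simp add: vector_space_over_itself.scale_one)
  then obtain c where c: "w = c *s v" by (auto simp: proj_def)
  then have "c \<noteq> 0" using assms by auto
  then show ?thesis using that c by blast
qed

lemma proj_scale:
  assumes "c \<noteq> 0"
  shows "proj (c *s v) = proj v"
proof (intro equalityI subsetI)
  fix x assume "x \<in> proj v"
  then obtain d where "x = d *s v" by (auto simp: proj_def)
  then have "x = (d / c) *s (c *s v)" using assms by (simp add: vector_smult_assoc)
  then show "x \<in> proj (c *s v)" unfolding proj_def by blast
next
  fix x assume "x \<in> proj (c *s v)"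
  then obtain d where "x = d *s (c *s v)" by (auto simp: proj_def)
  then have "x = (d * c) *s v" by (simp add: vector_smult_assoc)
  then show "x \<in> proj v" unfolding proj_def by blast
qed

lemma proj_in_comp_plane:
  fixes v :: "complex ^ 4"
  shows "v \<noteq> 0 \<Longrightarrow> proj v \<in> comp_plane i \<longleftrightarrow> v $ i = 0"
  by (auto simp: comp_plane_def elim!: proj_eqE)

lemma quartic_scale: "quartic f (c *s v) = c ^ 4 * quartic f v"
proof -
  have "f \<mu> * (\<Prod>i\<in>UNIV. ((c *s v) $ i) ^ \<mu> i) = c ^ 4 * (f \<mu> * (\<Prod>i\<in>UNIV. (v $ i) ^ \<mu> i))"
    if "sum \<mu> UNIV = 4" for \<mu> :: "4 \<Rightarrow> nat"
  proof -
    have "(\<Prod>i\<in>UNIV. ((c *s v) $ i) ^ \<mu> i) = c ^ sum \<mu> UNIV * (\<Prod>i\<in>UNIV. (v $ i) ^ \<mu> i)"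
      by (simp add: power_mult_distrib prod.distrib power_sum)
    then show ?thesis using that by simp
  qed
  then show ?thesis
    unfolding quartic_def sum_distrib_left by (intro sum.cong) auto
qed

lemma finite_exponents: "finite {\<mu> :: 4 \<Rightarrow> nat. sum \<mu> UNIV = 4}"
proof (rule finite_subset)
  show "{\<mu> :: 4 \<Rightarrow> nat. sum \<mu> UNIV = 4} \<subseteq> (\<Pi>\<^sub>E i\<in>UNIV. {..4})"
  proof
    fix \<mu> :: "4 \<Rightarrow> nat" assume "\<mu> \<in> {\<mu>. sum \<mu> UNIV = 4}"
    then have "\<mu> i \<le> 4" for i using member_le_sum[of i UNIV \<mu>] by simp
    then show "\<mu> \<in> (\<Pi>\<^sub>E i\<in>UNIV. {..4})" by auto
  qed
qed (intro finite_PiE; simp)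

text \<open>Only the monomials in the two remaining variables survive on a coordinate line.\<close>

lemma quartic_on_edge:
  fixes v :: "complex ^ 4"
  assumes nm: "n \<noteq> m" and v: "\<And>r. r \<noteq> n \<Longrightarrow> r \<noteq> m \<Longrightarrow> v $ r = 0"
  shows "quartic f v = (\<Sum>e\<le>4. f ((\<lambda>_. 0)(n := e, m := 4 - e)) * (v $ n ^ e * v $ m ^ (4 - e)))"
proof -
  let ?\<mu> = "\<lambda>e. (\<lambda>_. 0)(n := e, m := 4 - e) :: 4 \<Rightarrow> nat"
  let ?t = "\<lambda>\<mu>. f \<mu> * (\<Prod>i\<in>UNIV. (v $ i) ^ \<mu> i)"
  have sum: "sum \<mu> UNIV = \<mu> n + \<mu> m" if "\<And>r. r \<noteq> n \<Longrightarrow> r \<noteq> m \<Longrightarrow> \<mu> r = 0" for \<mu> :: "4 \<Rightarrow> nat"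
  proof -
    have "sum \<mu> UNIV = sum \<mu> {n, m}" using that by (intro sum.mono_neutral_right) auto
    then show ?thesis using nm by simp
  qed
  have "quartic f v = sum ?t (?\<mu> ` {..4})"
    unfolding quartic_def
  proof (rule sum.mono_neutral_right[OF finite_exponents])
    show "?\<mu> ` {..4} \<subseteq> {\<mu>. sum \<mu> UNIV = 4}"
      using nm by (auto simp: sum)
    show "\<forall>\<mu>\<in>{\<mu>. sum \<mu> UNIV = 4} - ?\<mu> ` {..4}. ?t \<mu> = 0"
    proof
      fix \<mu> assume \<mu>: "\<mu> \<in> {\<mu>. sum \<mu> UNIV = 4} - ?\<mu> ` {..4}"
      have "\<exists>r. r \<noteq> n \<and> r \<noteq> m \<and> \<mu> r \<noteq> 0"
      proof (rule ccontr)
        assume "\<not> ?thesis"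
        then have z: "\<And>r. r \<noteq> n \<Longrightarrow> r \<noteq> m \<Longrightarrow> \<mu> r = 0" by blast
        then have "\<mu> n + \<mu> m = 4" using sum[of \<mu>] \<mu> by simp
        then have "\<mu> = ?\<mu> (\<mu> n)" "\<mu> n \<in> {..4}" using z nm by (auto simp: fun_eq_iff)
        then show False using \<mu> by blast
      qed
      then obtain r where "r \<noteq> n" "r \<noteq> m" "\<mu> r \<noteq> 0" by blast
      then have "(v $ r) ^ \<mu> r = 0" using v by simp
      then have "(\<Prod>i\<in>UNIV. (v $ i) ^ \<mu> i) = 0" by (intro prod_zero) auto
      then show "?t \<mu> = 0" by simp
    qed
  qed
  also have "\<dots> = (\<Sum>e\<le>4. ?t (?\<mu> e))"
  proof (rule sum.reindex_cong[where l = ?\<mu>])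
    show "inj_on ?\<mu> {..4}"
    proof (rule inj_onI)
      fix x y assume "?\<mu> x = ?\<mu> y"
      from fun_cong[OF this, of n] show "x = y" using nm by simp
    qed
  qed auto
  also have "\<dots> = (\<Sum>e\<le>4. f (?\<mu> e) * (v $ n ^ e * v $ m ^ (4 - e)))"
  proof (intro sum.cong refl)
    fix e
    have "(\<Prod>i\<in>UNIV. (v $ i) ^ ?\<mu> e i) = (\<Prod>i\<in>{n, m}. (v $ i) ^ ?\<mu> e i)"
      by (intro prod.mono_neutral_right) auto
    then show "?t (?\<mu> e) = f (?\<mu> e) * (v $ n ^ e * v $ m ^ (4 - e))" using nm by simp
  qed
  finally show ?thesis .
qed

lemma poly_edge_poly: "poly (edge_poly f n m) x = (\<Sum>e\<le>4. f ((\<lambda>_. 0)(n := e, m := 4 - e)) * x ^ e)"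
  by (simp add: edge_poly_def poly_sum poly_monom)

lemma quartic_edge_poly:
  fixes v :: "complex ^ 4"
  assumes nm: "n \<noteq> m" and v: "\<And>r. r \<noteq> n \<Longrightarrow> r \<noteq> m \<Longrightarrow> v $ r = 0" and m: "v $ m \<noteq> 0"
  shows "quartic f v = v $ m ^ 4 * poly (edge_poly f n m) (v $ n / v $ m)"
proof -
  have "quartic f v = (\<Sum>e\<le>4. f ((\<lambda>_. 0)(n := e, m := 4 - e)) * (v $ n ^ e * v $ m ^ (4 - e)))"
    by (rule quartic_on_edge) (use nm v in auto)
  also have "\<dots> = v $ m ^ 4 * poly (edge_poly f n m) (v $ n / v $ m)"
    unfolding poly_edge_poly sum_distrib_left
  proof (intro sum.cong refl)
  fix e :: nat assume "e \<in> {..4}"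
  then have "v $ m ^ 4 = v $ m ^ e * v $ m ^ (4 - e)" by (simp flip: power_add)
  then show "f ((\<lambda>_. 0)(n := e, m := 4 - e)) * (v $ n ^ e * v $ m ^ (4 - e)) =
      v $ m ^ 4 * (f ((\<lambda>_. 0)(n := e, m := 4 - e)) * (v $ n / v $ m) ^ e)"
    using m by (simp add: power_divide)
  qed
  finally show ?thesis .
qed

text \<open>The gradient of the product of the coordinates vanishes exactly where two coordinates do.\<close>

lemma family_singular_iff:
  fixes v :: "complex ^ 4"
  shows
  "family_eq f v 0 = 0 \<and> (\<forall>i. ((\<lambda>u. family_eq f (v + u *s axis i 1) 0) has_field_derivative 0) (at 0)) \<and>
     ((\<lambda>u. family_eq f v u) has_field_derivative 0) (at 0) \<longleftrightarrow>
   (\<exists>r s. r \<noteq> s \<and> v $ r = 0 \<and> v $ s = 0) \<and> quartic f v = 0"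
proof -
  have d: "((\<lambda>u. family_eq f (v + u *s axis i 1) 0) has_field_derivative 0) (at 0) \<longleftrightarrow>
      (\<Prod>r\<in>UNIV - {i}. v $ r) = 0" for i
  proof -
    have "family_eq f (v + u *s axis i 1) 0 = (v $ i + u) * (\<Prod>r\<in>UNIV - {i}. v $ r)" for u
    proof -
      have "(\<Prod>r\<in>UNIV. (v + u *s axis i 1) $ r) =
          (v + u *s axis i 1) $ i * (\<Prod>r\<in>UNIV - {i}. (v + u *s axis i 1) $ r)"
        by (rule prod.remove) auto
      also have "(\<Prod>r\<in>UNIV - {i}. (v + u *s axis i 1) $ r) = (\<Prod>r\<in>UNIV - {i}. v $ r)"
        by (intro prod.cong) (auto simp: axis_def)
      finally show ?thesis by (simp add: family_eq_def axis_def)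
    qed
    then have "((\<lambda>u. family_eq f (v + u *s axis i 1) 0) has_field_derivative (\<Prod>r\<in>UNIV - {i}. v $ r)) (at 0)"
      by (auto intro!: derivative_eq_intros)
    then show ?thesis using DERIV_unique by metis
  qed
  have q: "((\<lambda>u. family_eq f v u) has_field_derivative 0) (at 0) \<longleftrightarrow> quartic f v = 0"
  proof -
    have "((\<lambda>u. family_eq f v u) has_field_derivative quartic f v) (at 0)"
      unfolding family_eq_def by (auto intro!: derivative_eq_intros)
    then show ?thesis using DERIV_unique by metis
  qed
  have "family_eq f v 0 = 0 \<and> (\<forall>i. (\<Prod>r\<in>UNIV - {i}. v $ r) = 0) \<longleftrightarrow>
      (\<exists>r s. r \<noteq> s \<and> v $ r = 0 \<and> v $ s = 0)"
  proof
    assume *: "family_eq f v 0 = 0 \<and> (\<forall>i. (\<Prod>r\<in>UNIV - {i}. v $ r) = 0)"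
    then obtain r where r: "v $ r = 0" by (auto simp: family_eq_def)
    from * have "(\<Prod>s\<in>UNIV - {r}. v $ s) = 0" by blast
    then show "\<exists>r s. r \<noteq> s \<and> v $ r = 0 \<and> v $ s = 0" using r by auto
  next
    assume "\<exists>r s. r \<noteq> s \<and> v $ r = 0 \<and> v $ s = 0"
    then obtain r s where rs: "r \<noteq> s" "v $ r = 0" "v $ s = 0" by blast
    have "(\<Prod>r\<in>UNIV - {i}. v $ r) = 0" for i using rs by (cases "i = r") (auto intro!: prod_zero)
    moreover have "family_eq f v 0 = 0" using rs by (auto simp: family_eq_def)
    ultimately show "family_eq f v 0 = 0 \<and> (\<forall>i. (\<Prod>r\<in>UNIV - {i}. v $ r) = 0)" by blast
  qed
  then show ?thesis unfolding d q by blast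
qed

lemma sing_set_iff:
  fixes v :: "complex ^ 4"
  assumes "v \<noteq> 0"
  shows "proj v \<in> sing_set f \<longleftrightarrow> (\<exists>r s. r \<noteq> s \<and> v $ r = 0 \<and> v $ s = 0) \<and> quartic f v = 0"
proof -
  have *: "P \<in> sing_set f \<longleftrightarrow> (\<exists>w. P = proj w \<and> w \<noteq> 0 \<and>
      (\<exists>r s. r \<noteq> s \<and> w $ r = 0 \<and> w $ s = 0) \<and> quartic f w = 0)" for P
    unfolding family_singular_iff[symmetric] by (auto simp: sing_set_def total_space_sing_def)
  show ?thesis
  proof
    assume "proj v \<in> sing_set f"
    then obtain w :: "complex ^ 4" where w: "proj v = proj w" "w \<noteq> 0" "\<exists>r s. r \<noteq> s \<and> w $ r = 0 \<and> w $ s = 0" "quartic f w = 0"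
      unfolding * by blast
    obtain c where "c \<noteq> 0" "w = c *s v" using proj_eqE[OF w(1,2)] .
    then show "(\<exists>r s. r \<noteq> s \<and> v $ r = 0 \<and> v $ s = 0) \<and> quartic f v = 0"
      using w by (auto simp: quartic_scale)
  next
    assume "(\<exists>r s. r \<noteq> s \<and> v $ r = 0 \<and> v $ s = 0) \<and> quartic f v = 0"
    then show "proj v \<in> sing_set f" unfolding * using assms by blast
  qed
qed

lemma distinct4_UNIV:
  assumes "distinct [n, m, p, q :: 4]"
  shows "r = n \<or> r = m \<or> r = p \<or> r = q"
proof -
  have "card {n, m, p, q} = CARD(4)" using assms by simp
  then have "{n, m, p, q} = UNIV" by (metis card_eq_UNIV_imp_eq_UNIV finite)
  then show ?thesis by blast
qed

lemma complement_of_pair: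
  assumes "n \<noteq> (m :: 4)"
  obtains p q where "- {n, m} = {p, q}" "p \<noteq> q"
proof -
  have "card (- {n, m}) = CARD(4) - card {n, m}"
    unfolding Compl_eq_Diff_UNIV by (rule card_Diff_subset) simp_all
  then have "card (- {n, m}) = 2" using assms by simp
  then show ?thesis using that by (auto simp only: card_2_iff)
qed

lemma edge_poly_lead:
  assumes "proj (axis n 1) \<notin> sing_set f" "n \<noteq> m"
  shows "edge_poly f n m \<noteq> 0" "degree (edge_poly f n m) \<le> 4"
proof -
  obtain r s where rs: "- {n, m} = {r, s}" "r \<noteq> s"
    using complement_of_pair[OF assms(2)] by blast
  then have "r \<noteq> n" "s \<noteq> n" by auto
  then have "\<exists>r s. r \<noteq> s \<and> (axis n 1 :: complex ^ 4) $ r = 0 \<and> (axis n 1 :: complex ^ 4) $ s = 0"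
    using rs(2) by (intro exI[of _ r] exI[of _ s]) (simp add: axis_def)
  moreover have "(axis n 1 :: complex ^ 4) \<noteq> 0" by simp
  ultimately have "quartic f (axis n 1) \<noteq> 0" using assms sing_set_iff[of "axis n 1" f] by blast
  moreover have "quartic f (axis n 1) = (\<Sum>e\<le>4. f ((\<lambda>_. 0)(n := e, m := 4 - e)) * (1 ^ e * 0 ^ (4 - e)))"
    using assms by (subst quartic_on_edge[of n m]) (auto simp: axis_def)
  moreover have "\<dots> = (\<Sum>e\<in>{4}. f ((\<lambda>_. 0)(n := e, m := 4 - e)))"
    by (rule sum.mono_neutral_cong_right) auto
  moreover have "coeff (edge_poly f n m) 4 = f ((\<lambda>_. 0)(n := 4, m := 0))"
    by (simp add: edge_poly_def coeff_sum)
  ultimately show "edge_poly f n m \<noteq> 0" by auto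
  show "degree (edge_poly f n m) \<le> 4"
    unfolding edge_poly_def by (intro degree_sum_le) (auto intro: order.trans[OF degree_monom_le])
qed

text \<open>Four points on each of the six coordinate lines exhaust the \<open>24\<close> singular points. So \<open>f\<close>
  cannot have a double zero on a coordinate line.\<close>

lemma edge_poly_simple_root:
  assumes card: "card (sing_set f) = 24" and vertex: "\<And>r. proj (axis r 1) \<notin> sing_set f"
    and nm: "n \<noteq> m" and root: "poly (edge_poly f n m) \<alpha> = 0"
  shows "poly (pderiv (edge_poly f n m)) \<alpha> \<noteq> 0"
proof
  assume double: "poly (pderiv (edge_poly f n m)) \<alpha> = 0"
  define R where "R n m = {x. poly (edge_poly f n m) x = 0}" for n m
  define E where "E = (\<lambda>(n, m). (\<lambda>x. proj (axis m 1 + x *s axis n 1)) ` R n m)"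
  have fin: "finite (R n m)" "card (R n m) \<le> 4" if "n \<noteq> m" for n m
    using edge_poly_lead[OF vertex that] card_poly_roots_bound[of "edge_poly f n m"]
      poly_roots_finite[of "edge_poly f n m"]
    unfolding R_def by simp_all
  \<comment> \<open>A line with a double zero carries at most three singular points, the other five at most four
    each.\<close>
  have card_E: "card (E (n, m)) \<le> card (R n m)" if "n \<noteq> m" for n m
    using card_image_le[OF fin(1)[OF that]] by (simp add: E_def)
  have "card (R n m) \<le> 3"
  proof -
    obtain g where g: "edge_poly f n m = [:- \<alpha>, 1:] * g"
      using root unfolding poly_eq_0_iff_dvd by (rule dvdE)
    have "poly g \<alpha> = 0" using double unfolding g pderiv_mult by (simp add: pderiv_pCons)
    then have "R n m = {x. poly g x = 0}" unfolding R_def g by auto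
    moreover have "g \<noteq> 0" "degree g \<le> 3"
      using edge_poly_lead[OF vertex nm] unfolding g by (auto simp: degree_mult_eq simp del: mult_pCons_left)
    ultimately show ?thesis using card_poly_roots_bound[of g] by simp
  qed
  obtain p q where d: "distinct [n, m, p, q]"
  proof -
    obtain p q where "- {n, m} = {p, q}" "p \<noteq> q"
      using complement_of_pair[OF nm] .
    then have "distinct [n, m, p, q]" using nm by auto
    then show ?thesis by (rule that)
  qed
  note cases = distinct4_UNIV[OF d]
  let ?S = "{(n, p), (n, q), (m, p), (m, q), (p, q)}"
  have "sing_set f \<subseteq> (\<Union>e\<in>insert (n, m) ?S. E e)"
  proof
    fix P assume P: "P \<in> sing_set f"
    then obtain v where v: "P = proj v" "v \<noteq> 0" by (auto simp: sing_set_def total_space_sing_def)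
    then obtain r s where rs: "r \<noteq> s" "v $ r = 0" "v $ s = 0" and qz: "quartic f v = 0"
      using P sing_set_iff by blast
    obtain x y where xy: "- {r, s} = {x, y}" "x \<noteq> y"
      using complement_of_pair[OF \<open>r \<noteq> s\<close>] by blast
    have "(x, y) \<in> insert (n, m) ?S \<or> (y, x) \<in> insert (n, m) ?S"
      using cases[of x] cases[of y] xy(2) by auto
    then obtain n' m' where e: "(n', m') \<in> insert (n, m) ?S" and "n' = x \<and> m' = y \<or> n' = y \<and> m' = x"
      by blast
    then have sup': "t = r \<or> t = s" if "t \<noteq> n'" "t \<noteq> m'" for t
    proof -
      have "t \<notin> - {r, s}" unfolding xy(1) using that \<open>n' = x \<and> m' = y \<or> n' = y \<and> m' = x\<close> by blast
      then show ?thesis by blast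
    qed
    have sup: "v $ t = 0" if "t \<noteq> n'" "t \<noteq> m'" for t
      using sup'[OF that] rs by auto
    have ne: "n' \<noteq> m'" using e d by auto
    have m': "v $ m' \<noteq> 0"
    proof
      assume "v $ m' = 0"
      then have "v = (v $ n') *s axis n' 1" using sup by (auto simp: vec_eq_iff axis_def)
      moreover from this have "v $ n' \<noteq> 0" using v by auto
      ultimately have "proj v = proj (axis n' 1)" by (metis proj_scale)
      then show False using P v vertex by simp
    qed
    then have "poly (edge_poly f n' m') (v $ n' / v $ m') = 0"
      using quartic_edge_poly[OF ne sup m', of f] qz by simp
    moreover have "v = (v $ m') *s (axis m' 1 + (v $ n' / v $ m') *s axis n' 1)"
      using sup ne m' by (auto simp: vec_eq_iff axis_def)
    then have "P = proj (axis m' 1 + (v $ n' / v $ m') *s axis n' 1)"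
      unfolding v(1) using proj_scale[OF m'] by metis
    ultimately have "P \<in> E (n', m')" by (auto simp: E_def R_def)
    then show "P \<in> (\<Union>e\<in>insert (n, m) ?S. E e)" using e by blast
  qed
  moreover have finE: "finite (E e)" if "e \<in> insert (n, m) ?S" for e
    using that d fin by (auto simp: E_def)
  ultimately have "card (sing_set f) \<le> card (\<Union>e\<in>insert (n, m) ?S. E e)"
    by (intro card_mono) auto
  also have "\<dots> \<le> (\<Sum>e\<in>insert (n, m) ?S. card (E e))" by (rule card_UN_le) simp
  also have "\<dots> = card (E (n, m)) + (\<Sum>e\<in>?S. card (E e))"
    by (rule sum.insert) (use d in auto)
  finally have bound: "card (sing_set f) \<le> card (E (n, m)) + (\<Sum>e\<in>?S. card (E e))" .
  have "card (E (n, m)) \<le> 3"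
    using card_E[OF nm] \<open>card (R n m) \<le> 3\<close> by linarith
  moreover have "(\<Sum>e\<in>?S. card (E e)) \<le> (\<Sum>e\<in>?S. 4)"
  proof (rule sum_mono)
    fix e assume "e \<in> ?S"
    then have ne: "fst e \<noteq> snd e" using d by auto
    have "card (E (fst e, snd e)) \<le> 4"
      using card_E[OF ne] fin(2)[OF ne] by (rule order.trans)
    then show "card (E e) \<le> 4" by simp
  qed
  moreover have "(\<Sum>e\<in>?S. 4) \<le> (20 :: nat)"
    using card_length[of "[(n, p), (n, q), (m, p), (m, q), (p, q)]"] by simp
  ultimately show False using card bound by linarith
qed

section \<open>Global sections of the twisted dual\<close>

lemma global_function_constant:
  assumes "\<And>q. r \<in> local_ring q"
  obtains c where "r = kconst c"
proof -
  define P Q where "P = fst (quot_of_fract r)" and "Q = snd (quot_of_fract r)"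
  have r: "r = Fract P Q" "Q \<noteq> 0" by (simp_all add: P_def Q_def)
  have "poly Q a \<noteq> 0" for a
    using assms[of "Aff a"] unfolding local_ring_Aff_iff by (simp add: poles_def Q_def)
  then have "constant (poly Q)" using fundamental_theorem_of_algebra by blast
  then have "degree Q = 0" by (simp add: constant_degree)
  then obtain d where d: "Q = [:d:]" by (metis degree_eq_zeroE)
  with r have "d \<noteq> 0" by auto
  obtain p q where pq: "r = Fract p q" "q \<noteq> 0" "degree p \<le> degree q"
    using assms[of Infty] by auto
  have e: "P * q = p * Q" using r pq by (simp add: eq_fract)
  have "degree P = 0"
  proof (cases "P = 0")
    case False
    then have "degree P + degree q = degree (p * Q)" using pq by (simp add: e[symmetric] degree_mult_eq)
    also have "\<dots> \<le> degree p" using d by simp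
    finally show ?thesis using pq by simp
  qed simp
  then obtain c where "P = [:c:]" by (metis degree_eq_zeroE)
  then have "r = kconst (c / d)" using d \<open>d \<noteq> 0\<close> by (simp add: r eq_fract)
  then show ?thesis using that by blast
qed

context canonical_quotient
begin

lemma \<phi>_cancel: "pair_mult r \<eta>\<^sub>0 = pair_mult r' \<eta>\<^sub>0 \<Longrightarrow> r = r'"
proof -
  assume "pair_mult r \<eta>\<^sub>0 = pair_mult r' \<eta>\<^sub>0"
  then have "pairing (pair_mult r \<eta>\<^sub>0) (\<sigma> 1) = pairing (pair_mult r' \<eta>\<^sub>0) (\<sigma> 1)" by simp
  moreover have "pairing (pair_mult s \<eta>\<^sub>0) v = s * \<phi> v" for s v by (simp add: pairing_def algebra_simps)
  ultimately show "r = r'" by (simp add: splitting)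
qed

text \<open>The kernel of \<open>\<eta>\<^sub>0\<close> is a line, so the functionals that vanish on a nonzero vector of it are
proportional to \<open>\<eta>\<^sub>0\<close>. The factor is found by evaluation on a vector with \<open>\<phi> = 1\<close>.\<close>

lemma annihilator:
  assumes "v \<noteq> 0" "\<phi> v = 0" "pairing m v = 0"
  shows "m = pair_mult (pairing m (\<sigma> 1)) \<eta>\<^sub>0"
proof -
  obtain x y where v: "v = (x, y)" by (cases v)
  obtain m\<^sub>1 m\<^sub>2 where m: "m = (m\<^sub>1, m\<^sub>2)" by (cases m)
  obtain e\<^sub>1 e\<^sub>2 where e: "\<eta>\<^sub>0 = (e\<^sub>1, e\<^sub>2)" by (cases \<eta>\<^sub>0)
  obtain s\<^sub>1 s\<^sub>2 where s: "\<sigma> 1 = (s\<^sub>1, s\<^sub>2)" by (cases "\<sigma> 1")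
  have eqs: "e\<^sub>1 * x + e\<^sub>2 * y = 0" "m\<^sub>1 * x + m\<^sub>2 * y = 0" and 1: "e\<^sub>1 * s\<^sub>1 + e\<^sub>2 * s\<^sub>2 = 1"
    using assms splitting[of 1] by (simp_all add: pairing_def v m e s)
  have "(m\<^sub>2 * e\<^sub>1 - m\<^sub>1 * e\<^sub>2) * x = m\<^sub>2 * (e\<^sub>1 * x + e\<^sub>2 * y) - e\<^sub>2 * (m\<^sub>1 * x + m\<^sub>2 * y)"
    "(m\<^sub>2 * e\<^sub>1 - m\<^sub>1 * e\<^sub>2) * y = e\<^sub>1 * (m\<^sub>1 * x + m\<^sub>2 * y) - m\<^sub>1 * (e\<^sub>1 * x + e\<^sub>2 * y)"
    by (simp_all add: algebra_simps)
  then have det: "m\<^sub>2 * e\<^sub>1 - m\<^sub>1 * e\<^sub>2 = 0" using assms(1) v eqs by (auto simp: zero_prod_def)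
  have "(m\<^sub>1 * s\<^sub>1 + m\<^sub>2 * s\<^sub>2) * e\<^sub>1 = m\<^sub>1 * (e\<^sub>1 * s\<^sub>1 + e\<^sub>2 * s\<^sub>2) + s\<^sub>2 * (m\<^sub>2 * e\<^sub>1 - m\<^sub>1 * e\<^sub>2)"
    "(m\<^sub>1 * s\<^sub>1 + m\<^sub>2 * s\<^sub>2) * e\<^sub>2 = m\<^sub>2 * (e\<^sub>1 * s\<^sub>1 + e\<^sub>2 * s\<^sub>2) - s\<^sub>1 * (m\<^sub>2 * e\<^sub>1 - m\<^sub>1 * e\<^sub>2)"
    by (simp_all add: algebra_simps)
  then show ?thesis by (simp add: det 1 pair_mult_def pairing_def m e s)
qed

definition dual_stalk :: "P1 \<Rightarrow> (K \<times> K) set" where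
  "dual_stalk q = {m. (\<forall>v\<in>B q. pairing m v \<in> local_ring q) \<and> (\<forall>v\<in>A q. pairing m v = 0)}"

lemma dual_stalk_eq:
  assumes "v\<^sub>0 \<in> A q" "v\<^sub>0 \<noteq> 0"
  shows "dual_stalk q = {pair_mult \<kappa> \<eta>\<^sub>0 |\<kappa>. \<kappa> * trivialization q ^ 2 \<in> local_ring q}"
proof (intro equalityI subsetI)
  fix m assume m: "m \<in> dual_stalk q"
  have "pairing m v\<^sub>0 = 0" "\<phi> v\<^sub>0 = 0" using m assms unfolding dual_stalk_def A_eq by blast+
  then have m_eq: "m = pair_mult (pairing m (\<sigma> 1)) \<eta>\<^sub>0" using assms by (intro annihilator)
  have "trivialization q ^ 2 \<in> canonical q" by (simp add: canonical_eq)
  then have "pairing m (\<sigma> (trivialization q ^ 2)) \<in> local_ring q"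
    using m \<sigma>_B by (auto simp: dual_stalk_def)
  moreover have "\<sigma> (trivialization q ^ 2) = pair_mult (trivialization q ^ 2) (\<sigma> 1)"
    using \<sigma>_mult[of "trivialization q ^ 2" 1] by simp
  then have "pairing m (\<sigma> (trivialization q ^ 2)) = pairing m (\<sigma> 1) * trivialization q ^ 2"
    by (simp add: pairing_def algebra_simps)
  ultimately show "m \<in> {pair_mult \<kappa> \<eta>\<^sub>0 |\<kappa>. \<kappa> * trivialization q ^ 2 \<in> local_ring q}"
    using m_eq by auto
next
  fix m assume "m \<in> {pair_mult \<kappa> \<eta>\<^sub>0 |\<kappa>. \<kappa> * trivialization q ^ 2 \<in> local_ring q}"
  then obtain \<kappa> where \<kappa>: "m = pair_mult \<kappa> \<eta>\<^sub>0" "\<kappa> * trivialization q ^ 2 \<in> local_ring q" by blast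
  have p: "pairing m v = \<kappa> * \<phi> v" for v by (simp add: \<kappa> pairing_def algebra_simps)
  have "\<kappa> * \<phi> v \<in> local_ring q" if "v \<in> B q" for v
  proof -
    have "\<phi> v / trivialization q ^ 2 \<in> local_ring q" using pairing_B[OF that] by (simp add: canonical_eq)
    from local_ring_mult[OF \<kappa>(2) this] show ?thesis by simp
  qed
  then show "m \<in> dual_stalk q"
    unfolding dual_stalk_def by (intro CollectI conjI ballI) (simp_all add: p A_eq)
qed

definition twisted_dual_stalk :: "P1 \<Rightarrow> (K \<times> K) set" where
  "twisted_dual_stalk q = {\<Sum>d<n. pair_mult (\<theta> d) (m d) |(n::nat) \<theta> m.
     \<forall>d<n. \<theta> d \<in> canonical q \<and> m d \<in> dual_stalk q}"

text \<open>The stalks of the dual sheaf and of the canonical sheaf are free of rank one, with generators that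
are inverse to each other up to \<open>\<eta>\<^sub>0\<close>.\<close>

lemma twisted_dual_stalk_eq:
  assumes "v\<^sub>0 \<in> A q" "v\<^sub>0 \<noteq> 0"
  shows "twisted_dual_stalk q = (\<lambda>r. pair_mult r \<eta>\<^sub>0) ` local_ring q"
proof (intro equalityI subsetI)
  fix \<eta> assume "\<eta> \<in> twisted_dual_stalk q"
  then obtain n :: nat and \<theta> m where \<eta>: "\<eta> = (\<Sum>d<n. pair_mult (\<theta> d) (m d))"
    and *: "\<And>d. d < n \<Longrightarrow> \<theta> d \<in> canonical q \<and> m d \<in> dual_stalk q"
    unfolding twisted_dual_stalk_def by blast
  have "(\<Sum>d<n'. pair_mult (\<theta> d) (m d)) \<in> (\<lambda>r. pair_mult r \<eta>\<^sub>0) ` local_ring q" if "n' \<le> n" for n'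
    using that
  proof (induction n')
    case 0
    have "(0 :: K \<times> K) = pair_mult 0 \<eta>\<^sub>0" by (simp add: pair_mult_def zero_prod_def)
    then show ?case by (simp add: image_iff) (metis local_ring_0)
  next
    case (Suc n')
    then obtain r where r: "r \<in> local_ring q" "(\<Sum>d<n'. pair_mult (\<theta> d) (m d)) = pair_mult r \<eta>\<^sub>0" by auto
    obtain \<kappa> where \<kappa>: "m n' = pair_mult \<kappa> \<eta>\<^sub>0" "\<kappa> * trivialization q ^ 2 \<in> local_ring q"
      using *[of n'] Suc.prems unfolding dual_stalk_eq[OF assms] by auto
    have "\<theta> n' / trivialization q ^ 2 \<in> local_ring q"
      using *[of n'] Suc.prems by (simp add: canonical_eq)
    from local_ring_mult[OF \<kappa>(2) this] have "\<kappa> * \<theta> n' \<in> local_ring q" by simp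
    then have "r + \<theta> n' * \<kappa> \<in> local_ring q" using r by (simp add: mult.commute)
    moreover have "(\<Sum>d<Suc n'. pair_mult (\<theta> d) (m d)) = pair_mult (r + \<theta> n' * \<kappa>) \<eta>\<^sub>0"
      using r \<kappa> by (simp add: pair_mult_def plus_prod_def algebra_simps)
    ultimately show ?case by blast
  qed
  then show "\<eta> \<in> (\<lambda>r. pair_mult r \<eta>\<^sub>0) ` local_ring q" by (simp add: \<eta>)
next
  fix \<eta> assume "\<eta> \<in> (\<lambda>r. pair_mult r \<eta>\<^sub>0) ` local_ring q"
  then obtain r where r: "r \<in> local_ring q" "\<eta> = pair_mult r \<eta>\<^sub>0" by blast
  \<comment> \<open>One tensor suffices: a generator of the canonical sheaf times a generator of the dual.\<close>
  define \<theta> \<kappa> where "\<theta> = r * trivialization q ^ 2" and "\<kappa> = inverse (trivialization q ^ 2)"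
  have "\<theta> \<in> canonical q" using r by (simp add: canonical_eq \<theta>_def)
  moreover have "pair_mult \<kappa> \<eta>\<^sub>0 \<in> dual_stalk q"
    unfolding dual_stalk_eq[OF assms] by (auto intro!: exI[of _ \<kappa>] simp: \<kappa>_def)
  moreover have "\<eta> = (\<Sum>d<Suc 0. pair_mult \<theta> (pair_mult \<kappa> \<eta>\<^sub>0))"
    by (simp add: r \<theta>_def \<kappa>_def pair_mult_def)
  ultimately show "\<eta> \<in> twisted_dual_stalk q"
    unfolding twisted_dual_stalk_def mem_Collect_eq
    by (intro exI[of _ "Suc 0"] exI[of _ "\<lambda>_. \<theta>"] exI[of _ "\<lambda>_. pair_mult \<kappa> \<eta>\<^sub>0"]) simp
qed

lemma line_coord_global_sections:
  assumes "\<And>q. \<exists>v\<in>A q. v \<noteq> 0"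
  shows "line_coord (lin_mod (\<lambda>c. pair_mult (kconst c)) (\<Inter>q. twisted_dual_stalk q))
    (\<lambda>c. pair_mult (kconst c) \<eta>\<^sub>0)"
proof -
  have stalk: "twisted_dual_stalk q = (\<lambda>r. pair_mult r \<eta>\<^sub>0) ` local_ring q" for q
    using assms[of q] twisted_dual_stalk_eq by blast
  have "(\<Inter>q. twisted_dual_stalk q) = range (\<lambda>c. pair_mult (kconst c) \<eta>\<^sub>0)"
  proof (intro equalityI subsetI)
    fix \<eta> assume \<eta>: "\<eta> \<in> (\<Inter>q. twisted_dual_stalk q)"
    then obtain r where r: "\<eta> = pair_mult r \<eta>\<^sub>0" unfolding stalk by blast
    have "r \<in> local_ring q" for q
    proof -
      obtain r' where "r' \<in> local_ring q" "\<eta> = pair_mult r' \<eta>\<^sub>0" using \<eta> unfolding stalk by blast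
      then show ?thesis using r \<phi>_cancel[of r r'] by simp
    qed
    then obtain c where "r = kconst c" by (rule global_function_constant)
    then show "\<eta> \<in> range (\<lambda>c. pair_mult (kconst c) \<eta>\<^sub>0)" using r by blast
  next
    fix \<eta> assume "\<eta> \<in> range (\<lambda>c. pair_mult (kconst c) \<eta>\<^sub>0)"
    then show "\<eta> \<in> (\<Inter>q. twisted_dual_stalk q)" unfolding stalk by auto
  qed
  moreover have "inj (\<lambda>c. pair_mult (kconst c) \<eta>\<^sub>0)"
    by (rule injI) (metis \<phi>_cancel kconst_eq_iff)
  ultimately show ?thesis
    by (auto simp: line_coord_def lin_mod_def bij_betw_def pair_mult_def plus_prod_def zero_prod_def
        algebra_simps)
qed

end

section \<open>The coordinate triangle and the stalks along the line\<close>

text \<open>The line through the points \<open>a\<close> and \<open>b\<close> of the plane \<open>X\<^sub>i = 0\<close>.\<close>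

locale special_line =
  fixes f :: "(4 \<Rightarrow> nat) \<Rightarrow> complex" and a b :: "complex ^ 4" and i j k l :: 4
  assumes coords: "distinct [i, j, k, l]"
    and generic: "generic_quartic f i"
    and in_plane: "a $ i = 0" "b $ i = 0"
    and embedding: "\<And>\<alpha> \<beta>. \<alpha> *s a + \<beta> *s b = 0 \<Longrightarrow> \<alpha> = 0 \<and> \<beta> = 0"
    and star: "range (line_map a b) \<inter> coord_lines \<subseteq> sing_set f"
begin

text \<open>A vector of homogeneous coordinates for a point of the line, and a second vector that spans the line
together with it, normalized so that \<open>local_eqn_expand\<close> holds.\<close>

fun hpoint :: "P1 \<Rightarrow> complex ^ 4" where
  "hpoint (Aff s) = a + s *s b"
| "hpoint Infty = b"

fun hdirection :: "P1 \<Rightarrow> complex ^ 4" where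
  "hdirection (Aff s) = b"
| "hdirection Infty = a"

definition minor :: "4 \<Rightarrow> 4 \<Rightarrow> complex" where
  "minor r m = b $ r * a $ m - a $ r * b $ m"

text \<open>The restriction of a homogeneous coordinate to the line, as a function near \<open>q\<close>. For
\<open>r \<noteq> i\<close> it is a unit or a local coordinate at \<open>q\<close>.\<close>

definition local_eqn :: "P1 \<Rightarrow> 4 \<Rightarrow> K" where
  "local_eqn q r = hcoord a b r * trivialization q"

lemma line_map_hpoint: "line_map a b q = proj (hpoint q)"
  by (cases q) simp_all

lemma hpoint_nonzero: "hpoint q \<noteq> 0"
  using embedding[of 1 "case q of Aff s \<Rightarrow> s | Infty \<Rightarrow> 0"] embedding[of 0 1] by (cases q) auto

lemma hpoint_i: "hpoint q $ i = 0"
  using in_plane by (cases q) auto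

lemma line_map_plane: "line_map a b q \<in> comp_plane r \<longleftrightarrow> hpoint q $ r = 0"
  unfolding line_map_hpoint by (rule proj_in_comp_plane[OF hpoint_nonzero])

lemma coord_cases: "r = i \<or> r = j \<or> r = k \<or> r = l"
  using distinct4_UNIV[OF coords] .

lemma vertex_not_singular: "proj (axis r 1) \<notin> sing_set f" and card_sing: "card (sing_set f) = 24"
  using generic by (auto simp: generic_quartic_def)

lemma line_map_sing:
  assumes "r \<noteq> i" "hpoint q $ r = 0"
  shows "line_map a b q \<in> sing_set f"
proof -
  have "line_map a b q \<in> comp_plane i \<inter> comp_plane r"
    using assms hpoint_i by (simp add: line_map_plane)
  then have "line_map a b q \<in> coord_lines" using assms(1) unfolding coord_lines_def by blast
  then show ?thesis using star by blast
qed

lemma line_map_coord_lines: "line_map a b q \<in> coord_lines \<longleftrightarrow> (\<exists>r. r \<noteq> i \<and> hpoint q $ r = 0)"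
proof
  assume "line_map a b q \<in> coord_lines"
  then obtain r s where "r \<noteq> s" "hpoint q $ r = 0" "hpoint q $ s = 0"
    by (auto simp: coord_lines_def line_map_plane)
  then show "\<exists>r. r \<noteq> i \<and> hpoint q $ r = 0" by metis
next
  assume "\<exists>r. r \<noteq> i \<and> hpoint q $ r = 0"
  then show "line_map a b q \<in> coord_lines"
    using hpoint_i unfolding coord_lines_def line_map_plane[symmetric] by blast
qed

text \<open>A point of the line with two vanishing coordinates in the plane is fixed by the torus, and it is
singular by the assumption on the intersection of the line with the coordinate lines.\<close>

lemma avoids_vertices:
  assumes "r \<noteq> s" "r \<noteq> i" "s \<noteq> i"
  shows "\<not> (hpoint q $ r = 0 \<and> hpoint q $ s = 0)"
proof
  assume z: "hpoint q $ r = 0 \<and> hpoint q $ s = 0"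
  obtain x y where xy: "- {r, s} = {x, y}" "x \<noteq> y" using complement_of_pair[OF assms(1)] .
  then have "i = x \<or> i = y" using assms by blast
  then obtain m where m: "- {r, s} = {i, m}" using xy by blast
  have "hpoint q = (hpoint q $ m) *s axis m 1"
  proof -
    have "hpoint q $ t = 0" if "t \<noteq> m" for t
    proof -
      have "t = r \<or> t = s \<or> t = i" using m that by blast
      then show ?thesis using z hpoint_i by blast
    qed
    then show ?thesis by (auto simp: vec_eq_iff axis_def)
  qed
  moreover from this have "hpoint q $ m \<noteq> 0" using hpoint_nonzero[of q] by auto
  ultimately have "line_map a b q = proj (axis m 1)"
    unfolding line_map_hpoint by (metis proj_scale)
  moreover have "line_map a b q \<in> sing_set f" using line_map_sing[of r q] assms z by blast
  ultimately show False using vertex_not_singular by simp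
qed

text \<open>If a minor vanished, the two linear forms would have a common zero.\<close>

lemma minor_nonzero:
  assumes "r \<noteq> m" "r \<noteq> i" "m \<noteq> i"
  shows "minor r m \<noteq> 0"
proof
  assume 0: "minor r m = 0"
  have no: "hpoint q $ r \<noteq> 0 \<or> hpoint q $ m \<noteq> 0" for q using avoids_vertices[OF assms] by blast
  show False
  proof (cases "b $ r = 0")
    case True
    then have "b $ m \<noteq> 0" using no[of Infty] by simp
    then show False using no[of "Aff (- a $ m / b $ m)"] 0 True by (simp add: minor_def)
  next
    case False
    then show False using no[of "Aff (- a $ r / b $ r)"] 0 by (simp add: minor_def field_simps)
  qed
qed

lemma minor_antisym: "minor m r = - minor r m"
  by (simp add: minor_def)

lemma hcoord_nonzero:
  assumes "r \<noteq> i"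
  shows "[:a $ r, b $ r:] \<noteq> 0" "hcoord a b r \<noteq> 0"
proof -
  define m where "m = (if r = j then k else j)"
  have "m \<noteq> i" "m \<noteq> r"
    using coords by (auto simp: m_def)
  then have "minor r m \<noteq> 0" using assms by (intro minor_nonzero) auto
  then show "[:a $ r, b $ r:] \<noteq> 0" by (auto simp: minor_def)
  then show "hcoord a b r \<noteq> 0" by (simp add: hcoord_def Fract_eq_0_iff del: pCons_eq_0_iff)
qed

lemma hcoord_i: "hcoord a b i = 0"
  by (simp add: hcoord_def in_plane)

lemma local_eqn_nonzero: "r \<noteq> i \<Longrightarrow> local_eqn q r \<noteq> 0"
  by (simp add: local_eqn_def hcoord_nonzero)

lemma hcoord_divide: "hcoord a b r / hcoord a b m = local_eqn q r / local_eqn q m"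
  by (simp add: local_eqn_def)

lemma hcoord_linear: "hcoord a b r = kconst (a $ r) + kconst (b $ r) * Fract [:0, 1:] 1"
  by (simp add: hcoord_def add_fract mult_fract del: kconst_arith)

lemma local_eqn_expand: "local_eqn q r = kconst (hpoint q $ r) + uniformizer q * kconst (hdirection q $ r)"
proof (cases q)
  case (Aff s)
  then show ?thesis by (simp add: local_eqn_def hcoord_def add_fract mult_fract del: kconst_arith)
next
  case Infty
  then show ?thesis by (simp add: local_eqn_def hcoord_def fract_arith eq_fract del: kconst_arith)
qed

lemma local_eqn_local_ring [simp]: "local_eqn q r \<in> local_ring q"
  unfolding local_eqn_expand by simp

lemma local_eqn_unit: "hpoint q $ r \<noteq> 0 \<Longrightarrow> local_unit q (local_eqn q r)"
  by (rule local_unitI[of _ "hpoint q $ r"]) (simp_all add: local_eqn_expand uniformizer_mult_in_max_ideal)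

lemma local_eqn_uniformizer:
  assumes "r \<noteq> i" "hpoint q $ r = 0"
  obtains c where "c \<noteq> 0" "local_eqn q r = uniformizer q * kconst c"
  using local_eqn_expand[of q r] local_eqn_nonzero[OF assms(1), of q] assms(2) that[of "hdirection q $ r"] by auto

lemma max_ideal_divide_eqn:
  assumes "r \<noteq> i" "hpoint q $ r = 0"
  shows "x / local_eqn q r \<in> local_ring q \<longleftrightarrow> x \<in> max_ideal q"
proof -
  obtain c where c: "c \<noteq> 0" "local_eqn q r = uniformizer q * kconst c" using local_eqn_uniformizer[OF assms] .
  have u: "local_unit q (kconst c)" using c by (simp add: local_unit_const)
  have "x / local_eqn q r \<in> local_ring q \<longleftrightarrow> x / local_eqn q r * kconst c \<in> local_ring q"
    by (rule local_unit_cancel(2)[OF u, symmetric])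
  also have "\<dots> \<longleftrightarrow> uniformizer q * (x / local_eqn q r * kconst c) \<in> max_ideal q"
    by (simp only: uniformizer_mult_in_max_ideal)
  also have "uniformizer q * (x / local_eqn q r * kconst c) = x" using c by simp
  finally show ?thesis .
qed

lemma local_eqn_max_ideal: "r \<noteq> i \<Longrightarrow> hpoint q $ r = 0 \<Longrightarrow> local_eqn q r \<in> max_ideal q"
  using max_ideal_divide_eqn[of r q "local_eqn q r"] by (simp add: local_eqn_nonzero)

text \<open>A linear relation between three linear forms in two variables.\<close>

lemma pluecker:
  "kconst (minor r m) * hcoord a b n - kconst (minor r n) * hcoord a b m = kconst (minor n m) * hcoord a b r"
proof -
  have "minor r m * a $ n - minor r n * a $ m = minor n m * a $ r"
    "minor r m * b $ n - minor r n * b $ m = minor n m * b $ r"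
    by (simp_all add: minor_def algebra_simps)
  then have "kconst (minor r m * a $ n - minor r n * a $ m) +
      kconst (minor r m * b $ n - minor r n * b $ m) * Fract [:0, 1:] 1 =
      kconst (minor n m * a $ r) + kconst (minor n m * b $ r) * Fract [:0, 1:] 1"
    by (simp only:)
  then show ?thesis unfolding hcoord_linear by (simp add: algebra_simps)
qed

lemma pluecker_local_eqn:
  "kconst (minor r m) * local_eqn q n - kconst (minor r n) * local_eqn q m = kconst (minor n m) * local_eqn q r"
  using arg_cong[OF pluecker, of "\<lambda>x. x * trivialization q" r m n] by (simp add: local_eqn_def algebra_simps)

lemma pluecker_hpoint: "minor r m * hpoint q $ n - minor r n * hpoint q $ m = minor n m * hpoint q $ r"
  by (cases q) (simp_all add: minor_def algebra_simps)

text \<open>By the Pluecker relation, \<open>X\<^sub>n/X\<^sub>m\<close> minus its value at the zero \<open>q\<close> of \<open>X\<^sub>r\<close> is a constant multiple of \<open>X\<^sub>r/X\<^sub>m\<close>,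
hence a local coordinate at \<open>q\<close>. The restricted quartic has a simple zero at this value, so
it is a local coordinate as well.\<close>

lemma edge_poly_local_coordinate:
  assumes d: "distinct [i, r, n, m]" and r: "hpoint q $ r = 0"
  defines "\<rho> \<equiv> hcoord a b n / hcoord a b m"
  shows "local_unit q \<rho>" "local_unit q (kpoly (pderiv (edge_poly f n m)) \<rho>)"
    "\<exists>w. local_unit q w \<and> kpoly (edge_poly f n m) \<rho> = uniformizer q * w"
proof -
  have n: "hpoint q $ n \<noteq> 0" and m: "hpoint q $ m \<noteq> 0"
    using avoids_vertices[of r n q] avoids_vertices[of r m q] d r by auto
  have \<rho>: "\<rho> = local_eqn q n / local_eqn q m" unfolding \<rho>_def by (rule hcoord_divide)
  then show u: "local_unit q \<rho>" using n m by (simp add: local_unit_divide local_eqn_unit)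
  define c where "c = minor r n / minor r m"
  have nz: "minor r m \<noteq> 0" "minor n m \<noteq> 0"
    using minor_nonzero[of r m] minor_nonzero[of n m] d by auto
  obtain e where e: "e \<noteq> 0" "local_eqn q r = uniformizer q * kconst e"
    using local_eqn_uniformizer[of r q] d r by auto
  have "\<rho> - kconst c = (kconst (minor r m) * local_eqn q n - kconst (minor r n) * local_eqn q m) / (kconst (minor r m) * local_eqn q m)"
  proof -
    have "kconst c = kconst (minor r n) / kconst (minor r m)"
      by (simp only: c_def kconst_divide)
    moreover have "N / E - S / M = (M * N - S * E) / (M * E)" if "E \<noteq> 0" "M \<noteq> 0" for N E S M :: K
      using that by (simp add: field_simps)
    moreover have "m \<noteq> i" using d by auto
    ultimately show ?thesis
      using nz local_eqn_nonzero[of m q] by (simp add: \<rho>)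
  qed
  also have "\<dots> = uniformizer q * (kconst (minor n m) * kconst e / (kconst (minor r m) * local_eqn q m))"
    unfolding pluecker_local_eqn e by simp
  finally have \<rho>c: "\<rho> - kconst c = uniformizer q * (kconst (minor n m) * kconst e / (kconst (minor r m) * local_eqn q m))" .
  have unit: "local_unit q (kconst (minor n m) * kconst e / (kconst (minor r m) * local_eqn q m))"
    using nz e m by (intro local_unit_divide local_unit_mult) (simp_all add: local_unit_const local_eqn_unit)
  have "c = hpoint q $ n / hpoint q $ m"
    using pluecker_hpoint[of r m q n] nz m r by (simp add: c_def field_simps)
  moreover have "quartic f (hpoint q) = 0"
    using line_map_sing[of r q] d r unfolding line_map_hpoint sing_set_iff[OF hpoint_nonzero] by auto
  moreover have "hpoint q $ t = 0" if "t \<noteq> n" "t \<noteq> m" for t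
    using distinct4_UNIV[OF d, of t] that r hpoint_i by auto
  ultimately have root: "poly (edge_poly f n m) c = 0"
    using quartic_edge_poly[of n m "hpoint q" f] d m by simp
  have simple: "poly (pderiv (edge_poly f n m)) c \<noteq> 0"
    using d by (intro edge_poly_simple_root[OF card_sing vertex_not_singular _ root]) auto
  have \<rho>O: "\<rho> \<in> local_ring q" using u by (simp add: local_unit_def)
  show "local_unit q (kpoly (pderiv (edge_poly f n m)) \<rho>)"
    "\<exists>w. local_unit q w \<and> kpoly (edge_poly f n m) \<rho> = uniformizer q * w"
    using kpoly_simple_root[OF \<rho>O \<rho>c unit root simple] by blast+
qed

abbreviation B :: "P1 \<Rightarrow> (K \<times> K) set" where
  "B \<equiv> central_log_tangent f a b i j k"

abbreviation A :: "P1 \<Rightarrow> (K \<times> K) set" where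
  "A \<equiv> line_log_tangent a b j k l"

lemma char_deriv_eqn:
  "char_deriv a b j k v r m = (weight j k v r - weight j k v m) * (local_eqn q r / local_eqn q m)"
  by (simp add: char_deriv_def hcoord_divide[of r m q])

lemma weight_simps [simp]:
  "weight j k v j = fst v" "weight j k v k = snd v" "weight j k v l = 0" "weight j k v i = 0"
  using coords by (auto simp: weight_def)

lemma central_log_tangent_generic:
  assumes "\<And>r. r \<noteq> i \<Longrightarrow> hpoint q $ r \<noteq> 0"
  shows "v \<in> B q \<longleftrightarrow> fst v \<in> local_ring q \<and> snd v \<in> local_ring q"
proof -
  have u: "local_unit q (local_eqn q r / local_eqn q m)" if "r \<noteq> i" "m \<noteq> i" for r m
    using that assms by (intro local_unit_divide local_eqn_unit)
  have "v \<in> B q \<longleftrightarrow> v \<in> plane_tangent a b j k q"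
    unfolding central_log_tangent_def line_map_plane using assms by auto
  also have "\<dots> \<longleftrightarrow> (\<forall>r m. m \<noteq> i \<longrightarrow> r \<noteq> i \<longrightarrow> weight j k v r - weight j k v m \<in> local_ring q)"
  proof -
    have "char_deriv a b j k v r m \<in> local_ring q \<longleftrightarrow>
        (r \<noteq> i \<longrightarrow> weight j k v r - weight j k v m \<in> local_ring q)" if "m \<noteq> i" for r m
    proof (cases "r = i")
      case True
      then show ?thesis by (simp add: char_deriv_def hcoord_i)
    next
      case False
      then show ?thesis
        unfolding char_deriv_eqn[of v r m q] using local_unit_cancel(2)[OF u] that by simp
    qed
    moreover have "hpoint q $ m \<noteq> 0 \<longleftrightarrow> m \<noteq> i" for m
      using assms[of m] hpoint_i[of q] by metis
    ultimately show ?thesis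
      unfolding plane_tangent_def line_map_plane by simp
  qed
  also have "\<dots> \<longleftrightarrow> fst v \<in> local_ring q \<and> snd v \<in> local_ring q"
  proof
    assume *: "\<forall>r m. m \<noteq> i \<longrightarrow> r \<noteq> i \<longrightarrow> weight j k v r - weight j k v m \<in> local_ring q"
    show "fst v \<in> local_ring q \<and> snd v \<in> local_ring q"
      using *[rule_format, of l j] *[rule_format, of l k] coords by auto
  next
    assume *: "fst v \<in> local_ring q \<and> snd v \<in> local_ring q"
    then have "weight j k v r \<in> local_ring q" for r by (simp add: weight_def)
    then show "\<forall>r m. m \<noteq> i \<longrightarrow> r \<noteq> i \<longrightarrow> weight j k v r - weight j k v m \<in> local_ring q"
      by simp
  qed
  finally show ?thesis .
qed

text \<open>The condition for \<open>X\<close> says that the derivation is logarithmic along \<open>X\<^sub>r = 0\<close>. In the condition for \<open>Z\<close> the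
coefficient of the derivative is a unit and \<open>Z\<close> is a local coordinate, so it says that the
component along the coordinate line vanishes.\<close>

lemma central_log_tangent_special:
  assumes d: "distinct [i, r, n, m]" and r: "hpoint q $ r = 0"
  shows "v \<in> B q \<longleftrightarrow> weight j k v r - weight j k v m \<in> local_ring q \<and>
    weight j k v n - weight j k v m \<in> max_ideal q"
proof -
  let ?w = "weight j k v"
  have unit: "hpoint q $ t \<noteq> 0" if "t \<noteq> i" "t \<noteq> r" for t
    using avoids_vertices[of r t q] that d r by auto
  have edge: "(\<exists>\<delta>\<in>local_ring q. kpoly (pderiv (edge_poly f n' m')) (hcoord a b n' / hcoord a b m') * char_deriv a b j k v n' m'
      = \<delta> * kpoly (edge_poly f n' m') (hcoord a b n' / hcoord a b m')) \<longleftrightarrow> ?w n' - ?w m' \<in> max_ideal q"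
    if d': "distinct [i, r, n', m']" for n' m'
  proof -
    let ?\<rho> = "hcoord a b n' / hcoord a b m'"
    have u1: "local_unit q ?\<rho>" and u2: "local_unit q (kpoly (pderiv (edge_poly f n' m')) ?\<rho>)"
      using edge_poly_local_coordinate[OF d' r] by auto
    obtain w where w: "local_unit q w" "kpoly (edge_poly f n' m') ?\<rho> = uniformizer q * w"
      using edge_poly_local_coordinate(3)[OF d' r] by blast
    let ?u = "kpoly (pderiv (edge_poly f n' m')) ?\<rho> * ?\<rho> / w"
    have u: "local_unit q ?u" by (rule local_unit_divide[OF local_unit_mult[OF u2 u1] w(1)])
    have "w \<noteq> 0" using w by (simp add: local_unit_def)
    then have cancel: "P * (x * R) = \<delta> * (uniformizer q * w) \<longleftrightarrow> P * R / w * x = uniformizer q * \<delta>" for P R x \<delta>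
      by (simp add: field_simps)
    have "(\<exists>\<delta>\<in>local_ring q. kpoly (pderiv (edge_poly f n' m')) ?\<rho> * char_deriv a b j k v n' m'
        = \<delta> * kpoly (edge_poly f n' m') ?\<rho>) \<longleftrightarrow> (\<exists>\<delta>\<in>local_ring q. ?u * (?w n' - ?w m') = uniformizer q * \<delta>)"
      unfolding char_deriv_def w(2) cancel ..
    also have "\<dots> \<longleftrightarrow> ?u * (?w n' - ?w m') \<in> max_ideal q"
      unfolding max_ideal_eq by blast
    also have "\<dots> \<longleftrightarrow> ?w n' - ?w m' \<in> max_ideal q" by (rule local_unit_cancel(4)[OF u])
    finally show ?thesis .
  qed
  show ?thesis
  proof
    assume v: "v \<in> B q"
    have "line_map a b q \<in> sing_set f" using line_map_sing[of r q] d r by auto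
    moreover have "distinct [i, r, n, m] \<and> line_map a b q \<in> comp_plane r \<and> line_map a b q \<notin> comp_plane m"
      using d r unit[of m] by (auto simp: line_map_plane)
    ultimately have ex: "\<exists>\<delta>\<^sub>X\<in>local_ring q. \<exists>\<delta>\<^sub>Z\<in>local_ring q.
             char_deriv a b j k v r m = \<delta>\<^sub>X * (hcoord a b r / hcoord a b m) \<and>
             kpoly (pderiv (edge_poly f n m)) (hcoord a b n / hcoord a b m) * char_deriv a b j k v n m
             = \<delta>\<^sub>Z * kpoly (edge_poly f n m) (hcoord a b n / hcoord a b m)"
      using v unfolding central_log_tangent_def by blast
    then obtain \<delta> where \<delta>: "\<delta> \<in> local_ring q" "char_deriv a b j k v r m = \<delta> * (hcoord a b r / hcoord a b m)"
      by blast
    moreover have "hcoord a b r \<noteq> 0" "hcoord a b m \<noteq> 0"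
      using hcoord_nonzero(2)[of r] hcoord_nonzero(2)[of m] d by auto
    ultimately have "?w r - ?w m = \<delta>"
      by (simp add: char_deriv_def)
    moreover have "?w n - ?w m \<in> max_ideal q"
      using edge[OF d] ex by blast
    ultimately show "?w r - ?w m \<in> local_ring q \<and> ?w n - ?w m \<in> max_ideal q" using \<delta> by simp
  next
    assume w: "?w r - ?w m \<in> local_ring q \<and> ?w n - ?w m \<in> max_ideal q"
    then have nm: "?w n - ?w m \<in> local_ring q" by (auto intro: max_ideal_imp_local_ring)
    have base: "?w t - ?w m \<in> local_ring q" if "t \<noteq> i" for t
      using distinct4_UNIV[OF d, of t] that w nm by auto
    have diff: "?w t - ?w t' \<in> local_ring q" if "t \<noteq> i" "t' \<noteq> i" for t t'
      using local_ring_diff[OF base[OF that(1)] base[OF that(2)]] by simp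
    have "v \<in> plane_tangent a b j k q"
      unfolding plane_tangent_def line_map_plane
    proof (intro CollectI allI impI)
      fix t t' assume t': "hpoint q $ t' \<noteq> 0"
      then have "t' \<noteq> i" using hpoint_i by auto
      show "char_deriv a b j k v t t' \<in> local_ring q"
      proof (cases "t = i")
        case False
        then show ?thesis
          unfolding char_deriv_eqn[of v t t' q] using diff \<open>t' \<noteq> i\<close> local_unit_cancel(3)[OF local_eqn_unit[OF t']]
          by (intro local_ring_mult) auto
      qed (simp add: char_deriv_def hcoord_i)
    qed
    moreover have "\<exists>\<delta>\<^sub>X\<in>local_ring q. \<exists>\<delta>\<^sub>Z\<in>local_ring q.
             char_deriv a b j k v r' m' = \<delta>\<^sub>X * (hcoord a b r' / hcoord a b m') \<and>
             kpoly (pderiv (edge_poly f n' m')) (hcoord a b n' / hcoord a b m') * char_deriv a b j k v n' m'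
             = \<delta>\<^sub>Z * kpoly (edge_poly f n' m') (hcoord a b n' / hcoord a b m')"
      if d': "distinct [i, r', n', m']" and r': "hpoint q $ r' = 0" for r' n' m'
    proof -
      have "r' = r" using unit[of r'] r' d' by auto
      then have d'': "distinct [i, r, n', m']" using d' by simp
      have "n' = n \<and> m' = m \<or> n' = m \<and> m' = n"
        using distinct4_UNIV[OF d, of n'] distinct4_UNIV[OF d, of m'] d'' by auto
      then have "?w n' - ?w m' \<in> max_ideal q"
        using w max_ideal_uminus[of "?w n - ?w m" q] by auto
      then obtain \<delta>\<^sub>Z where "\<delta>\<^sub>Z \<in> local_ring q"
        "kpoly (pderiv (edge_poly f n' m')) (hcoord a b n' / hcoord a b m') * char_deriv a b j k v n' m'
             = \<delta>\<^sub>Z * kpoly (edge_poly f n' m') (hcoord a b n' / hcoord a b m')"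
        using edge[OF d''] by blast
      moreover have "?w r' - ?w m' \<in> local_ring q" using d' by (intro diff) auto
      moreover have "char_deriv a b j k v r' m' = (?w r' - ?w m') * (hcoord a b r' / hcoord a b m')"
        by (simp add: char_deriv_def)
      ultimately show ?thesis by blast
    qed
    ultimately show "v \<in> B q"
      unfolding central_log_tangent_def line_map_plane by blast
  qed
qed

end

context special_line
begin

text \<open>The components are the logarithmic derivatives of \<open>X\<^sub>k/X\<^sub>l\<close> and of \<open>X\<^sub>l/X\<^sub>j\<close> along the line; compare
\<open>kderiv_log\<close>.\<close>

definition \<eta>\<^sub>0 :: "K \<times> K" where
  "\<eta>\<^sub>0 = (kconst (minor k l) / (hcoord a b k * hcoord a b l),
     - (kconst (minor j l) / (hcoord a b j * hcoord a b l)))"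

definition \<sigma> :: "K \<Rightarrow> K \<times> K" where
  "\<sigma> h = (h * hcoord a b k * hcoord a b l / kconst (minor k l), 0)"

lemma distinct_coords: "j \<noteq> i" "k \<noteq> i" "l \<noteq> i" "j \<noteq> k" "j \<noteq> l" "k \<noteq> l" "k \<noteq> j" "l \<noteq> j" "l \<noteq> k"
  "i \<noteq> j" "i \<noteq> k" "i \<noteq> l"
  using coords by auto

lemma minors_nonzero: "minor j k \<noteq> 0" "minor j l \<noteq> 0" "minor k l \<noteq> 0"
  by (intro minor_nonzero distinct_coords)+

lemma hcoords_nonzero: "hcoord a b j \<noteq> 0" "hcoord a b k \<noteq> 0" "hcoord a b l \<noteq> 0"
  by (intro hcoord_nonzero(2) distinct_coords)+

lemma local_eqns_nonzero: "local_eqn q j \<noteq> 0" "local_eqn q k \<noteq> 0" "local_eqn q l \<noteq> 0"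
  by (intro local_eqn_nonzero distinct_coords)+

lemma position_cases:
  obtains (generic) "local_unit q (local_eqn q j)" "local_unit q (local_eqn q k)" "local_unit q (local_eqn q l)"
      "\<And>r. r \<noteq> i \<Longrightarrow> hpoint q $ r \<noteq> 0"
  | (j) "hpoint q $ j = 0" "local_unit q (local_eqn q k)" "local_unit q (local_eqn q l)"
  | (k) "hpoint q $ k = 0" "local_unit q (local_eqn q j)" "local_unit q (local_eqn q l)"
  | (l) "hpoint q $ l = 0" "local_unit q (local_eqn q j)" "local_unit q (local_eqn q k)"
proof -
  note av = avoids_vertices[of j k q] avoids_vertices[of j l q] avoids_vertices[of k l q]
  consider "hpoint q $ j = 0" | "hpoint q $ k = 0" | "hpoint q $ l = 0"
    | "hpoint q $ j \<noteq> 0" "hpoint q $ k \<noteq> 0" "hpoint q $ l \<noteq> 0" by blast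
  then show ?thesis
  proof cases
    case 1
    then show ?thesis using av distinct_coords by (intro that(2) local_eqn_unit) auto
  next
    case 2
    then show ?thesis using av distinct_coords by (intro that(3) local_eqn_unit) auto
  next
    case 3
    then show ?thesis using av distinct_coords by (intro that(4) local_eqn_unit) auto
  next
    case 4
    then have "hpoint q $ r \<noteq> 0" if "r \<noteq> i" for r using coord_cases[of r] that by auto
    with 4 show ?thesis by (intro that(1) local_eqn_unit) auto
  qed
qed

lemma central_log_tangent_j: "hpoint q $ j = 0 \<Longrightarrow> v \<in> B q \<longleftrightarrow> fst v \<in> local_ring q \<and> snd v \<in> max_ideal q"
  using central_log_tangent_special[of j k l q v] distinct_coords by simp

lemma central_log_tangent_k: "hpoint q $ k = 0 \<Longrightarrow> v \<in> B q \<longleftrightarrow> snd v \<in> local_ring q \<and> fst v \<in> max_ideal q"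
  using central_log_tangent_special[of k j l q v] distinct_coords by simp

lemma central_log_tangent_l: "hpoint q $ l = 0 \<Longrightarrow> v \<in> B q \<longleftrightarrow> snd v \<in> local_ring q \<and> fst v - snd v \<in> max_ideal q"
  using central_log_tangent_special[of l j k q v] distinct_coords local_ring_uminus[of "snd v" q]
    local_ring_uminus[of "- snd v" q] by auto

lemma central_log_tangent_add: "v \<in> B q \<Longrightarrow> w \<in> B q \<Longrightarrow> v + w \<in> B q"
proof (cases q rule: position_cases)
  case l
  assume "v \<in> B q" "w \<in> B q"
  then have "snd v \<in> local_ring q" "snd w \<in> local_ring q" "(fst v - snd v) + (fst w - snd w) \<in> max_ideal q"
    by (simp_all only: central_log_tangent_l[OF l(1)] max_ideal_add)
  then show ?thesis by (simp add: central_log_tangent_l[OF l(1)] add_diff_add)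
qed (simp_all add: central_log_tangent_generic central_log_tangent_j central_log_tangent_k)

lemma central_log_tangent_mult: "r \<in> local_ring q \<Longrightarrow> v \<in> B q \<Longrightarrow> pair_mult r v \<in> B q"
proof (cases q rule: position_cases)
  case l
  assume r: "r \<in> local_ring q" and "v \<in> B q"
  then have "snd v \<in> local_ring q" "r * (fst v - snd v) \<in> max_ideal q"
    by (simp_all only: central_log_tangent_l[OF l(1)] max_ideal_mult(2))
  then show ?thesis using r by (simp add: central_log_tangent_l[OF l(1)] right_diff_distrib)
qed (simp_all add: central_log_tangent_generic central_log_tangent_j central_log_tangent_k)

lemma \<eta>\<^sub>0_eqn: "pairing \<eta>\<^sub>0 v / trivialization q ^ 2 =
    kconst (minor k l) * fst v / (local_eqn q k * local_eqn q l) - kconst (minor j l) * snd v / (local_eqn q j * local_eqn q l)"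
  using trivialization_nonzero[of q] hcoords_nonzero
  by (simp add: \<eta>\<^sub>0_def pairing_def local_eqn_def power2_eq_square field_simps)

text \<open>In terms of the local equations, \<open>\<eta>\<^sub>0\<close> has a simple pole at each of the three special points. At the zeros
of \<open>X\<^sub>j\<close> and \<open>X\<^sub>k\<close> only one component has a pole, and it is paired with a component that vanishes. At the
zero of \<open>X\<^sub>l\<close> both have poles, but by the Pluecker relation the polar part only sees the
difference \<open>v\<^sub>1 - v\<^sub>2\<close>, which vanishes there.\<close>

lemma pairing_central:
  assumes "v \<in> B q"
  shows "pairing \<eta>\<^sub>0 v \<in> canonical q"
proof -
  have div: "x / (y * z) \<in> local_ring q" if "x / y \<in> local_ring q" "local_unit q z" for x y z
    using local_unit_cancel(3)[OF that(2), of "x / y"] that(1) by (simp add: divide_divide_eq_left)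
  have "kconst (minor k l) * fst v / (local_eqn q k * local_eqn q l) - kconst (minor j l) * snd v / (local_eqn q j * local_eqn q l) \<in> local_ring q"
  proof (cases q rule: position_cases)
    case generic
    then have "fst v \<in> local_ring q" "snd v \<in> local_ring q"
      using assms central_log_tangent_generic by auto
    with generic show ?thesis by (intro local_ring_diff div) (simp_all add: local_unit_cancel)
  next
    case j
    then have v: "fst v \<in> local_ring q" "snd v \<in> max_ideal q" using assms central_log_tangent_j by auto
    then have "kconst (minor j l) * snd v / local_eqn q j \<in> local_ring q"
      unfolding max_ideal_divide_eqn[OF distinct_coords(1) j(1)] by simp
    with v j show ?thesis by (intro local_ring_diff div) (simp_all add: local_unit_cancel)
  next
    case k
    then have v: "snd v \<in> local_ring q" "fst v \<in> max_ideal q" using assms central_log_tangent_k by auto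
    then have "kconst (minor k l) * fst v / local_eqn q k \<in> local_ring q"
      unfolding max_ideal_divide_eqn[OF distinct_coords(2) k(1)] by simp
    with v k show ?thesis by (intro local_ring_diff div) (simp_all add: local_unit_cancel)
  next
    case l
    then have v: "snd v \<in> local_ring q" "fst v - snd v \<in> max_ideal q" using assms central_log_tangent_l by auto
    then have *: "kconst (minor k l) * (fst v - snd v) / local_eqn q l \<in> local_ring q"
      unfolding max_ideal_divide_eqn[OF distinct_coords(3) l(1)] by simp
    have "kconst (minor j l) * local_eqn q k - kconst (minor k l) * local_eqn q j = kconst (minor j k) * local_eqn q l"
      using pluecker_local_eqn[of l k q j] by (simp add: minor_antisym[of l])
    then have p: "kconst (minor k l) * local_eqn q j - kconst (minor j l) * local_eqn q k = - (kconst (minor j k) * local_eqn q l)"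
      by (metis minus_diff_eq)
    have "kconst (minor k l) * fst v / (local_eqn q k * local_eqn q l) - kconst (minor j l) * snd v / (local_eqn q j * local_eqn q l) =
        kconst (minor k l) * (fst v - snd v) / (local_eqn q l * local_eqn q k) +
        (kconst (minor k l) * local_eqn q j - kconst (minor j l) * local_eqn q k) * snd v / (local_eqn q j * local_eqn q k * local_eqn q l)"
      using local_eqns_nonzero[of q] by (simp add: field_simps)
    also have "\<dots> = kconst (minor k l) * (fst v - snd v) / (local_eqn q l * local_eqn q k) +
        - kconst (minor j k) * snd v / (local_eqn q j * local_eqn q k)"
      unfolding p using local_eqns_nonzero[of q] by simp
    also have "\<dots> \<in> local_ring q"
      using * v l by (intro local_ring_add div) (simp_all add: local_unit_cancel)
    finally show ?thesis .
  qed
  then show ?thesis unfolding canonical_eq \<eta>\<^sub>0_eqn[symmetric] by simp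
qed

text \<open>The factors \<open>X\<^sub>k\<close> and \<open>X\<^sub>l\<close> supply the vanishing that is required at their zeros; at the zero of \<open>X\<^sub>j\<close> the
second component has to vanish, and it is \<open>0\<close>.\<close>

lemma \<sigma>_central:
  assumes "h \<in> canonical q"
  shows "\<sigma> h \<in> B q"
proof -
  define g where "g = h / trivialization q ^ 2"
  have g: "g \<in> local_ring q" using assms by (simp add: canonical_eq g_def)
  have inv: "inverse (kconst (minor k l)) \<in> local_ring q" unfolding inverse_kconst by simp
  have \<sigma>: "fst (\<sigma> h) = inverse (kconst (minor k l)) * g * (local_eqn q k * local_eqn q l)" "snd (\<sigma> h) = 0"
  proof -
    have "local_eqn q k * local_eqn q l = hcoord a b k * hcoord a b l * trivialization q ^ 2"
      by (simp add: local_eqn_def power2_eq_square mult_ac)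
    then show "fst (\<sigma> h) = inverse (kconst (minor k l)) * g * (local_eqn q k * local_eqn q l)" "snd (\<sigma> h) = 0"
      by (simp_all add: \<sigma>_def g_def divide_inverse)
  qed
  show ?thesis
  proof (cases q rule: position_cases)
    case generic
    then show ?thesis using g inv by (simp add: central_log_tangent_generic \<sigma>)
  next
    case j
    then show ?thesis using g inv by (simp add: central_log_tangent_j \<sigma>)
  next
    case k
    have "local_eqn q k * local_eqn q l \<in> max_ideal q"
      using local_eqn_max_ideal[OF distinct_coords(2) k(1)] by simp
    then show ?thesis using k g inv by (simp add: central_log_tangent_k \<sigma>)
  next
    case l
    have "local_eqn q k * local_eqn q l \<in> max_ideal q"
      using local_eqn_max_ideal[OF distinct_coords(3) l(1)] by simp
    then show ?thesis using l g inv by (simp add: central_log_tangent_l \<sigma>)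
  qed
qed

lemma pairing_\<sigma>: "pairing \<eta>\<^sub>0 (\<sigma> h) = h"
  using hcoords_nonzero minors_nonzero by (simp add: pairing_def \<eta>\<^sub>0_def \<sigma>_def)

lemma kderiv_log:
  assumes "r \<noteq> i" "m \<noteq> i"
  shows "kderiv (hcoord a b r / hcoord a b m) / (hcoord a b r / hcoord a b m) =
    kconst (minor r m) / (hcoord a b r * hcoord a b m)"
proof -
  let ?p = "[:a $ r, b $ r:]" and ?q = "[:a $ m, b $ m:]"
  have nz: "?p \<noteq> 0" "?q \<noteq> 0" using hcoord_nonzero(1) assms by blast+
  have "hcoord a b r / hcoord a b m = Fract ?p ?q" by (simp add: hcoord_def divide_fract)
  moreover have "pderiv ?p * ?q - ?p * pderiv ?q = [:minor r m:]"
    by (simp add: pderiv_pCons minor_def algebra_simps)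
  ultimately have "kderiv (hcoord a b r / hcoord a b m) / (hcoord a b r / hcoord a b m) =
      Fract [:minor r m:] (?q * ?q) / Fract ?p ?q"
    using kderiv_Fract[OF nz(2), of ?p] by simp
  also have "\<dots> = Fract ([:minor r m:] * ?q) (?q * ?q * ?p)"
    by (simp only: divide_fract)
  also have "\<dots> = Fract [:minor r m:] (?p * ?q)"
    by (rule eq_fract(1)[THEN iffD2]) (use nz in \<open>simp_all only: mult_eq_0_iff de_Morgan_disj not_False_eq_True simp_thms mult_ac\<close>)
  also have "\<dots> = kconst (minor r m) / (hcoord a b r * hcoord a b m)"
    by (simp add: hcoord_def fract_arith)
  finally show ?thesis .
qed

lemma differential_eq: "differential a b j k l g =
    (g * kconst (minor j l) / (hcoord a b j * hcoord a b l), g * kconst (minor k l) / (hcoord a b k * hcoord a b l))"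
proof -
  have e: "g * kderiv x / x = g * (kderiv x / x)" for x by simp
  show ?thesis
    unfolding differential_def Let_def e kderiv_log[OF distinct_coords(1,3)] kderiv_log[OF distinct_coords(2,3)] by simp
qed

lemma differential_eqn:
  "fst (differential a b j k l g) = (g * trivialization q ^ 2) * (kconst (minor j l) / (local_eqn q j * local_eqn q l))"
  "snd (differential a b j k l g) = (g * trivialization q ^ 2) * (kconst (minor k l) / (local_eqn q k * local_eqn q l))"
  using trivialization_nonzero[of q] by (simp_all add: differential_eq local_eqn_def power2_eq_square)

lemma pairing_differential: "pairing \<eta>\<^sub>0 (differential a b j k l g) = 0"
  by (simp add: pairing_def \<eta>\<^sub>0_def differential_eq mult_ac)

text \<open>The differential of the line has simple poles at the special points, in the basis \<open>e\<^sub>1, e\<^sub>2\<close>;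
they are cancelled by the zeros of a log vector field. At the zero of \<open>X\<^sub>j\<close> only the first component
has a pole, so the second one vanishes there after multiplication, as is required; the zero of \<open>X\<^sub>k\<close> is
symmetric, and at the zero of \<open>X\<^sub>l\<close> the poles of the two components cancel in the difference.\<close>

lemma differential_central:
  assumes "g \<in> log_tangent {p. line_map a b p \<in> coord_lines} q"
  shows "differential a b j k l g \<in> B q"
proof -
  define h where "h = g * trivialization q ^ 2"
  have h: "h \<in> (if \<exists>r. r \<noteq> i \<and> hpoint q $ r = 0 then max_ideal q else local_ring q)"
    using assms unfolding log_tangent_eq h_def line_map_coord_lines by simp
  have div: "kconst c / (x * y) \<in> local_ring q" if "local_unit q x" "local_unit q y" for c x y
    using local_unit_cancel(3)[OF local_unit_mult[OF that], of "kconst c"] by simp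
  have 1: "x / y * z \<in> local_ring q" if "x \<in> max_ideal q" "hpoint q $ r = 0" "r \<noteq> i" "y = local_eqn q r" "z \<in> local_ring q" for x y z r
    using that max_ideal_divide_eqn by (intro local_ring_mult) auto
  note d = differential_eqn[of g q, folded h_def]
  show ?thesis
  proof (cases q rule: position_cases)
    case generic
    then have "\<not> (\<exists>r. r \<noteq> i \<and> hpoint q $ r = 0)" by blast
    then have "h \<in> local_ring q" using h by (simp only: if_False)
    moreover have "v \<in> B q \<longleftrightarrow> fst v \<in> local_ring q \<and> snd v \<in> local_ring q" for v
      by (rule central_log_tangent_generic) (rule generic(4))
    ultimately show ?thesis
      using generic(1-3) by (simp only: d) (intro conjI local_ring_mult div)
  next
    case j
    then have h: "h \<in> max_ideal q" using h distinct_coords(1) by (auto split: if_splits)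
    have "h * (kconst (minor j l) / (local_eqn q j * local_eqn q l)) = h / local_eqn q j * (kconst (minor j l) / (local_eqn q l * 1))" by simp
    also have "\<dots> \<in> local_ring q"
      using j by (intro 1[OF h j(1) distinct_coords(1)] div) (simp_all add: local_unit_def)
    finally show ?thesis
      using max_ideal_mult(1)[OF h div[OF j(2,3)], of "minor k l"] by (simp add: central_log_tangent_j[OF j(1)] d)
  next
    case k
    then have h: "h \<in> max_ideal q" using h distinct_coords(2) by (auto split: if_splits)
    have "h * (kconst (minor k l) / (local_eqn q k * local_eqn q l)) = h / local_eqn q k * (kconst (minor k l) / (local_eqn q l * 1))" by simp
    also have "\<dots> \<in> local_ring q"
      using k by (intro 1[OF h k(1) distinct_coords(2)] div) (simp_all add: local_unit_def)
    finally show ?thesis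
      using max_ideal_mult(1)[OF h div[OF k(2,3)], of "minor j l"] by (simp add: central_log_tangent_k[OF k(1)] d)
  next
    case l
    then have h: "h \<in> max_ideal q" using h distinct_coords(3) by (auto split: if_splits)
    have "h * (kconst (minor k l) / (local_eqn q k * local_eqn q l)) = h / local_eqn q l * (kconst (minor k l) / (local_eqn q k * 1))" by simp
    also have "\<dots> \<in> local_ring q"
      using l by (intro 1[OF h l(1) distinct_coords(3)] div) (simp_all add: local_unit_def)
    finally have s: "h * (kconst (minor k l) / (local_eqn q k * local_eqn q l)) \<in> local_ring q" .
    have p: "kconst (minor j l) * local_eqn q k - kconst (minor k l) * local_eqn q j = kconst (minor j k) * local_eqn q l"
      using pluecker_local_eqn[of l k q j] by (simp add: minor_antisym[of l])
    have "h * (kconst (minor j l) / (local_eqn q j * local_eqn q l)) - h * (kconst (minor k l) / (local_eqn q k * local_eqn q l)) =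
        h * (kconst (minor j l) * local_eqn q k - kconst (minor k l) * local_eqn q j) / (local_eqn q j * local_eqn q k * local_eqn q l)"
      using local_eqns_nonzero[of q] by (simp add: field_simps)
    also have "\<dots> = h * (kconst (minor j k) / (local_eqn q j * local_eqn q k))"
      unfolding p using local_eqns_nonzero[of q] by simp
    also have "\<dots> \<in> max_ideal q" using l by (intro max_ideal_mult h div)
    finally show ?thesis using l s by (simp add: central_log_tangent_l d)
  qed
qed

lemma line_log_tangent_eq: "A q = {v \<in> B q. pairing \<eta>\<^sub>0 v = 0}"
proof (intro equalityI subsetI)
  fix v assume "v \<in> A q"
  then show "v \<in> {v \<in> B q. pairing \<eta>\<^sub>0 v = 0}"
    unfolding line_log_tangent_def using differential_central pairing_differential by auto
next
  fix v assume v: "v \<in> {v \<in> B q. pairing \<eta>\<^sub>0 v = 0}"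
  \<comment> \<open>The kernel of \<open>\<eta>\<^sub>0\<close> is spanned by the differential, so the first component determines \<open>g\<close>.\<close>
  define g where "g = fst v * hcoord a b j * hcoord a b l / kconst (minor j l)"
  have "snd v * kconst (minor j l) * hcoord a b k = fst v * kconst (minor k l) * hcoord a b j"
    using v hcoords_nonzero by (simp add: pairing_def \<eta>\<^sub>0_def field_simps)
  then have "snd v = fst v * kconst (minor k l) * hcoord a b j / (kconst (minor j l) * hcoord a b k)"
    using minors_nonzero hcoords_nonzero by (simp add: field_simps)
  then have "v = differential a b j k l g"
    using minors_nonzero hcoords_nonzero by (simp add: differential_eq g_def prod_eq_iff)
  moreover have "g \<in> log_tangent {p. line_map a b p \<in> coord_lines} q"
  proof -
    have inv: "inverse (kconst (minor j l)) \<in> local_ring q" unfolding inverse_kconst by simp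
    have e: "g * trivialization q ^ 2 = fst v * local_eqn q j * local_eqn q l * inverse (kconst (minor j l))"
      by (simp add: g_def local_eqn_def power2_eq_square divide_inverse)
    have "fst v * local_eqn q j * local_eqn q l \<in> (if \<exists>r. r \<noteq> i \<and> hpoint q $ r = 0 then max_ideal q else local_ring q)"
    proof (cases q rule: position_cases)
      case generic
      then have "\<not> (\<exists>r. r \<noteq> i \<and> hpoint q $ r = 0)" by blast
      then show ?thesis
        unfolding if_not_P[OF \<open>\<not> (\<exists>r. r \<noteq> i \<and> hpoint q $ r = 0)\<close>]
        using v generic by (simp add: central_log_tangent_generic)
    next
      case j
      then have "\<exists>r. r \<noteq> i \<and> hpoint q $ r = 0" using distinct_coords(1) by blast
      moreover have "fst v * local_eqn q j \<in> max_ideal q"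
        using v j local_eqn_max_ideal[OF distinct_coords(1) j(1)] by (simp add: central_log_tangent_j)
      ultimately show ?thesis by simp
    next
      case k
      then have "\<exists>r. r \<noteq> i \<and> hpoint q $ r = 0" using distinct_coords(2) by blast
      moreover have "fst v * local_eqn q j \<in> max_ideal q"
        using v k by (simp add: central_log_tangent_k)
      ultimately show ?thesis by simp
    next
      case l
      then have "\<exists>r. r \<noteq> i \<and> hpoint q $ r = 0" using distinct_coords(3) by blast
      moreover have "fst v \<in> local_ring q"
        using v l local_ring_add[of "fst v - snd v" q "snd v"] max_ideal_imp_local_ring[of "fst v - snd v" q]
        by (simp add: central_log_tangent_l)
      ultimately show ?thesis
        using local_eqn_max_ideal[OF distinct_coords(3) l(1)] by simp
    qed
    then show ?thesis
      unfolding log_tangent_eq e line_map_coord_lines mem_Collect_eq using inv by (auto split: if_splits)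
  qed
  ultimately show "v \<in> A q" unfolding line_log_tangent_def by blast
qed

sublocale canonical_quotient A B \<eta>\<^sub>0 \<sigma>
proof
  fix h h' r
  show "\<sigma> (h + h') = \<sigma> h + \<sigma> h'" by (simp add: \<sigma>_def add_divide_distrib distrib_right)
  show "\<sigma> (r * h) = pair_mult r (\<sigma> h)" by (simp add: \<sigma>_def pair_mult_def mult.assoc)
qed (use pairing_\<sigma> central_log_tangent_add central_log_tangent_mult pairing_central \<sigma>_central
      line_log_tangent_eq in blast)+

lemma line_log_tangent_nonzero: "\<exists>v\<in>A q. v \<noteq> 0"
proof -
  define g where "g = uniformizer q / trivialization q ^ 2"
  have "g \<in> log_tangent {p. line_map a b p \<in> coord_lines} q" by (simp add: log_tangent_eq g_def)
  moreover have "differential a b j k l g \<noteq> 0"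
    using hcoords_nonzero minors_nonzero by (simp add: differential_eq zero_prod_def g_def)
  ultimately show ?thesis unfolding line_log_tangent_def by blast
qed

text \<open>The logarithmic derivative of a linear form has residue \<open>1\<close> at its zero and \<open>- 1\<close> at infinity. If the zero
is at infinity, the linear form is constant in \<open>s\<close>, and the two contributions cancel.\<close>

lemma residue_dlog:
  assumes "r \<noteq> i"
  shows "form_residue q (kconst (b $ r) / hcoord a b r) = of_bool (hpoint q $ r = 0) - of_bool (q = Infty)"
proof (cases "b $ r = 0")
  case True
  then have "a $ r \<noteq> 0" using hcoord_nonzero(1)[OF assms] by auto
  then have "hpoint q $ r = 0 \<longleftrightarrow> q = Infty" using True by (cases q) auto
  then show ?thesis by (simp add: True del: form_residue.simps)
next
  case False
  define s where "s = - (a $ r / b $ r)"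
  have "kconst (b $ r) / hcoord a b r = simple_fraction s (Suc 0)"
    using False by (simp add: hcoord_def divide_fract eq_fract s_def)
  moreover have "hpoint q $ r = 0 \<longleftrightarrow> q = Aff s"
  proof (cases q)
    case (Aff t)
    have "a $ r + t * b $ r = (t - s) * b $ r" using False by (simp add: s_def algebra_simps)
    then show ?thesis using False by (simp add: Aff)
  qed (use False in simp)
  moreover have "form_residue q (simple_fraction s (Suc 0)) = of_bool (q = Aff s) - of_bool (q = Infty)"
    by (cases q) (simp_all only: form_residue_simple_fraction, auto)
  ultimately show ?thesis by simp
qed

lemma dlog_difference:
  assumes "r \<noteq> i" "m \<noteq> i"
  shows "kconst (minor r m) / (hcoord a b r * hcoord a b m) =
    kconst (b $ r) / hcoord a b r - kconst (b $ m) / hcoord a b m"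
proof -
  have "kconst (minor r m) = kconst (b $ r) * hcoord a b m - kconst (b $ m) * hcoord a b r"
    unfolding hcoord_linear by (simp add: minor_def algebra_simps)
  then show ?thesis using hcoord_nonzero(2) assms by (simp add: field_simps)
qed

lemma residue_vec_\<eta>\<^sub>0:
  "residue_vec q (pair_mult (kconst c) \<eta>\<^sub>0) =
    (c * (of_bool (hpoint q $ k = 0) - of_bool (hpoint q $ l = 0)), - (c * (of_bool (hpoint q $ j = 0) - of_bool (hpoint q $ l = 0))))"
  unfolding residue_vec_def pair_mult_simps \<eta>\<^sub>0_def fst_conv snd_conv
    dlog_difference[OF distinct_coords(2,3)] dlog_difference[OF distinct_coords(1,3)]
    form_residue_kconst_mult form_residue_uminus form_residue_diff
    residue_dlog[OF distinct_coords(1)] residue_dlog[OF distinct_coords(2)] residue_dlog[OF distinct_coords(3)]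
  by simp

lemma log_normal_sheaf_eq: "log_normal_sheaf f a b i j k l = F"
  by (simp add: log_normal_sheaf_def)

lemma H0_eq: "H0_dual_normal_canonical f a b i j k l =
    lin_mod (\<lambda>c. pair_mult (kconst c)) (\<Inter>q. twisted_dual_stalk q)"
  by (simp add: H0_dual_normal_canonical_def dual_normal_canonical_def twisted_dual_stalk_def
      dual_normal_def dual_stalk_def)

end

theorem theorem15:
  fixes f :: "(4 \<Rightarrow> nat) \<Rightarrow> complex" and i j k l :: 4
    and a b :: "complex ^ 4" and p1 p2 p3 :: P1
  assumes coords: "distinct [i, j, k, l]"
    and generic: "generic_quartic f i"
    and in_plane: "a $ i = 0" "b $ i = 0"
    and embedding: "\<And>\<alpha> \<beta>. \<alpha> *s a + \<beta> *s b = 0 \<Longrightarrow> \<alpha> = 0 \<and> \<beta> = 0"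
    and star: "range (line_map a b) \<inter> coord_lines \<subseteq> sing_set f"
    and p1: "line_map a b p1 \<in> comp_plane j"
    and p2: "line_map a b p2 \<in> comp_plane k"
    and p3: "line_map a b p3 \<in> comp_plane l"
  shows "(\<exists>h. linear_iso (H1 zariski (log_normal_sheaf f a b i j k l)) complex_line h) \<and>
    linear_iso (H0_dual_normal_canonical f a b i j k l) (dual_space (H1 zariski (log_normal_sheaf f a b i j k l)))
      (serre_map (log_normal_sheaf f a b i j k l)) \<and>
    linear_iso (H0_dual_normal_canonical f a b i j k l) residue_triples
      (\<lambda>\<eta>. (residue_vec p2 \<eta>, residue_vec p1 \<eta>, residue_vec p3 \<eta>))"
proof -
  interpret special_line f a b i j k l
    by unfold_locales (fact coords generic in_plane embedding star)+
  have H0: "line_coord (H0_dual_normal_canonical f a b i j k l) (\<lambda>c. pair_mult (kconst c) \<eta>\<^sub>0)"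
    unfolding H0_eq by (rule line_coord_global_sections[OF line_log_tangent_nonzero])
  have z: "hpoint p1 $ j = 0" "hpoint p2 $ k = 0" "hpoint p3 $ l = 0"
    using p1 p2 p3 by (simp_all add: line_map_plane)
  have nz: "hpoint p1 $ k \<noteq> 0" "hpoint p1 $ l \<noteq> 0" "hpoint p2 $ j \<noteq> 0" "hpoint p2 $ l \<noteq> 0" "hpoint p3 $ j \<noteq> 0" "hpoint p3 $ k \<noteq> 0"
    using z avoids_vertices distinct_coords by blast+
  have "(residue_vec p2 \<eta>, residue_vec p1 \<eta>, residue_vec p3 \<eta>) = residue_triple c"
    if "\<eta> = pair_mult (kconst c) \<eta>\<^sub>0" for \<eta> c
    unfolding that residue_vec_\<eta>\<^sub>0 residue_triple_def by (simp add: z nz)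
  then show ?thesis
    unfolding log_normal_sheaf_eq
    using line_coord_iso[OF line_coord_H1 line_coord_complex_line, of "inv_into UNIV residue_class"]
      line_coord_iso[OF H0 line_coord_dual[OF line_coord_H1] serre_map_eq]
      line_coord_iso[OF H0 line_coord_residue_triples,
        of "\<lambda>\<eta>. (residue_vec p2 \<eta>, residue_vec p1 \<eta>, residue_vec p3 \<eta>)"]
    by (auto simp: inv_f_f inj_def residue_class_inj)
qed

end
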